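(* Let $0<p\le\infty$ and $0<q,q_0,q_1,r\le\infty$. Let $\beta_0,\beta_1\in\mathbb{R}$ with $\beta_0\ne\beta_1$ and $\theta\in(0,1)$. Then $$(\mathrm T^{p,q_0,r}_{\beta_0},\mathrm T^{p,q_1,r}_{\beta_1})_{\theta,q}=\mathrm Z^{p,q,r}_\beta,\qquad\text{where }\beta=(1-\theta)\beta_0+\theta\beta_1.$$
   Context: The symbol ⨍ denotes the mean-value integral and $B(x,t)$ the open ball in $\mathbb{R}^d$; $\mathbb{R}^{d+1}_+=(0,\infty)\times\mathbb{R}^d$. For $0<r\le\infty$, $\beta\in\mathbb{R}$ and measurable $f$ on $\mathbb{R}^{d+1}_+$ write $W_{r,\beta}f(t,x)=\big(⨍_{t/2}^t⨍_{B(x,t)}|s^{-\beta}f(s,y)|^r\,\mathrm{d}y\,\mathrm{d}s\big)^{1/r}$ (essential supremum of $|s^{-\beta}f(s,y)|$ over $(\frac t2,t]\times B(x,t)$ if $r=\infty$). For $0<p,q,r\le\infty$ the tent space $\mathrm T^{p,q,r}_\beta$ is the set of measurable $f$ with finite (quasi-)norm, where $$\|f\|_{\mathrm T^{p,q,r}_\beta}=\Big\|\Big(\int_0^\infty (W_{r,\beta}f(t,\cdot))^q\frac{\mathrm{d}t}{t}\Big)^{1/q}\Big\|_{L^p(\mathbb{R}^d)}\quad(p<\infty),$$ with $\operatorname{ess\,sup}_{t>0}$ in place of the $t$-integral if $q=\infty$; $$\|f\|_{\mathrm T^{\infty,q,r}_\beta}=\sup_{\tau>0}\sup_{y\in\mathbb{R}^d}\Big(\int_0^\tau⨍_{B(y,\tau)}(W_{r,\beta}f(t,x))^q\frac{\mathrm{d}x\,\mathrm{d}t}{t}\Big)^{1/q}\quad(q<\infty),\qquad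 \|f\|_{\mathrm T^{\infty,\infty,r}_\beta}=\sup_{t>0}\sup_{x\in\mathbb{R}^d}W_{r,\beta}f(t,x).$$ The space $\mathrm Z^{p,q,r}_\beta$ is the set of measurable $f$ on $\mathbb{R}^{d+1}_+$ with $\|f\|_{\mathrm Z^{p,q,r}_\beta}=\big(\int_0^\infty\|W_{r,\beta}f(t,\cdot)\|_{L^p(\mathbb{R}^d)}^q\frac{\mathrm{d}t}{t}\big)^{1/q}<\infty$ ($\operatorname{ess\,sup}_{t>0}$ if $q=\infty$). Real interpolation: for an interpolation couple $(X_0,X_1)$ of (quasi-)Banach spaces, $x\in X_0+X_1$ and $t>0$, let $K(t,x,X_0,X_1)=\inf\{\|x_0\|_{X_0}+t\|x_1\|_{X_1}:x=x_0+x_1,\ x_i\in X_i\}$. For $0<\theta<1$, $0<q\le\infty$, $(X_0,X_1)_{\theta,q}$ is the set of $x\in X_0+X_1$ with $\|x\|_{\theta,q}=\big(\int_0^\infty t^{-\theta q}K(t,x,X_0,X_1)^q\frac{\mathrm{d}t}{t}\big)^{1/q}<\infty$ (supremum over $t>0$ of $t^{-\theta}K$ if $q=\infty$). Equality of (quasi-)Banach spaces is understood as equality of sets with equivalent (quasi-)norms. *)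

theory Defs
  imports "HOL-Analysis.Analysis" "HOL-Probability.Essential_Supremum"
begin

text \<open>
  All exponents in \<open>(0, \<infinity>]\<close> are of type \<^typ>\<open>ennreal\<close>, and all (quasi-)norms are
  extended quasi-norms with values in \<^typ>\<open>ennreal\<close>; a space consists of the functions
  on which its quasi-norm is finite. Almost everywhere equivalence classes are represented by
  functions, which are total on \<open>\<real> \<times> \<real>\<^sup>d\<close>; their values outside the half-space
  \<open>(0, \<infinity>) \<times> \<real>\<^sup>d\<close> play no role.
\<close>

text \<open>The power \<open>x\<^sup>a\<close> for \<open>x \<in> [0, \<infinity>]\<close> and a finite exponent \<open>a > 0\<close>.\<close>

definition epow :: "ennreal \<Rightarrow> real \<Rightarrow> ennreal" where
  "epow x a = (if x = \<infinity> then \<infinity> else ennreal (enn2real x powr a))"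

definition Lnorm :: "'a measure \<Rightarrow> ennreal \<Rightarrow> ('a \<Rightarrow> ennreal) \<Rightarrow> ennreal" where
  "Lnorm M p g =
     (if p = \<infinity> then esssup M g
      else epow (\<integral>\<^sup>+ x. epow (g x) (enn2real p) \<partial>M) (1 / enn2real p))"

definition mean :: "'a measure \<Rightarrow> 'a set \<Rightarrow> ('a \<Rightarrow> ennreal) \<Rightarrow> ennreal" where
  "mean M A g = (\<integral>\<^sup>+ x\<in>A. g x \<partial>M) / emeasure M A"

text \<open>The measure \<open>dt/t\<close> on \<open>(0, \<infinity>)\<close>.\<close>

definition dtt :: "real measure" where
  "dtt = density (lebesgue_on {0<..}) (\<lambda>t. ennreal (1 / t))"

definition half_space :: "(real \<times> 'a::euclidean_space) set" where
  "half_space = {0<..} \<times> UNIV"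

definition whitney ::
  "ennreal \<Rightarrow> real \<Rightarrow> (real \<times> 'a::euclidean_space \<Rightarrow> complex) \<Rightarrow> real \<Rightarrow> 'a \<Rightarrow> ennreal" where
  "whitney r \<beta> f t x =
     (if r = \<infinity>
      then esssup (lebesgue_on ({t/2<..t} \<times> ball x t))
             (\<lambda>(s, y). ennreal (norm (s powr (-\<beta>) *\<^sub>R f (s, y))))
      else epow (mean lebesgue {t/2<..t} (\<lambda>s. mean lebesgue (ball x t)
             (\<lambda>y. ennreal (norm (s powr (-\<beta>) *\<^sub>R f (s, y)) powr enn2real r))))
           (1 / enn2real r))"

definition tent_norm ::
  "ennreal \<Rightarrow> ennreal \<Rightarrow> ennreal \<Rightarrow> real \<Rightarrow> (real \<times> 'a::euclidean_space \<Rightarrow> complex) \<Rightarrow> ennreal" where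
  "tent_norm p q r \<beta> f =
     (if p < \<infinity> then Lnorm lebesgue p (\<lambda>x. Lnorm dtt q (\<lambda>t. whitney r \<beta> f t x))
      else if q < \<infinity> then
        (SUP \<tau>\<in>{0<..}. SUP y.
           epow (\<integral>\<^sup>+ t\<in>{0<..<\<tau>}. mean lebesgue (ball y \<tau>)
                  (\<lambda>x. epow (whitney r \<beta> f t x) (enn2real q)) \<partial>dtt)
             (1 / enn2real q))
      else (SUP t\<in>{0<..}. SUP x. whitney r \<beta> f t x))"

definition Z_norm ::
  "ennreal \<Rightarrow> ennreal \<Rightarrow> ennreal \<Rightarrow> real \<Rightarrow> (real \<times> 'a::euclidean_space \<Rightarrow> complex) \<Rightarrow> ennreal" where
  "Z_norm p q r \<beta> f = Lnorm dtt q (\<lambda>t. Lnorm lebesgue p (whitney r \<beta> f t))"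

text \<open>A (quasi-)normed space of measurable functions: its elements and its (quasi-)norm.\<close>

record 'b qnspace =
  elems :: "'b set"
  qnorm :: "'b \<Rightarrow> ennreal"

definition tent_space ::
  "ennreal \<Rightarrow> ennreal \<Rightarrow> ennreal \<Rightarrow> real \<Rightarrow> (real \<times> 'a::euclidean_space \<Rightarrow> complex) qnspace" where
  "tent_space p q r \<beta> =
     \<lparr>elems = {f \<in> borel_measurable (lebesgue_on half_space). tent_norm p q r \<beta> f < \<infinity>},
      qnorm = tent_norm p q r \<beta>\<rparr>"

definition Z_space ::
  "ennreal \<Rightarrow> ennreal \<Rightarrow> ennreal \<Rightarrow> real \<Rightarrow> (real \<times> 'a::euclidean_space \<Rightarrow> complex) qnspace" where
  "Z_space p q r \<beta> =
     \<lparr>elems = {f \<in> borel_measurable (lebesgue_on half_space). Z_norm p q r \<beta> f < \<infinity>},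
      qnorm = Z_norm p q r \<beta>\<rparr>"

text \<open>
  Real interpolation of spaces of measurable functions on a measure space \<open>M\<close>, with equality
  of functions understood \<open>M\<close>-almost everywhere.
\<close>

definition decomps ::
  "'c measure \<Rightarrow> ('c \<Rightarrow> 'b::plus) qnspace \<Rightarrow> ('c \<Rightarrow> 'b) qnspace \<Rightarrow> ('c \<Rightarrow> 'b)
    \<Rightarrow> (('c \<Rightarrow> 'b) \<times> ('c \<Rightarrow> 'b)) set" where
  "decomps M X0 X1 f =
     {(f0, f1). f0 \<in> elems X0 \<and> f1 \<in> elems X1 \<and> (AE z in M. f z = f0 z + f1 z)}"

definition sum_elems ::
  "'c measure \<Rightarrow> ('c \<Rightarrow> 'b::{plus,topological_space}) qnspace \<Rightarrow> ('c \<Rightarrow> 'b) qnspace \<Rightarrow> ('c \<Rightarrow> 'b) set" where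
  "sum_elems M X0 X1 = {f \<in> borel_measurable M. decomps M X0 X1 f \<noteq> {}}"

definition K_functional ::
  "'c measure \<Rightarrow> real \<Rightarrow> ('c \<Rightarrow> 'b::plus) \<Rightarrow> ('c \<Rightarrow> 'b) qnspace \<Rightarrow> ('c \<Rightarrow> 'b) qnspace \<Rightarrow> ennreal" where
  "K_functional M t f X0 X1 =
     (INF (f0, f1)\<in>decomps M X0 X1 f. qnorm X0 f0 + ennreal t * qnorm X1 f1)"

definition interp_norm ::
  "'c measure \<Rightarrow> ('c \<Rightarrow> 'b::plus) qnspace \<Rightarrow> ('c \<Rightarrow> 'b) qnspace \<Rightarrow> real \<Rightarrow> ennreal \<Rightarrow> ('c \<Rightarrow> 'b) \<Rightarrow> ennreal" where
  "interp_norm M X0 X1 \<theta> q f =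
     (if q = \<infinity> then (SUP t\<in>{0<..}. ennreal (t powr (-\<theta>)) * K_functional M t f X0 X1)
      else epow (\<integral>\<^sup>+ t. ennreal (t powr (-\<theta> * enn2real q))
                     * epow (K_functional M t f X0 X1) (enn2real q) \<partial>dtt)
             (1 / enn2real q))"

definition real_interp ::
  "'c measure \<Rightarrow> ('c \<Rightarrow> 'b::{plus,topological_space}) qnspace \<Rightarrow> ('c \<Rightarrow> 'b) qnspace \<Rightarrow> real \<Rightarrow> ennreal
    \<Rightarrow> ('c \<Rightarrow> 'b) qnspace" where
  "real_interp M X0 X1 \<theta> q =
     \<lparr>elems = {f \<in> sum_elems M X0 X1. interp_norm M X0 X1 \<theta> q f < \<infinity>},
      qnorm = interp_norm M X0 X1 \<theta> q\<rparr>"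

text \<open>Equality of sets with equivalent (quasi-)norms.\<close>

definition qn_equal :: "'b qnspace \<Rightarrow> 'b qnspace \<Rightarrow> bool" where
  "qn_equal X Y \<longleftrightarrow> elems X = elems Y \<and>
     (\<exists>c C :: real. 0 < c \<and> 0 < C \<and>
        (\<forall>f\<in>elems X. ennreal c * qnorm X f \<le> qnorm Y f \<and> qnorm Y f \<le> ennreal C * qnorm X f))"

end

theory Submission
  imports Defs
begin

text \<open>
  Cut the half-space into strips \<open>t \<sim> T\<^sub>k = e\<^bsup>k/8\<^esup>\<close> and put
  \<open>b\<^sub>k = T\<^sub>k\<^bsup>-\<beta>\<^esup> \<parallel>W\<^sub>r f(T\<^sub>k, \<cdot>)\<parallel>\<^sub>p\<close>. A Whitney box at one scale is covered by finitely many
  translates of Whitney boxes at the two neighbouring scales, and the \<open>L\<^sup>p\<close> quasi-norm is translation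
  invariant, so the Z-norm is equivalent to the \<open>\<ell>\<^sup>q\<close> quasi-norm of \<open>b\<close>, and the tent norm dominates
  each \<open>b\<^sub>k\<close>. Conversely, \<open>b\<^sub>k \<le> A e\<^bsup>-\<epsilon>|k-n|\<^esup>\<close> for all \<open>k\<close> bounds the tent norm by a multiple of \<open>A\<close>,
  whatever the inner exponent: an \<open>\<ell>\<^sup>q\<close> sum costs only a slightly weaker exponential weight compared with a
  supremum, and \<open>(sup\<^sub>k g\<^sub>k)\<^sup>p \<le> \<Sum>\<^sub>k g\<^sub>k\<^sup>p\<close>. The first fact bounds the K-functional at \<open>T\<^sub>n\<^bsup>\<beta>\<^sub>1-\<beta>\<^sub>0\<^esup>\<close> from
  below by \<open>b\<^sub>n\<close>; the second one, applied to the parts of \<open>f\<close> above and below height \<open>T\<^sub>n\<close>, bounds it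
  from above by \<open>sup\<^sub>k e\<^bsup>-\<delta>|k-n|\<^esup> b\<^sub>k\<close>, both up to the factor \<open>T\<^sub>n\<^bsup>\<theta>(\<beta>\<^sub>1-\<beta>\<^sub>0)\<^esup>\<close>.
\<close>

subsection \<open>Powers and Lebesgue quasi-norms\<close>

text \<open>Exponents below 1 rule out a triangle inequality for countable families. Quasi-triangle
  inequalities are therefore applied only to finite families of fixed size, while countable ones
  enter through suprema and sums of powers, where Tonelli applies.

  One neighbouring scale cannot cover a box: a lower box misses its top, a higher one its bottom, so
  the strip above covers the upper heights and the strip below the rest. The step 1/8 makes three
  steps cost at most a factor 2, which is what this covering needs.

  Lower bounds go through the infimum of the averages over a strip and a small ball. Such an infimum
  is dominated alike by \<open>dt/t\<close>-integrals, by means over balls and by essential suprema,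
  so all endpoint forms of the tent norm are reached by one estimate.

  Since \<beta> lies strictly between \<beta>0 and \<beta>1, cutting at one height leaves geometric
  decay on both sides, each part placed in the space where it decays. This decay absorbs any inner
  exponent, which is why q0 and q1 leave no trace in the result.\<close>

lemma epow_top [simp]: "epow top a = top"
  by (simp add: epow_def)

lemma epow_ennreal: "0 \<le> c \<Longrightarrow> epow (ennreal c) a = ennreal (c powr a)"
  by (simp add: epow_def)

lemma epow_0 [simp]: "epow 0 a = 0"
  by (simp add: epow_def)

lemma epow_one [simp]: "epow x 1 = x"
  by (cases x) (auto simp: epow_ennreal)

lemma epow_mono: "0 \<le> a \<Longrightarrow> x \<le> y \<Longrightarrow> epow x a \<le> epow y a"
  by (cases x; cases y) (auto simp: epow_ennreal powr_mono2 top_unique)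

lemma epow_mult: "epow (x * y) a = epow x a * epow y a"
proof (cases x; cases y)
  fix r s assume "0 \<le> r" "x = ennreal r" "0 \<le> s" "y = ennreal s"
  then show ?thesis
    by (simp add: epow_ennreal powr_mult flip: ennreal_mult)
qed (auto simp: ennreal_mult_top ennreal_top_mult epow_ennreal)

lemma epow_epow: "epow (epow x a) b = epow x (a * b)"
  by (cases x) (auto simp: epow_ennreal powr_powr)

lemma epow_inverse [simp]: "0 < a \<Longrightarrow> epow (epow x a) (1 / a) = x" "0 < a \<Longrightarrow> epow (epow x (1 / a)) a = x"
  by (simp_all add: epow_epow)

text \<open>Bounding \<open>x + y\<close> by twice the maximum treats convex and concave powers
  alike, so no case distinction at a = 1 arises.\<close>

lemma epow_add_le:
  assumes "0 \<le> a"
  shows "epow (x + y) a \<le> ennreal (2 powr a) * (epow x a + epow y a)"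
proof -
  have "epow (x + y) a \<le> epow (ennreal 2 * max x y) a"
    using assms by (intro epow_mono) (auto simp: mult_2 max_def add_mono)
  also have "\<dots> = ennreal (2 powr a) * epow (max x y) a"
    by (subst epow_mult) (subst epow_ennreal, auto)
  also have "\<dots> \<le> ennreal (2 powr a) * (epow x a + epow y a)"
    by (intro mult_left_mono) (auto simp: max_def)
  finally show ?thesis .
qed

lemma epow_eq_top_iff [simp]: "epow x a = top \<longleftrightarrow> x = top"
  by (cases x) (auto simp: epow_ennreal)

lemma epow_measurable [measurable]: "(\<lambda>x. epow x a) \<in> borel_measurable borel"
  unfolding epow_def by measurable

text \<open>Each \<open>g k\<close> is at most the (1/a)-th power of the sum; raising the supremum
  back to the power \<open>a\<close> finishes without any continuity argument for
  \<open>epow\<close>.\<close>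

lemma epow_SUP_le:
  fixes g :: "'i::countable \<Rightarrow> ennreal"
  assumes "0 < a"
  shows "epow (SUP k. g k) a \<le> (\<integral>\<^sup>+k. epow (g k) a \<partial>count_space UNIV)"
proof -
  let ?S = "\<integral>\<^sup>+k. epow (g k) a \<partial>count_space UNIV"
  have "g k \<le> epow ?S (1 / a)" for k
  proof -
    have "epow (g k) a \<le> ?S"
      by (rule nn_integral_ge_point) simp
    from epow_mono[OF _ this, of "1 / a"] show ?thesis using assms by simp
  qed
  then have "(SUP k. g k) \<le> epow ?S (1 / a)"
    by (rule SUP_least)
  from epow_mono[OF _ this, of a] show ?thesis using assms by simp
qed

lemma enn2real_pos: "0 < p \<Longrightarrow> p \<noteq> top \<Longrightarrow> 0 < enn2real p"
  by (simp add: enn2real_positive_iff less_top)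

lemma Lnorm_top: "Lnorm M top g = esssup M g"
  by (simp add: Lnorm_def)

lemma Lnorm_finite:
  "p \<noteq> top \<Longrightarrow> Lnorm M p g = epow (\<integral>\<^sup>+ x. epow (g x) (enn2real p) \<partial>M) (1 / enn2real p)"
  by (simp add: Lnorm_def)

text \<open>The library's \<open>esssup\<close> returns \<open>top\<close> on non-measurable
  functions, so the measurability test has to be transported along with the
  \<open>Limsup\<close>.\<close>

lemma Lnorm_cong: "(\<And>x. x \<in> space M \<Longrightarrow> f x = g x) \<Longrightarrow> Lnorm M p f = Lnorm M p g"
  unfolding Lnorm_def esssup_def
  by (intro if_cong refl arg_cong2[where f=epow] nn_integral_cong)
     (auto cong: measurable_cong intro!: Limsup_eq)

text \<open>The comparison survives a non-measurable \<open>g\<close>: its \<open>esssup\<close> is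
  \<open>top\<close>, and \<open>nn_integral\<close>, a supremum over simple functions from below,
  is monotone on all functions.\<close>

lemma Lnorm_mono_AE:
  assumes "0 < p" "f \<in> borel_measurable M" "AE x in M. f x \<le> g x"
  shows "Lnorm M p f \<le> Lnorm M p g"
proof (cases "p = top")
  case True then show ?thesis using assms by (simp add: Lnorm_top esssup_AE_mono)
next
  case False
  then show ?thesis unfolding Lnorm_finite[OF False] using assms enn2real_pos[of p]
    by (intro epow_mono nn_integral_mono_AE) (auto elim!: eventually_mono intro!: epow_mono)
qed

lemma Lnorm_mono:
  assumes "0 < p" "f \<in> borel_measurable M" "\<And>x. x \<in> space M \<Longrightarrow> f x \<le> g x"
  shows "Lnorm M p f \<le> Lnorm M p g"
  using assms by (intro Lnorm_mono_AE) auto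

lemma Lnorm_zero: "0 < p \<Longrightarrow> Lnorm M p (\<lambda>x. 0) = 0"
  using esssup_I[of "\<lambda>x. 0 :: ennreal" M 0]
  by (cases "p = top") (auto simp: Lnorm_top Lnorm_finite)

lemma esssup_cmult_ennreal:
  assumes "f \<in> borel_measurable M"
  shows "esssup M (\<lambda>x. c * f x) \<le> c * esssup M (f :: _ \<Rightarrow> ennreal)"
  using assms esssup_AE[of f M] by (intro esssup_I) (auto elim!: eventually_mono intro: mult_left_mono)

lemma Lnorm_cmult_le:
  assumes "0 < p" "f \<in> borel_measurable M"
  shows "Lnorm M p (\<lambda>x. c * f x) \<le> c * Lnorm M p f"
proof (cases "p = top")
  case True then show ?thesis using assms esssup_cmult_ennreal by (simp add: Lnorm_top)
next
  case False
  then show ?thesis using assms enn2real_pos[OF assms(1) False]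
    by (simp add: Lnorm_finite epow_mult nn_integral_cmult)
qed

text \<open>\<open>Lnorm_cmult_le\<close> is used twice, with \<open>c\<close> and with its inverse;
  this is where \<open>0 < c < top\<close> enters.\<close>

lemma Lnorm_cmult:
  assumes "0 < p" "f \<in> borel_measurable M" "0 < c" "c < top"
  shows "Lnorm M p (\<lambda>x. c * f x) = c * Lnorm M p f"
proof (rule antisym[OF Lnorm_cmult_le])
  have "inverse c * c = 1"
    using assms(3,4) by (cases c) (auto simp: inverse_ennreal ennreal_mult[symmetric])
  then have *: "c * (inverse c * y) = y" "inverse c * (c * y) = y" for y
    by (metis mult.assoc mult.commute mult_1)+
  have "Lnorm M p f = Lnorm M p (\<lambda>x. inverse c * (c * f x))"
    by (simp add: *)
  also have "\<dots> \<le> inverse c * Lnorm M p (\<lambda>x. c * f x)"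
    using assms by (intro Lnorm_cmult_le) auto
  finally have "c * Lnorm M p f \<le> c * (inverse c * Lnorm M p (\<lambda>x. c * f x))"
    by (rule mult_left_mono) simp
  then show "c * Lnorm M p f \<le> Lnorm M p (\<lambda>x. c * f x)" by (simp add: *)
qed (use assms in auto)

text \<open>For \<open>p = \<infinity>\<close> the junk values \<open>enn2real \<infinity> = 0\<close> and \<open>1 / 0 = 0\<close> give the constant 2.\<close>

definition Lconst :: "ennreal \<Rightarrow> ennreal" where
  "Lconst p = ennreal (2 * 2 powr (1 / enn2real p))"

lemma Lconst_bounds: "1 \<le> Lconst p" "Lconst p < top"
proof -
  have "1 * 1 \<le> 2 * 2 powr (1 / enn2real p)"
    by (intro mult_mono ge_one_powr_ge_zero) auto
  then show "1 \<le> Lconst p" "Lconst p < top"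
    unfolding Lconst_def by (auto simp: ennreal_1[symmetric] simp del: ennreal_1)
qed

text \<open>\<open>epow_add_le\<close> acts twice: with the exponent \<open>a\<close> under the
  integral, which leaves the factor \<open>(2 powr a) powr (1 / a) = 2\<close>, and with
  \<open>1 / a\<close> outside, which gives \<open>2 powr (1 / a)\<close>.\<close>

lemma Lnorm_add_le:
  assumes "0 < p" and [measurable]: "f \<in> borel_measurable M" "g \<in> borel_measurable M"
  shows "Lnorm M p (\<lambda>x. f x + g x) \<le> Lconst p * (Lnorm M p f + Lnorm M p g)"
proof (cases "p = top")
  case True
  have "AE x in M. f x + g x \<le> esssup M f + esssup M g"
    using esssup_AE[of f M] esssup_AE[of g M] by eventually_elim (rule add_mono)
  then have "esssup M (\<lambda>x. f x + g x) \<le> 1 * (esssup M f + esssup M g)"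
    by (simp add: esssup_I)
  also have "\<dots> \<le> Lconst p * (esssup M f + esssup M g)"
    by (intro mult_right_mono Lconst_bounds) auto
  finally show ?thesis by (simp add: Lnorm_top True)
next
  case False
  define a where "a = enn2real p"
  have a: "0 < a" using assms False enn2real_pos by (simp add: a_def)
  let ?F = "\<integral>\<^sup>+x. epow (f x) a \<partial>M" and ?G = "\<integral>\<^sup>+x. epow (g x) a \<partial>M"
  have "(\<integral>\<^sup>+x. epow (f x + g x) a \<partial>M) \<le> (\<integral>\<^sup>+x. ennreal (2 powr a) * (epow (f x) a + epow (g x) a) \<partial>M)"
    using a by (intro nn_integral_mono epow_add_le) auto
  also have "\<dots> = ennreal (2 powr a) * (?F + ?G)"
    by (simp add: nn_integral_cmult nn_integral_add)
  finally have "epow (\<integral>\<^sup>+x. epow (f x + g x) a \<partial>M) (1 / a) \<le> epow (ennreal (2 powr a) * (?F + ?G)) (1 / a)"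
    using a by (intro epow_mono) auto
  also have "\<dots> = ennreal 2 * epow (?F + ?G) (1 / a)"
    using a by (simp add: epow_mult epow_ennreal powr_powr)
  also have "\<dots> \<le> ennreal 2 * (ennreal (2 powr (1 / a)) * (epow ?F (1 / a) + epow ?G (1 / a)))"
    using a by (intro mult_left_mono epow_add_le) auto
  also have "\<dots> = Lconst p * (epow ?F (1 / a) + epow ?G (1 / a))"
    by (simp add: Lconst_def a_def mult.assoc ennreal_mult)
  finally show ?thesis by (simp add: Lnorm_finite False a_def)
qed

text \<open>The quasi-triangle constant is paid once per summand. The crude power is harmless
  because the sums that occur run over the fixed finite net \<open>cover_net\<close>.\<close>

lemma Lnorm_sum_le:
  assumes "0 < p" "finite I" "\<And>i. i \<in> I \<Longrightarrow> f i \<in> borel_measurable M"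
  shows "Lnorm M p (\<lambda>x. \<Sum>i\<in>I. f i x) \<le> Lconst p ^ card I * (\<Sum>i\<in>I. Lnorm M p (f i))"
  using assms(2,3)
proof (induction I rule: finite_induct)
  case empty
  then show ?case using assms(1) by (simp add: Lnorm_zero)
next
  case (insert i I)
  have "Lnorm M p (\<lambda>x. \<Sum>i\<in>insert i I. f i x) = Lnorm M p (\<lambda>x. f i x + (\<Sum>i\<in>I. f i x))"
    using insert by simp
  also have "\<dots> \<le> Lconst p * (Lnorm M p (f i) + Lnorm M p (\<lambda>x. \<Sum>i\<in>I. f i x))"
    using insert.prems assms(1) by (intro Lnorm_add_le borel_measurable_sum) auto
  also have "\<dots> \<le> Lconst p * (Lconst p ^ card I * Lnorm M p (f i) + Lconst p ^ card I * (\<Sum>i\<in>I. Lnorm M p (f i)))"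
    using insert mult_right_mono[OF one_le_power[OF Lconst_bounds(1)], of "Lnorm M p (f i)" p "card I"]
    by (intro mult_left_mono add_mono) auto
  also have "\<dots> = Lconst p ^ card (insert i I) * (\<Sum>i\<in>insert i I. Lnorm M p (f i))"
    using insert by (simp add: algebra_simps)
  finally show ?case .
qed

section \<open>Measurable dependence on a parameter, and changes of the underlying measure\<close>

lemma esssup_measurable_param:
  fixes g :: "'c \<Rightarrow> 'b \<Rightarrow> ennreal"
  assumes "sigma_finite_measure M"
    and g: "case_prod g \<in> borel_measurable (N \<Otimes>\<^sub>M M)"
  shows "(\<lambda>x. esssup M (g x)) \<in> borel_measurable N"
proof (rule borel_measurableI_le)
  fix c
  interpret sigma_finite_measure M by fact
  note g [measurable]
  have gx [measurable]: "g x \<in> borel_measurable M" if "x \<in> space N" for x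
    using measurable_Pair2[OF g that] by simp
  \<comment> \<open>The essential supremum is at most \<open>c\<close> exactly when the superlevel
    set is null, and the measure of that set depends measurably on the parameter.\<close>
  have *: "esssup M (g x) \<le> c \<longleftrightarrow> (\<integral>\<^sup>+z. indicator {z. c < g x z} z \<partial>M) = 0" if "x \<in> space N" for x
  proof -
    note [measurable] = gx[OF that]
    have "(\<integral>\<^sup>+z. indicator {z. c < g x z} z \<partial>M) = 0 \<longleftrightarrow> (AE z in M. g x z \<le> c)"
      by (subst nn_integral_0_iff_AE) (auto simp: indicator_def intro!: eventually_subst)
    also have "\<dots> \<longleftrightarrow> esssup M (g x) \<le> c"
      using esssup_AE[of "g x" M] gx[OF that] by (auto elim!: eventually_mono)
    finally show ?thesis by simp
  qed
  have "{x \<in> space N. esssup M (g x) \<le> c} = {x \<in> space N. (\<integral>\<^sup>+z. indicator {z. c < g x z} z \<partial>M) = 0}"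
    using * by auto
  also have "\<dots> \<in> sets N"
    by measurable
  finally show "{x \<in> space N. esssup M (g x) \<le> c} \<in> sets N" .
qed

lemma Lnorm_measurable_param:
  fixes g :: "'c \<Rightarrow> 'b \<Rightarrow> ennreal"
  assumes "sigma_finite_measure M"
    and g: "case_prod g \<in> borel_measurable (N \<Otimes>\<^sub>M M)"
  shows "(\<lambda>x. Lnorm M p (g x)) \<in> borel_measurable N"
proof (cases "p = top")
  case True
  then show ?thesis using esssup_measurable_param[OF assms] by (simp add: Lnorm_top)
next
  case False
  interpret sigma_finite_measure M by fact
  note g [measurable]
  show ?thesis unfolding Lnorm_finite[OF False] by measurable
qed

lemma Lnorm_completion:
  assumes "0 < p" "g \<in> borel_measurable M"
  shows "Lnorm (completion M) p g = Lnorm M p g"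
proof (cases "p = top")
  case True
  have "g \<in> borel_measurable (completion M)" using assms measurable_completion by auto
  then show ?thesis using assms
    by (simp add: True Lnorm_top esssup_eq_AE AE_completion_iff)
qed (simp add: Lnorm_finite nn_integral_completion)

lemma Lnorm_distr:
  assumes "0 < p" "T \<in> measurable M N" "g \<in> borel_measurable N"
  shows "Lnorm (distr M N T) p g = Lnorm M p (\<lambda>x. g (T x))"
proof (cases "p = top")
  case True
  have [measurable]: "T \<in> measurable M N" "g \<in> borel_measurable N" by fact+
  have "(AE x in distr M N T. g x \<le> z) \<longleftrightarrow> (AE x in M. g (T x) \<le> z)" for z
    by (subst AE_distr_iff) auto
  then show ?thesis
    by (simp add: True Lnorm_top esssup_eq_AE)
qed (use assms in \<open>simp add: Lnorm_finite nn_integral_distr\<close>)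

lemma Lnorm_translate:
  fixes g :: "'a::euclidean_space \<Rightarrow> ennreal"
  assumes "0 < p" "g \<in> borel_measurable borel"
  shows "Lnorm lborel p (\<lambda>x. g (x + c)) = Lnorm lborel p g"
proof -
  have "Lnorm lborel p g = Lnorm (distr lborel borel ((+) c)) p g"
    by (subst lborel_distr_plus) simp
  also have "\<dots> = Lnorm lborel p (\<lambda>x. g (c + x))"
    using assms by (subst Lnorm_distr) (auto simp: measurable_lborel1)
  finally show ?thesis by (simp add: add.commute)
qed

lemma Lnorm_count_space_top: "Lnorm (count_space UNIV) top c = (SUP k. c k)"
  unfolding Lnorm_top
  by (intro antisym esssup_I SUP_least)
     (use esssup_AE[of c "count_space UNIV"] in \<open>auto simp: AE_count_space intro: SUP_upper\<close>)

lemma Lnorm_count_space_bij: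
  assumes "bij \<phi>"
  shows "Lnorm (count_space UNIV) q (\<lambda>k. c (\<phi> k)) = Lnorm (count_space UNIV) q c"
proof (cases "q = top")
  case True
  have "range (\<lambda>k. c (\<phi> k)) = range c"
    using bij_is_surj[OF assms] by (metis image_image)
  then show ?thesis unfolding True Lnorm_count_space_top by simp
next
  case False
  show ?thesis
    using nn_integral_bij_count_space[OF assms, of "\<lambda>k. epow (c k) (enn2real q)"]
    by (simp add: Lnorm_finite[OF False])
qed

lemma Lnorm_count_space_ge:
  assumes "0 < q"
  shows "c k \<le> Lnorm (count_space UNIV) q c"
proof (cases "q = top")
  case True then show ?thesis by (simp add: Lnorm_count_space_top SUP_upper)
next
  case False
  have "epow (c k) (enn2real q) \<le> (\<integral>\<^sup>+k. epow (c k) (enn2real q) \<partial>count_space UNIV)"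
    by (rule nn_integral_ge_point) simp
  from epow_mono[OF _ this, of "1 / enn2real q"] show ?thesis
    using enn2real_pos[OF assms False] by (simp add: Lnorm_finite[OF False])
qed

subsection \<open>Discretization of the measure dt/t\<close>

text \<open>Whitney averages turn out to be jointly Borel in position and scale. Measuring them
  against a sigma-finite version of dt/t on the Borel sets makes parameter-dependent norms
  measurable; \<open>Lnorm_dtt\<close> transfers the result to \<open>dtt\<close>.\<close>

definition dtt_borel :: "real measure" where
  "dtt_borel = density lborel (\<lambda>t. ennreal (1 / t) * indicator {0<..} t)"

lemma sets_dtt_borel [measurable_cong]: "sets dtt_borel = sets borel"
  by (simp add: dtt_borel_def)

lemma sigma_finite_dtt_borel: "sigma_finite_measure dtt_borel"
  unfolding dtt_borel_def
  by (subst sigma_finite_measure.sigma_finite_iff_density_finite'[OF sigma_finite_lborel]) (auto simp: ennreal_mult_eq_top_iff indicator_def)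

lemma space_dtt [simp]: "space dtt = {0<..}"
  by (simp add: dtt_def)

lemma measurable_dtt: "F \<in> borel_measurable borel \<Longrightarrow> F \<in> borel_measurable dtt"
  unfolding dtt_def measurable_density_eq1
  by (intro measurable_restrict_space1 measurable_completion) auto

lemma nn_integral_dtt:
  assumes [measurable]: "F \<in> borel_measurable borel"
  shows "(\<integral>\<^sup>+t. F t \<partial>dtt) = (\<integral>\<^sup>+t. F t \<partial>dtt_borel)"
proof -
  have [measurable]: "F \<in> borel_measurable lebesgue"
    "(\<lambda>t::real. ennreal (1 / t)) \<in> borel_measurable lebesgue"
    by (auto intro!: measurable_completion)
  have "(\<integral>\<^sup>+t. F t \<partial>dtt) = (\<integral>\<^sup>+t. ennreal (1 / t) * F t \<partial>lebesgue_on {0<..})"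
    unfolding dtt_def by (intro nn_integral_density measurable_restrict_space1) auto
  also have "\<dots> = (\<integral>\<^sup>+t. ennreal (1 / t) * F t * indicator {0<..} t \<partial>lebesgue)"
    by (subst nn_integral_restrict_space) auto
  also have "\<dots> = (\<integral>\<^sup>+t. (ennreal (1 / t) * indicator {0<..} t) * F t \<partial>lborel)"
    by (simp add: nn_integral_completion mult_ac)
  also have "\<dots> = (\<integral>\<^sup>+t. F t \<partial>dtt_borel)"
    unfolding dtt_borel_def by (intro nn_integral_density[symmetric]) auto
  finally show ?thesis .
qed

lemma AE_dtt: "(AE t in dtt. P t) \<longleftrightarrow> (AE t in dtt_borel. P t)"
proof -
  have [measurable]: "(\<lambda>t::real. ennreal (1 / t)) \<in> borel_measurable lebesgue"
    by (auto intro!: measurable_completion)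
  have "(AE t in dtt. P t) \<longleftrightarrow> (AE t in lebesgue_on {0<..}. 0 < ennreal (1 / t) \<longrightarrow> P t)"
    unfolding dtt_def by (intro AE_density measurable_restrict_space1) auto
  also have "\<dots> \<longleftrightarrow> (AE t in lebesgue. 0 < t \<longrightarrow> P t)"
    by (subst AE_restrict_space_iff) auto
  also have "\<dots> \<longleftrightarrow> (AE t in lborel. 0 < t \<longrightarrow> P t)"
    by (simp add: AE_completion_iff)
  also have "\<dots> \<longleftrightarrow> (AE t in dtt_borel. P t)"
    unfolding dtt_borel_def
    by (subst AE_density) (auto intro!: eventually_subst simp: indicator_def)
  finally show ?thesis .
qed

lemma Lnorm_dtt:
  assumes [measurable]: "F \<in> borel_measurable borel"
  shows "Lnorm dtt q F = Lnorm dtt_borel q F"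
proof (cases "q = top")
  case True
  have "F \<in> borel_measurable dtt_borel" by measurable
  then show ?thesis using measurable_dtt[OF assms]
    by (simp add: True Lnorm_top esssup_eq_AE AE_dtt)
qed (simp add: Lnorm_finite nn_integral_dtt)

lemma Lnorm_dtt_measurable_param:
  assumes g: "case_prod g \<in> borel_measurable (borel \<Otimes>\<^sub>M borel)"
  shows "(\<lambda>x. Lnorm dtt q (g x)) \<in> borel_measurable borel"
proof -
  have "g x \<in> borel_measurable borel" for x
    using measurable_Pair2[OF g, of x] by simp
  then have "(\<lambda>x. Lnorm dtt q (g x)) = (\<lambda>x. Lnorm dtt_borel q (g x))"
    by (intro ext Lnorm_dtt)
  also have "\<dots> \<in> borel_measurable borel"
    using g by (intro Lnorm_measurable_param sigma_finite_dtt_borel)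
      (simp cong: measurable_cong_sets add: sets_pair_measure_cong[OF refl sets_dtt_borel])
  finally show ?thesis .
qed

definition strip :: "real \<Rightarrow> int \<Rightarrow> real set" where
  "strip h k = {t. 0 < t \<and> \<lceil>ln t / h\<rceil> = k}"

lemma strip_iff: "t \<in> strip h k \<longleftrightarrow> 0 < t \<and> of_int k - 1 < ln t / h \<and> ln t / h \<le> of_int k"
  by (auto simp: strip_def ceiling_eq_iff)

lemma strip_iff_pos:
  assumes "0 < h"
  shows "t \<in> strip h k \<longleftrightarrow> exp (h * (of_int k - 1)) < t \<and> t \<le> exp (h * of_int k)"
proof (cases "0 < t")
  case True
  have "of_int k - 1 < ln t / h \<longleftrightarrow> h * (of_int k - 1) < ln t"
    using assms by (simp add: pos_less_divide_eq mult.commute)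
  also have "\<dots> \<longleftrightarrow> exp (h * (of_int k - 1)) < t"
    using True by (metis exp_less_cancel_iff exp_ln)
  finally have 1: "of_int k - 1 < ln t / h \<longleftrightarrow> exp (h * (of_int k - 1)) < t" .
  have "ln t / h \<le> of_int k \<longleftrightarrow> ln t \<le> h * of_int k"
    using assms by (simp add: pos_divide_le_eq mult.commute)
  also have "\<dots> \<longleftrightarrow> t \<le> exp (h * of_int k)"
    using True by (metis exp_le_cancel_iff exp_ln)
  finally show ?thesis using True 1 by (simp add: strip_iff)
next
  case False
  moreover have "\<not> exp (h * (of_int k - 1)) < t"
    using False exp_gt_zero[of "h * (of_int k - 1)"] by linarith
  ultimately show ?thesis by (simp add: strip_iff)
qed

lemma strip_iff_neg:
  assumes "h < 0"
  shows "t \<in> strip h k \<longleftrightarrow> exp (h * of_int k) \<le> t \<and> t < exp (h * (of_int k - 1))"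
proof (cases "0 < t")
  case True
  have "of_int k - 1 < ln t / h \<longleftrightarrow> ln t < h * (of_int k - 1)"
    using assms by (simp add: neg_less_divide_eq mult.commute)
  also have "\<dots> \<longleftrightarrow> t < exp (h * (of_int k - 1))"
    using True by (metis exp_less_cancel_iff exp_ln)
  finally have 1: "of_int k - 1 < ln t / h \<longleftrightarrow> t < exp (h * (of_int k - 1))" .
  have "ln t / h \<le> of_int k \<longleftrightarrow> h * of_int k \<le> ln t"
    using assms by (simp add: neg_divide_le_eq mult.commute)
  also have "\<dots> \<longleftrightarrow> exp (h * of_int k) \<le> t"
    using True by (metis exp_le_cancel_iff exp_ln)
  finally show ?thesis using True 1 by (auto simp: strip_iff)
qed (auto simp: strip_iff not_less dest: order.strict_trans2[OF exp_gt_zero])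

lemma strip_borel [measurable]: "strip h k \<in> sets borel"
proof -
  have "strip h k = {t. 0 < t \<and> of_int k - 1 < ln t / h \<and> ln t / h \<le> of_int k}"
    by (auto simp: strip_iff)
  then show ?thesis by simp
qed

lemma strip_dtt [measurable]: "strip h k \<in> sets dtt"
proof -
  have "strip h k \<subseteq> {0<..}" by (auto simp: strip_def)
  moreover have "strip h k \<in> sets lebesgue" by (intro sets_completionI_sets) simp
  ultimately show ?thesis by (simp add: dtt_def sets_restrict_space_iff)
qed

lemma nn_integral_inverse_Icc:
  assumes "0 < a" "a \<le> b"
  shows "(\<integral>\<^sup>+t. ennreal (1 / t) * indicator {a..b} t \<partial>lborel) = ennreal (ln b - ln a)"
proof (rule nn_integral_FTC_Icc)
  fix t assume "t \<in> {a..b}"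
  then show "(ln has_real_derivative 1 / t) (at t)" "0 \<le> 1 / t"
    using assms DERIV_ln_divide[of t] by auto
qed (use assms in auto)

lemma emeasure_dtt_strip:
  assumes "h \<noteq> 0"
  shows "emeasure dtt (strip h k) = ennreal \<bar>h\<bar>"
proof -
  define a where "a = exp (min (h * of_int k) (h * (of_int k - 1)))"
  define b where "b = exp (max (h * of_int k) (h * (of_int k - 1)))"
  have ab: "0 < a" "a \<le> b" "ln b - ln a = \<bar>h\<bar>"
    by (auto simp: a_def b_def algebra_simps max_def min_def)
  \<comment> \<open>The sign of \<open>h\<close> decides which endpoint belongs to the strip; off
    these two null points both cases agree with the closed interval.\<close>
  have strip: "t \<in> strip h k \<longleftrightarrow> t \<in> {a..b}" if "t \<noteq> a" "t \<noteq> b" for t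
    using that assms by (cases "0 < h")
      (auto simp: a_def b_def strip_iff_pos strip_iff_neg algebra_simps max_def min_def)
  have "emeasure dtt (strip h k) = (\<integral>\<^sup>+t. indicator (strip h k) t \<partial>dtt)"
    by simp
  also have "\<dots> = (\<integral>\<^sup>+t. indicator (strip h k) t \<partial>dtt_borel)"
    by (rule nn_integral_dtt) simp
  also have "\<dots> = (\<integral>\<^sup>+t. (ennreal (1 / t) * indicator {0<..} t) * indicator (strip h k) t \<partial>lborel)"
    unfolding dtt_borel_def by (intro nn_integral_density) auto
  also have "\<dots> = (\<integral>\<^sup>+t. ennreal (1 / t) * indicator {a..b} t \<partial>lborel)"
  proof (rule nn_integral_cong_AE)
    show "AE t in lborel. ennreal (1 / t) * indicator {0<..} t * indicator (strip h k) t
        = ennreal (1 / t) * indicator {a..b} t"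
      using AE_lborel_singleton[of a] AE_lborel_singleton[of b]
      by eventually_elim (use strip ab in \<open>auto simp: indicator_def\<close>)
  qed
  also have "\<dots> = ennreal \<bar>h\<bar>"
    using ab nn_integral_inverse_Icc by simp
  finally show ?thesis .
qed

lemma nn_integral_strips:
  assumes "h \<noteq> 0"
  shows "(\<integral>\<^sup>+t. (\<integral>\<^sup>+k. c k * indicator (strip h k) t \<partial>count_space UNIV) \<partial>dtt)
    = ennreal \<bar>h\<bar> * (\<integral>\<^sup>+k. c k \<partial>count_space UNIV)"
proof -
  have "(\<integral>\<^sup>+t. (\<integral>\<^sup>+k. c k * indicator (strip h k) t \<partial>count_space UNIV) \<partial>dtt)
    = (\<integral>\<^sup>+k. (\<integral>\<^sup>+t. c k * indicator (strip h k) t \<partial>dtt) \<partial>count_space UNIV)"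
    by (rule nn_integral_count_space_nn_integral) auto
  also have "\<dots> = (\<integral>\<^sup>+k. ennreal \<bar>h\<bar> * c k \<partial>count_space UNIV)"
    by (simp add: nn_integral_cmult_indicator emeasure_dtt_strip assms mult.commute)
  also have "\<dots> = ennreal \<bar>h\<bar> * (\<integral>\<^sup>+k. c k \<partial>count_space UNIV)"
    by (simp add: nn_integral_cmult)
  finally show ?thesis .
qed

lemma strip_sum:
  assumes "0 < t"
  shows "(\<integral>\<^sup>+k. c k * indicator (strip h k) t \<partial>count_space UNIV) = c \<lceil>ln t / h\<rceil>"
proof -
  have "indicator (strip h k) t = (indicator {\<lceil>ln t / h\<rceil>} k :: ennreal)" for k
    using assms by (simp add: strip_def indicator_def eq_commute)
  then have "(\<integral>\<^sup>+k. c k * indicator (strip h k) t \<partial>count_space UNIV)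
     = (\<integral>\<^sup>+k. c k * indicator {\<lceil>ln t / h\<rceil>} k \<partial>count_space UNIV)"
    by (simp only:)
  then show ?thesis by simp
qed

lemma strip_ceiling: "0 < t \<Longrightarrow> t \<in> strip h \<lceil>ln t / h\<rceil>"
  by (simp add: strip_def)

lemma strip_pos: "t \<in> strip h k \<Longrightarrow> 0 < t"
  by (simp add: strip_def)

text \<open>For finite \<open>q\<close> the left side is a lower integral and the majorant a step
  function, so monotonicity alone suffices, even for K-functionals of unknown measurability. For
  \<open>q = top\<close> measurability matters because \<open>esssup\<close> is otherwise
  \<open>top\<close>.\<close>

lemma strip_upper:
  assumes "0 < q" "h \<noteq> 0" and F: "\<And>k t. t \<in> strip h k \<Longrightarrow> F t \<le> c k"
    and "q = top \<Longrightarrow> F \<in> borel_measurable dtt"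
  shows "Lnorm dtt q F \<le> ennreal (\<bar>h\<bar> powr (1 / enn2real q)) * Lnorm (count_space UNIV) q c"
proof (cases "q = top")
  case True
  have "F t \<le> (SUP k. c k)" if "0 < t" for t
    using F[OF strip_ceiling[OF that]] by (rule order_trans) (simp add: SUP_upper)
  then have "esssup dtt F \<le> (SUP k. c k)"
    using assms(4)[OF True] by (intro esssup_I AE_I2) auto
  then show ?thesis using assms(2) by (simp add: True Lnorm_top[of dtt] Lnorm_count_space_top)
next
  case False
  note a = enn2real_pos[OF assms(1) False]
  have "(\<integral>\<^sup>+t. epow (F t) (enn2real q) \<partial>dtt)
      \<le> (\<integral>\<^sup>+t. (\<integral>\<^sup>+k. epow (c k) (enn2real q) * indicator (strip h k) t \<partial>count_space UNIV) \<partial>dtt)"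
    using a F[OF strip_ceiling] by (intro nn_integral_mono) (auto simp: strip_sum intro!: epow_mono)
  also have "\<dots> = ennreal \<bar>h\<bar> * (\<integral>\<^sup>+k. epow (c k) (enn2real q) \<partial>count_space UNIV)"
    by (rule nn_integral_strips) fact
  finally have "epow (\<integral>\<^sup>+t. epow (F t) (enn2real q) \<partial>dtt) (1 / enn2real q)
      \<le> epow (ennreal \<bar>h\<bar> * (\<integral>\<^sup>+k. epow (c k) (enn2real q) \<partial>count_space UNIV)) (1 / enn2real q)"
    using a by (intro epow_mono) auto
  then show ?thesis using a by (simp add: Lnorm_finite False epow_ennreal epow_mult)
qed

lemma strip_lower:
  assumes "0 < q" "h \<noteq> 0" and F: "\<And>k t. t \<in> strip h k \<Longrightarrow> c k \<le> F t"
  shows "ennreal (\<bar>h\<bar> powr (1 / enn2real q)) * Lnorm (count_space UNIV) q c \<le> Lnorm dtt q F"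
proof (cases "q = top")
  case True
  have "c k \<le> esssup dtt F" for k
  proof (rule ccontr)
    assume *: "\<not> c k \<le> esssup dtt F"
    \<comment> \<open>On the strip \<open>F\<close> stays above its essential supremum, so the strip
      would be null, contradicting its measure |h|.\<close>
    have "AE t in dtt. t \<notin> strip h k"
      using esssup_AE[of F dtt] F * by (auto elim!: eventually_mono dest: order_trans)
    then have "emeasure dtt (strip h k) = 0"
      by (subst (asm) AE_iff_measurable[OF strip_dtt]) (auto simp: strip_def)
    then show False using assms(2) by (simp add: emeasure_dtt_strip)
  qed
  then show ?thesis using assms(2) by (simp add: True Lnorm_top[of dtt] Lnorm_count_space_top SUP_least)
next
  case False
  note a = enn2real_pos[OF assms(1) False]
  have "ennreal \<bar>h\<bar> * (\<integral>\<^sup>+k. epow (c k) (enn2real q) \<partial>count_space UNIV)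
     = (\<integral>\<^sup>+t. (\<integral>\<^sup>+k. epow (c k) (enn2real q) * indicator (strip h k) t \<partial>count_space UNIV) \<partial>dtt)"
    using nn_integral_strips[OF assms(2)] by simp
  also have "\<dots> \<le> (\<integral>\<^sup>+t. epow (F t) (enn2real q) \<partial>dtt)"
    using a F[OF strip_ceiling] by (intro nn_integral_mono) (auto simp: strip_sum intro!: epow_mono)
  finally have "epow (ennreal \<bar>h\<bar> * (\<integral>\<^sup>+k. epow (c k) (enn2real q) \<partial>count_space UNIV)) (1 / enn2real q)
      \<le> epow (\<integral>\<^sup>+t. epow (F t) (enn2real q) \<partial>dtt) (1 / enn2real q)"
    using a by (intro epow_mono) auto
  then show ?thesis using a by (simp add: Lnorm_finite False epow_ennreal epow_mult)
qed

subsection \<open>Sequences with exponential decay\<close>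

definition decay :: "real \<Rightarrow> int \<Rightarrow> ennreal" where
  "decay \<epsilon> k = ennreal (exp (- \<epsilon> * \<bar>of_int k\<bar>))"

text \<open>Negative rates are used as well: \<open>decay (- a)\<close> is the exponential growth
  that undoes \<open>decay a\<close>.\<close>

lemma decay_add: "decay a k * decay b k = decay (a + b) k"
  by (simp add: decay_def ennreal_mult[symmetric] mult_exp_exp algebra_simps)

lemma decay_0 [simp]: "decay 0 k = 1" "decay a 0 = 1"
  by (simp_all add: decay_def)

lemma epow_decay: "epow (decay a k) b = decay (a * b) k"
  by (simp add: decay_def epow_ennreal powr_def algebra_simps)

lemma decay_minus_commute: "decay a (k - n) = decay a (n - k)"
  by (simp add: decay_def abs_minus_commute)

definition decay_sum :: "real \<Rightarrow> ennreal" where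
  "decay_sum \<epsilon> = (\<integral>\<^sup>+k. decay \<epsilon> k \<partial>count_space UNIV)"

lemma decay_sum_finite:
  assumes "0 < \<epsilon>"
  shows "decay_sum \<epsilon> < top"
proof -
  define r where "r = exp (- \<epsilon>)"
  have r: "0 < r" "r < 1" using assms by (auto simp: r_def)
  have pt: "decay \<epsilon> k = ennreal (r ^ nat \<bar>k\<bar>)" for k
    by (simp add: decay_def r_def exp_of_nat_mult[symmetric] algebra_simps of_nat_nat)
  \<comment> \<open>Grouping the integers by absolute value, at most two per class, bounds the
    two-sided series by twice a geometric series.\<close>
  have "decay \<epsilon> k \<le> (\<integral>\<^sup>+i. ennreal (r ^ i) * indicator {int i, - int i} k \<partial>count_space UNIV)" for k
  proof -
    have "ennreal (r ^ nat \<bar>k\<bar>) * indicator {int (nat \<bar>k\<bar>), - int (nat \<bar>k\<bar>)} k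
        \<le> (\<integral>\<^sup>+i. ennreal (r ^ i) * indicator {int i, - int i} k \<partial>count_space UNIV)"
      by (rule nn_integral_ge_point) simp
    moreover have "indicator {int (nat \<bar>k\<bar>), - int (nat \<bar>k\<bar>)} k = (1::ennreal)"
      by (auto simp: indicator_def abs_if)
    ultimately show ?thesis by (simp add: pt)
  qed
  then have "decay_sum \<epsilon> \<le> (\<integral>\<^sup>+k. (\<integral>\<^sup>+i. ennreal (r ^ i) * indicator {int i, - int i} k \<partial>count_space UNIV) \<partial>count_space UNIV)"
    unfolding decay_sum_def by (intro nn_integral_mono) auto
  also have "\<dots> = (\<integral>\<^sup>+i. (\<integral>\<^sup>+k. ennreal (r ^ i) * indicator {int i, - int i} k \<partial>count_space UNIV) \<partial>count_space UNIV)"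
    by (rule nn_integral_count_space_nn_integral) auto
  also have "\<dots> = (\<integral>\<^sup>+i. ennreal (r ^ i) * of_nat (card {int i, - int i}) \<partial>count_space UNIV)"
    by (intro nn_integral_cong) (simp add: nn_integral_cmult_indicator)
  also have "\<dots> \<le> (\<integral>\<^sup>+i. 2 * ennreal (r ^ i) \<partial>count_space UNIV)"
  proof (intro nn_integral_mono)
    fix i :: nat
    have "of_nat (card {int i, - int i}) \<le> (of_nat 2 :: ennreal)"
      by (intro of_nat_mono) (simp add: card_insert_if)
    then show "ennreal (r ^ i) * of_nat (card {int i, - int i}) \<le> 2 * ennreal (r ^ i)"
      by (subst mult.commute) (auto intro: mult_right_mono)
  qed
  also have "\<dots> = 2 * (\<Sum>i. ennreal (r ^ i))"
    by (simp add: nn_integral_cmult nn_integral_count_space_nat)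
  also have "(\<Sum>i. ennreal (r ^ i)) = ennreal (1 / (1 - r))"
    using r by (intro suminf_ennreal_eq) (auto simp: geometric_sums)
  finally show ?thesis
    by (rule order_le_less_trans) (auto simp: ennreal_mult_less_top)
qed

lemma decay_sum_shift: "(\<integral>\<^sup>+k. decay \<epsilon> (k - n) \<partial>count_space UNIV) = decay_sum \<epsilon>"
proof -
  have "bij (\<lambda>k::int. k - n)" by (rule bij_betw_byWitness[where f'="\<lambda>k. k + n"]) auto
  from nn_integral_bij_count_space[OF this] show ?thesis unfolding decay_sum_def .
qed

lemma decay_sum_shift': "(\<integral>\<^sup>+k. decay \<epsilon> (n - k) \<partial>count_space UNIV) = decay_sum \<epsilon>"
  using decay_sum_shift[of \<epsilon> n] by (simp add: decay_minus_commute[of \<epsilon> n])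

text \<open>For \<epsilon> > 0 this is the l^q quasi-norm of the two-sided sequence
  e^(-\<epsilon>|k|); for \<open>q = top\<close> its value is attained at k = 0.\<close>

definition decay_const :: "ennreal \<Rightarrow> real \<Rightarrow> ennreal" where
  "decay_const q \<epsilon> = (if q = top then 1 else epow (decay_sum (\<epsilon> * enn2real q)) (1 / enn2real q))"

lemma decay_const_finite: "0 < q \<Longrightarrow> 0 < \<epsilon> \<Longrightarrow> decay_const q \<epsilon> < top"
  using decay_sum_finite[of "\<epsilon> * enn2real q"] enn2real_pos[of q]
  by (auto simp: decay_const_def less_top[symmetric])

lemma Lnorm_decay_le:
  assumes "0 < q" "0 \<le> \<epsilon>" "\<And>k. c k \<le> A * decay \<epsilon> (k - n)"
  shows "Lnorm (count_space UNIV) q c \<le> decay_const q \<epsilon> * A"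
proof (cases "q = top")
  case True
  have "c k \<le> A" for k
    using assms(3)[of k] mult_left_mono[of "decay \<epsilon> (k - n)" 1 A] assms(2) by (force simp: decay_def)
  then show ?thesis using True by (simp add: Lnorm_count_space_top decay_const_def SUP_least)
next
  case False
  note a = enn2real_pos[OF assms(1) False]
  have "(\<integral>\<^sup>+k. epow (c k) (enn2real q) \<partial>count_space UNIV)
      \<le> (\<integral>\<^sup>+k. epow A (enn2real q) * decay (\<epsilon> * enn2real q) (k - n) \<partial>count_space UNIV)"
  proof (intro nn_integral_mono)
    fix k
    have "epow (c k) (enn2real q) \<le> epow (A * decay \<epsilon> (k - n)) (enn2real q)"
      using a assms(3) by (intro epow_mono) auto
    then show "epow (c k) (enn2real q) \<le> epow A (enn2real q) * decay (\<epsilon> * enn2real q) (k - n)"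
      by (simp add: epow_mult epow_decay)
  qed
  also have "\<dots> = epow A (enn2real q) * decay_sum (\<epsilon> * enn2real q)"
    by (simp add: nn_integral_cmult decay_sum_shift)
  finally have "epow (\<integral>\<^sup>+k. epow (c k) (enn2real q) \<partial>count_space UNIV) (1 / enn2real q)
     \<le> epow (epow A (enn2real q) * decay_sum (\<epsilon> * enn2real q)) (1 / enn2real q)"
    using a by (intro epow_mono) auto
  also have "\<dots> = decay_const q \<epsilon> * A"
    using a False by (simp add: epow_mult decay_const_def mult.commute)
  finally show ?thesis by (simp add: Lnorm_finite False)
qed

text \<open>By \<open>epow_SUP_le\<close> and Tonelli, the L^p quasi-norm of the supremum is at most
  the l^p quasi-norm of the numbers \<open>Lnorm M p (g k)\<close>, which decay. The outer exponent
  thus also plays the part of the summation exponent.\<close>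

lemma Lnorm_SUP_decay_le:
  fixes g :: "int \<Rightarrow> 'b \<Rightarrow> ennreal"
  assumes "0 < p" "0 \<le> \<epsilon>" and [measurable]: "\<And>k. g k \<in> borel_measurable M"
    and g: "\<And>k. Lnorm M p (g k) \<le> A * decay \<epsilon> (k - n)"
  shows "Lnorm M p (\<lambda>x. SUP k. g k x) \<le> decay_const p \<epsilon> * A"
proof (cases "p = top")
  case True
  have "AE x in M. \<forall>k. g k x \<le> A"
  proof (subst AE_all_countable, rule allI)
    fix k
    have "esssup M (g k) \<le> A"
      using g[of k] mult_left_mono[of "decay \<epsilon> (k - n)" 1 A] assms(2)
      by (force simp: decay_def True Lnorm_top)
    then show "AE x in M. g k x \<le> A"
      using esssup_AE[of "g k" M] by (auto elim!: eventually_mono)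
  qed
  then have "esssup M (\<lambda>x. SUP k. g k x) \<le> A"
    by (intro esssup_I) (auto elim!: eventually_mono intro: SUP_least)
  then show ?thesis by (simp add: True Lnorm_top decay_const_def)
next
  case False
  note a = enn2real_pos[OF assms(1) False]
  have "(\<integral>\<^sup>+x. epow (SUP k. g k x) (enn2real p) \<partial>M)
      \<le> (\<integral>\<^sup>+x. (\<integral>\<^sup>+k. epow (g k x) (enn2real p) \<partial>count_space UNIV) \<partial>M)"
    using a by (intro nn_integral_mono epow_SUP_le)
  also have "\<dots> = (\<integral>\<^sup>+k. (\<integral>\<^sup>+x. epow (g k x) (enn2real p) \<partial>M) \<partial>count_space UNIV)"
    by (rule nn_integral_count_space_nn_integral) auto
  also have "\<dots> = (\<integral>\<^sup>+k. epow (Lnorm M p (g k)) (enn2real p) \<partial>count_space UNIV)"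
    using a by (simp add: Lnorm_finite False)
  also have "\<dots> = epow (Lnorm (count_space UNIV) p (\<lambda>k. Lnorm M p (g k))) (enn2real p)"
    using a by (simp add: Lnorm_finite[OF False, of "count_space UNIV"])
  also have "\<dots> \<le> epow (decay_const p \<epsilon> * A) (enn2real p)"
    using a by (intro epow_mono Lnorm_decay_le[OF assms(1,2) g]) auto
  finally have "epow (\<integral>\<^sup>+x. epow (SUP k. g k x) (enn2real p) \<partial>M) (1 / enn2real p)
      \<le> epow (epow (decay_const p \<epsilon> * A) (enn2real p)) (1 / enn2real p)"
    using a by (intro epow_mono) auto
  then show ?thesis using a by (simp add: Lnorm_finite False)
qed

text \<open>A substitute for Young's convolution inequality: with a supremum in place of the
  convolution sum, the l^q quasi-norm of the kernel is an admissible constant for every q, also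
  below 1.\<close>

lemma Lnorm_SUP_conv_le:
  assumes "0 < q" "0 \<le> \<epsilon>"
  shows "Lnorm (count_space UNIV) q (\<lambda>n. SUP k. decay \<epsilon> (k - n) * b k)
    \<le> decay_const q \<epsilon> * Lnorm (count_space UNIV) q b"
proof (cases "q = top")
  case True
  have "decay \<epsilon> (k - n) * b k \<le> (SUP k. b k)" for k n
  proof -
    have "decay \<epsilon> (k - n) * b k \<le> 1 * b k"
      using assms(2) by (intro mult_right_mono) (auto simp: decay_def)
    also have "\<dots> \<le> (SUP k. b k)" by (simp add: SUP_upper)
    finally show ?thesis .
  qed
  then show ?thesis
    by (simp add: True Lnorm_count_space_top decay_const_def SUP_least)
next
  case False
  let ?a = "enn2real q"
  note a = enn2real_pos[OF assms(1) False]
  have "(\<integral>\<^sup>+n. epow (SUP k. decay \<epsilon> (k - n) * b k) ?a \<partial>count_space UNIV)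
     \<le> (\<integral>\<^sup>+n. (\<integral>\<^sup>+k. epow (decay \<epsilon> (k - n) * b k) ?a \<partial>count_space UNIV) \<partial>count_space UNIV)"
    using a by (intro nn_integral_mono epow_SUP_le)
  also have "\<dots> = (\<integral>\<^sup>+k. (\<integral>\<^sup>+n. epow (decay \<epsilon> (k - n) * b k) ?a \<partial>count_space UNIV) \<partial>count_space UNIV)"
    by (rule nn_integral_count_space_nn_integral) auto
  also have "\<dots> = (\<integral>\<^sup>+k. decay_sum (\<epsilon> * ?a) * epow (b k) ?a \<partial>count_space UNIV)"
    by (simp add: epow_mult epow_decay nn_integral_multc decay_sum_shift')
  also have "\<dots> = decay_sum (\<epsilon> * ?a) * (\<integral>\<^sup>+k. epow (b k) ?a \<partial>count_space UNIV)"
    by (simp add: nn_integral_cmult)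
  finally have "epow (\<integral>\<^sup>+n. epow (SUP k. decay \<epsilon> (k - n) * b k) ?a \<partial>count_space UNIV) (1 / ?a)
      \<le> epow (decay_sum (\<epsilon> * ?a) * (\<integral>\<^sup>+k. epow (b k) ?a \<partial>count_space UNIV)) (1 / ?a)"
    using a by (intro epow_mono) auto
  then show ?thesis using a by (simp add: Lnorm_finite False decay_const_def epow_mult)
qed

subsection \<open>Whitney averages\<close>

lemma powr_fst_measurable [measurable]:
  "(\<lambda>z::real \<times> 'a::euclidean_space. fst z powr b) \<in> borel_measurable borel"
  by (subst borel_prod[symmetric]) measurable

text \<open>Whitney averages see only the modulus of \<open>f\<close>, up to null sets. A Borel
  representative \<open>u\<close> of this modulus makes joint measurability in position and scale
  available, which a merely Lebesgue measurable \<open>f\<close> does not give directly.\<close>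

definition modulus_rep :: "(real \<times> 'a::euclidean_space \<Rightarrow> complex) \<Rightarrow> (real \<times> 'a \<Rightarrow> ennreal) \<Rightarrow> bool" where
  "modulus_rep f u \<longleftrightarrow> f \<in> borel_measurable (lebesgue_on half_space) \<and> u \<in> borel_measurable borel \<and>
     (AE z in lborel. 0 < fst z \<longrightarrow> u z = ennreal (norm (f z)))"

lemma half_space_eq: "half_space = {z. 0 < fst z}"
  by (auto simp: half_space_def)

lemma half_space_borel [measurable]: "(half_space :: (real \<times> 'a::euclidean_space) set) \<in> sets borel"
  unfolding half_space_def by (intro borel_open open_Times) auto

lemma modulus_rep_exists:
  fixes f :: "real \<times> 'a::euclidean_space \<Rightarrow> complex"
  assumes "f \<in> borel_measurable (lebesgue_on half_space)"
  obtains u where "modulus_rep f u"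
proof -
  have "(\<lambda>z. if z \<in> half_space then f z else 0) \<in> borel_measurable lebesgue"
    using assms by (intro borel_measurable_if_I) auto
  then have "(\<lambda>z. ennreal (norm (if z \<in> half_space then f z else 0))) \<in> borel_measurable lebesgue"
    by measurable
  then obtain u where u: "u \<in> borel_measurable lborel"
    "AE z in lborel. ennreal (norm (if z \<in> half_space then f z else 0)) = u z"
    using completion_ex_borel_measurable by blast
  have "AE z in lborel. 0 < fst z \<longrightarrow> u z = ennreal (norm (f z))"
    using u(2) by eventually_elim (auto simp: half_space_eq)
  then have "modulus_rep f u" using assms u(1) by (simp add: modulus_rep_def)
  then show ?thesis by (rule that)
qed

definition wbox :: "real \<Rightarrow> 'a::euclidean_space \<Rightarrow> (real \<times> 'a) set" where
  "wbox t x = {t/2<..t} \<times> ball x t"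

lemma wbox_borel [measurable]: "wbox t x \<in> sets borel"
  unfolding wbox_def by (auto simp flip: borel_prod)

lemma mem_wbox: "z \<in> wbox t x \<longleftrightarrow> t / 2 < fst z \<and> fst z \<le> t \<and> dist x (snd z) < t"
  by (cases z) (auto simp: wbox_def)

text \<open>The volume of a Whitney box to the power -1/r. For r = \<infinity> and t > 0 the
  conventions \<open>enn2real \<infinity> = 0\<close> and \<open>1 / 0 = 0\<close> make it
  1.\<close>

definition wconst :: "nat \<Rightarrow> ennreal \<Rightarrow> real \<Rightarrow> ennreal" where
  "wconst d r t = ennreal ((t / 2 * (unit_ball_vol (real d) * t ^ d)) powr - (1 / enn2real r))"

text \<open>Normalizing an L^r quasi-norm over the whole space treats finite and infinite r together
  and makes all facts about \<open>Lnorm\<close> applicable.\<close>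

definition wavg :: "ennreal \<Rightarrow> real \<Rightarrow> (real \<times> 'a::euclidean_space \<Rightarrow> ennreal) \<Rightarrow> real \<Rightarrow> 'a \<Rightarrow> ennreal" where
  "wavg r \<beta> u t x = wconst DIM('a) r t *
     Lnorm lborel r (\<lambda>z. indicator (wbox t x) z * (ennreal (fst z powr - \<beta>) * u z))"

lemma epow_divide_ennreal:
  assumes "0 < w"
  shows "epow (I / ennreal w) a = ennreal (w powr - a) * epow I a"
proof -
  have "I / ennreal w = I * ennreal (1 / w)"
    using assms by (simp add: divide_ennreal_def inverse_ennreal inverse_eq_divide)
  then show ?thesis using assms
    by (simp add: epow_mult epow_ennreal powr_divide powr_minus inverse_eq_divide mult.commute)
qed

lemma divide_divide_ennreal:
  assumes "0 < a" "0 < b"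
  shows "I / ennreal a / ennreal b = I / ennreal (b * a)"
proof -
  have "inverse (ennreal a) * inverse (ennreal b) = inverse (ennreal (b * a))"
    using assms by (simp add: inverse_ennreal flip: ennreal_mult)
  then show ?thesis by (simp add: divide_ennreal_def mult.assoc)
qed

text \<open>For infinite r both sides are essential suprema over the same box. For finite r the
  iterated mean is rewritten slice by slice in terms of the Borel function and then combined by
  Tonelli.\<close>

lemma whitney_eq_wavg:
  fixes f :: "real \<times> 'a::euclidean_space \<Rightarrow> complex"
  assumes "0 < r" "0 < t" and rep: "modulus_rep f u"
  shows "whitney r \<beta> f t x = wavg r \<beta> u t x"
proof -
  have f: "f \<in> borel_measurable (lebesgue_on half_space)" and [measurable]: "u \<in> borel_measurable borel" and
    uf: "AE z in lborel. 0 < fst z \<longrightarrow> u z = ennreal (norm (f z))"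
    using rep by (auto simp: modulus_rep_def)
  define v where "v = (\<lambda>z. ennreal (fst z powr - \<beta>) * u z)"
  have v [measurable]: "v \<in> borel_measurable borel"
    unfolding v_def by measurable
  have vf: "AE z in lborel. 0 < fst z \<longrightarrow> v z = ennreal (norm (fst z powr - \<beta> *\<^sub>R f z))"
    using uf by eventually_elim (auto simp: v_def ennreal_mult)
  have wpos: "0 < t / 2 * (unit_ball_vol DIM('a) * t ^ DIM('a))"
    using assms by (auto intro!: mult_pos_pos)
  show ?thesis
  proof (cases "r = top")
    case True
    have "wbox t x \<subseteq> half_space" using assms(2) by (auto simp: mem_wbox half_space_eq)
    then have [measurable]: "f \<in> borel_measurable (lebesgue_on (wbox t x))"
      using f measurable_restrict_mono by blast
    have [measurable]: "(\<lambda>z::real \<times> 'a. fst z powr - \<beta>) \<in> borel_measurable (lebesgue_on (wbox t x))"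
      by (intro measurable_restrict_space1 measurable_completion) measurable
    have m: "(\<lambda>z. ennreal (norm (fst z powr - \<beta> *\<^sub>R f z))) \<in> borel_measurable (lebesgue_on (wbox t x))"
      by measurable
    have "(AE z in lebesgue_on (wbox t x). ennreal (norm (fst z powr - \<beta> *\<^sub>R f z)) \<le> c)
       \<longleftrightarrow> (AE z in lborel. indicator (wbox t x) z * v z \<le> c)" for c
    proof -
      have "(AE z in lebesgue_on (wbox t x). ennreal (norm (fst z powr - \<beta> *\<^sub>R f z)) \<le> c)
        \<longleftrightarrow> (AE z in lborel. z \<in> wbox t x \<longrightarrow> ennreal (norm (fst z powr - \<beta> *\<^sub>R f z)) \<le> c)"
        by (subst AE_restrict_space_iff) (auto simp: AE_completion_iff)
      also have "\<dots> \<longleftrightarrow> (AE z in lborel. indicator (wbox t x) z * v z \<le> c)"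
        by (rule eventually_subst)
           (use vf in eventually_elim, use assms(2) in \<open>auto simp: indicator_def mem_wbox\<close>)
      finally show ?thesis .
    qed
    then have "esssup (lebesgue_on (wbox t x)) (\<lambda>z. ennreal (norm (fst z powr - \<beta> *\<^sub>R f z)))
        = esssup lborel (\<lambda>z. indicator (wbox t x) z * v z)"
      using m by (subst (1 2) esssup_eq_AE) auto
    moreover have "(\<lambda>(s, y). ennreal (norm (s powr - \<beta> *\<^sub>R f (s, y))))
        = (\<lambda>z. ennreal (norm (fst z powr - \<beta> *\<^sub>R f z)))"
      by (simp add: fun_eq_iff)
    moreover have "wconst DIM('a) top t = 1" using wpos by (auto simp: wconst_def)
    ultimately show ?thesis
      unfolding True whitney_def wavg_def Lnorm_top v_def
      by (simp only: wbox_def simp_thms if_True mult_1 infinity_ennreal_def)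
  next
    case False
    define a where "a = enn2real r"
    have a: "0 < a" using enn2real_pos[OF assms(1) False] by (simp add: a_def)
    let ?V = "ennreal (unit_ball_vol DIM('a) * t ^ DIM('a))"
    let ?h = "\<lambda>s y. epow (v (s, y)) a * indicator (ball x t) y"
    \<comment> \<open>A null set of the product has null slices for almost every height, so the
      inner means may be replaced for almost every \<open>s\<close>, although individual slices of
      \<open>f\<close> can be bad.\<close>
    have vf2: "AE s in lborel. AE y in lborel. 0 < s \<longrightarrow> v (s, y) = ennreal (norm (s powr - \<beta> *\<^sub>R f (s, y)))"
      using vf by (subst (asm) lborel_prod[symmetric]) (auto dest: lborel_pair.AE_pair)
    have 1: "AE s in lborel. 0 < s \<longrightarrow>
       mean lebesgue (ball x t) (\<lambda>y. ennreal (norm (s powr - \<beta> *\<^sub>R f (s, y)) powr a)) = (\<integral>\<^sup>+y. ?h s y \<partial>lborel) / ?V"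
      using vf2
    proof eventually_elim
      case (elim s)
      show ?case
      proof
        assume "0 < s"
        with elim have "AE y in lborel. ennreal (norm (s powr - \<beta> *\<^sub>R f (s, y)) powr a) = epow (v (s, y)) a"
          by (auto elim!: eventually_mono simp: epow_ennreal)
        then have "(\<integral>\<^sup>+y. ennreal (norm (s powr - \<beta> *\<^sub>R f (s, y)) powr a) * indicator (ball x t) y \<partial>lborel)
           = (\<integral>\<^sup>+y. ?h s y \<partial>lborel)"
          by (intro nn_integral_cong_AE) (auto elim!: eventually_mono)
        then show "mean lebesgue (ball x t) (\<lambda>y. ennreal (norm (s powr - \<beta> *\<^sub>R f (s, y)) powr a))
           = (\<integral>\<^sup>+y. ?h s y \<partial>lborel) / ?V"
          using assms(2) by (simp add: mean_def nn_integral_completion emeasure_ball)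
      qed
    qed
    have [measurable]: "ball x t \<in> sets borel" "{t/2<..t} \<in> sets borel" "v \<in> borel_measurable (lborel \<Otimes>\<^sub>M lborel)"
      using v by (auto simp: lborel_prod)
    then have m: "(\<lambda>z. ?h (fst z) (snd z) * indicator {t/2<..t} (fst z)) \<in> borel_measurable (lborel \<Otimes>\<^sub>M lborel)"
      by measurable
    have "mean lebesgue {t/2<..t} (\<lambda>s. mean lebesgue (ball x t) (\<lambda>y. ennreal (norm (s powr - \<beta> *\<^sub>R f (s, y)) powr a)))
       = (\<integral>\<^sup>+s. (\<integral>\<^sup>+y. ?h s y \<partial>lborel) / ?V * indicator {t/2<..t} s \<partial>lborel) / ennreal (t / 2)"
      unfolding mean_def[of _ "{t/2<..t}"] nn_integral_completion
      using assms(2) 1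
      by (intro arg_cong2[where f="(/)"] nn_integral_cong_AE) (auto elim!: eventually_mono simp: indicator_def)
    also have "(\<integral>\<^sup>+s. (\<integral>\<^sup>+y. ?h s y \<partial>lborel) / ?V * indicator {t/2<..t} s \<partial>lborel)
      = (\<integral>\<^sup>+s. (\<integral>\<^sup>+y. ?h s y * indicator {t/2<..t} s \<partial>lborel) / ?V \<partial>lborel)"
      by (intro nn_integral_cong) (auto simp: indicator_def)
    also have "\<dots> = (\<integral>\<^sup>+s. (\<integral>\<^sup>+y. ?h s y * indicator {t/2<..t} s \<partial>lborel) \<partial>lborel) / ?V"
      by (intro nn_integral_divide) measurable
    also have "(\<integral>\<^sup>+s. (\<integral>\<^sup>+y. ?h s y * indicator {t/2<..t} s \<partial>lborel) \<partial>lborel)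
      = (\<integral>\<^sup>+z. ?h (fst z) (snd z) * indicator {t/2<..t} (fst z) \<partial>lborel)"
      using lborel.nn_integral_fst[OF m] by (simp add: lborel_prod)
    also have "\<dots> = (\<integral>\<^sup>+z. epow (indicator (wbox t x) z * v z) a \<partial>lborel)"
      by (intro nn_integral_cong) (auto simp: indicator_def wbox_def mem_wbox)
    also have "\<dots> / ?V / ennreal (t / 2) = \<dots> / ennreal (t / 2 * (unit_ball_vol DIM('a) * t ^ DIM('a)))"
      using assms(2) by (intro divide_divide_ennreal) auto
    finally have "whitney r \<beta> f t x = epow (\<dots>) (1 / a)"
      using False by (simp add: whitney_def a_def)
    also have "\<dots> = wavg r \<beta> u t x"
      using wpos by (simp add: epow_divide_ennreal wavg_def wconst_def Lnorm_finite[OF False] a_def v_def)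
    finally show ?thesis .
  qed
qed

lemma wavg_measurable:
  fixes u :: "real \<times> 'a::euclidean_space \<Rightarrow> ennreal"
  assumes u [measurable]: "u \<in> borel_measurable borel"
  shows "(\<lambda>(x, t). wavg r \<beta> u t x) \<in> borel_measurable (borel \<Otimes>\<^sub>M borel)"
proof -
  \<comment> \<open>Spelled out as inequalities between centre, scale and point, the indicator is
    visibly measurable in all of them jointly.\<close>
  have *: "(\<lambda>(w::'a \<times> real, z::real \<times> 'a). indicator (wbox (snd w) (fst w)) z * (ennreal (fst z powr - \<beta>) * u z))
      = (\<lambda>(w, z). if snd w / 2 < fst z \<and> fst z \<le> snd w \<and> dist (fst w) (snd z) < snd w
                   then ennreal (fst z powr - \<beta>) * u z else 0)"
    by (auto simp: fun_eq_iff indicator_def mem_wbox)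
  have [measurable]: "u \<in> borel_measurable (borel \<Otimes>\<^sub>M borel)"
    using u by (simp add: borel_prod)
  have "(\<lambda>(w::'a \<times> real, z::real \<times> 'a). indicator (wbox (snd w) (fst w)) z * (ennreal (fst z powr - \<beta>) * u z))
      \<in> borel_measurable ((borel \<Otimes>\<^sub>M borel) \<Otimes>\<^sub>M (borel \<Otimes>\<^sub>M borel))"
    unfolding * by measurable
  also have "borel_measurable ((borel \<Otimes>\<^sub>M borel) \<Otimes>\<^sub>M (borel \<Otimes>\<^sub>M borel))
      = borel_measurable ((borel \<Otimes>\<^sub>M borel) \<Otimes>\<^sub>M (lborel :: (real \<times> 'a) measure))"
    by (intro measurable_cong_sets sets_pair_measure_cong refl) (metis borel_prod sets_lborel)
  finally have "(\<lambda>(w::'a \<times> real, z::real \<times> 'a). indicator (wbox (snd w) (fst w)) z * (ennreal (fst z powr - \<beta>) * u z))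
      \<in> borel_measurable ((borel \<Otimes>\<^sub>M borel) \<Otimes>\<^sub>M lborel)" .
  from Lnorm_measurable_param[OF sigma_finite_lborel this, of r]
  show ?thesis
    unfolding wavg_def wconst_def case_prod_beta by measurable
qed

lemma wavg_measurable_x:
  assumes "u \<in> borel_measurable borel"
  shows "wavg r \<beta> u t \<in> borel_measurable borel"
  using measurable_Pair1[OF wavg_measurable[OF assms], of t] by simp

lemma wavg_mono_AE:
  assumes "0 < r" "u \<in> borel_measurable borel" "AE z in lborel. z \<in> wbox t x \<longrightarrow> u z \<le> v z"
  shows "wavg r \<beta> u t x \<le> wavg r \<beta> v t x"
proof -
  note [measurable] = assms(2)
  have [measurable]: "(\<lambda>z. indicator (wbox t x) z * (ennreal (fst z powr - \<beta>) * u z)) \<in> borel_measurable lborel"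
    by measurable
  have "AE z in lborel. indicator (wbox t x) z * (ennreal (fst z powr - \<beta>) * u z)
      \<le> indicator (wbox t x) z * (ennreal (fst z powr - \<beta>) * v z)"
    using assms(3) by eventually_elim (auto simp: indicator_def intro: mult_left_mono)
  then show ?thesis unfolding wavg_def
    using assms(1) by (intro mult_left_mono Lnorm_mono_AE) auto
qed

lemma wavg_add_le:
  assumes "0 < r" and [measurable]: "u \<in> borel_measurable borel" "v \<in> borel_measurable borel"
  shows "wavg r \<beta> (\<lambda>z. u z + v z) t x \<le> Lconst r * (wavg r \<beta> u t x + wavg r \<beta> v t x)"
proof -
  let ?g = "\<lambda>u z. indicator (wbox t x) z * (ennreal (fst z powr - \<beta>) * u z)"
  have "?g (\<lambda>z. u z + v z) = (\<lambda>z. ?g u z + ?g v z)"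
    by (auto simp: algebra_simps)
  then have "Lnorm lborel r (?g (\<lambda>z. u z + v z)) \<le> Lconst r * (Lnorm lborel r (?g u) + Lnorm lborel r (?g v))"
    using assms(1) by (simp add: Lnorm_add_le)
  from mult_left_mono[OF this, of "wconst DIM('a) r t"] show ?thesis
    by (simp add: wavg_def algebra_simps)
qed

lemma wavg_eq_0:
  assumes "0 < r" "u \<in> borel_measurable borel" "AE z in lborel. z \<in> wbox t x \<longrightarrow> u z = 0"
  shows "wavg r \<beta> u t x = 0"
proof -
  have "wavg r \<beta> u t x \<le> wavg r \<beta> (\<lambda>z. 0) t x"
    using assms by (intro wavg_mono_AE) (auto elim!: eventually_mono)
  then show ?thesis by (simp add: wavg_def Lnorm_zero assms(1))
qed

subsection \<open>Comparison of Whitney averages at neighbouring scales\<close>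

text \<open>One net, fixed by choice, is translated and dilated throughout; every constant then
  depends on the space \<open>'a\<close> but not on the scale, the centre or the function.\<close>

definition cover_net :: "'a::euclidean_space set" where
  "cover_net = (SOME E. finite E \<and> ball 0 1 \<subseteq> (\<Union>e\<in>E. ball e (1/4)))"

lemma cover_net: "finite (cover_net :: 'a::euclidean_space set)"
  "ball (0::'a) 1 \<subseteq> (\<Union>e\<in>cover_net. ball e (1/4))"
proof -
  have "compact (cball (0::'a) 1)" by simp
  then obtain E where "finite E" "cball (0::'a) 1 \<subseteq> (\<Union>e\<in>E. ball e (1/4))"
    unfolding compact_eq_totally_bounded by (meson zero_less_divide_1_iff zero_less_numeral)
  then have "\<exists>E. finite E \<and> ball (0::'a) 1 \<subseteq> (\<Union>e\<in>E. ball e (1/4))"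
    using ball_subset_cball by blast
  from someI_ex[OF this] show "finite (cover_net :: 'a::euclidean_space set)"
    "ball (0::'a) 1 \<subseteq> (\<Union>e\<in>cover_net. ball e (1/4))"
    by (auto simp: cover_net_def)
qed

lemma cover_net_scaled:
  fixes x y :: "'a::euclidean_space"
  assumes "0 < R" "dist x y < R"
  obtains e where "e \<in> cover_net" "dist (x + R *\<^sub>R e) y < R / 4"
proof -
  have "norm ((y - x) /\<^sub>R R) = dist x y / R"
    using assms by (simp add: dist_norm norm_minus_commute divide_inverse mult.commute)
  then have "norm ((y - x) /\<^sub>R R) < 1"
    using assms by simp
  then have "(y - x) /\<^sub>R R \<in> ball 0 1" by simp
  then obtain e where e: "e \<in> cover_net" "dist e ((y - x) /\<^sub>R R) < 1 / 4"
    using cover_net(2) by fastforce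
  have "x + R *\<^sub>R e - y = R *\<^sub>R (e - (y - x) /\<^sub>R R)"
    using assms(1) by (simp add: algebra_simps)
  then have "dist (x + R *\<^sub>R e) y = R * dist e ((y - x) /\<^sub>R R)"
    using assms(1) by (simp add: dist_norm)
  then have "dist (x + R *\<^sub>R e) y < R / 4"
    using e(2) mult_strict_left_mono[OF e(2) assms(1)] by simp
  with e(1) show ?thesis by (rule that)
qed

text \<open>The rate 1/8 gives \<open>exp (3/8) \<le> exp (1/2) \<le> 2\<close>. Three steps thus
  stay within the factor 2 between bottom and top of a Whitney box, whereas eight steps give the
  factor e, which exceeds 2.\<close>

definition scale :: "int \<Rightarrow> real" where
  "scale k = exp (1/8 * of_int k)"

lemma scale_pos [simp]: "0 < scale k"
  by (simp add: scale_def)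

lemma exp_eighth: "1 < exp (1/8::real)" "exp (1/8::real) ^ 3 \<le> 2"
proof -
  show 1: "1 < exp (1/8::real)" by simp
  have "exp (1/8::real) ^ 3 \<le> exp (1/8) ^ 4" using 1 by (intro power_increasing) auto
  also have "\<dots> = exp (1/2::real)" by (simp flip: exp_of_nat_mult)
  also have "\<dots> \<le> 2" by (rule exp_half_le2)
  finally show "exp (1/8::real) ^ 3 \<le> 2" .
qed

lemma scale_add: "scale (k + n) = scale k * scale n"
  by (simp add: scale_def mult_exp_exp algebra_simps)

lemma scale_le_iff [simp]: "scale k \<le> scale l \<longleftrightarrow> k \<le> l" "scale k < scale l \<longleftrightarrow> k < l"
  by (simp_all add: scale_def)

lemma scale_double: "scale (k + 3) \<le> 2 * scale k"
proof -
  have "scale 3 = exp (1/8) ^ 3" by (simp add: scale_def flip: exp_of_nat_mult)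
  then show ?thesis using exp_eighth(2) by (simp add: scale_add)
qed

lemma strip_scale: "t \<in> strip (1/8) k \<longleftrightarrow> scale (k - 1) < t \<and> t \<le> scale k"
  by (simp add: strip_iff_pos scale_def)

lemma scale_in_strip: "scale k \<in> strip (1/8) k"
  by (simp add: strip_scale)

text \<open>Besides the strip of scales, the infimum ranges over a ball of centres. The strip makes
  it comparable with integrals in dt/t; the ball, having positive measure, makes it comparable with
  means and essential suprema in x.\<close>

definition winf :: "ennreal \<Rightarrow> real \<Rightarrow> (real \<times> 'a::euclidean_space \<Rightarrow> ennreal) \<Rightarrow> int \<Rightarrow> 'a \<Rightarrow> ennreal" where
  "winf r \<beta> u j y = (INF (\<tau>, z) \<in> strip (1/8) j \<times> ball y (scale j / 8). wavg r \<beta> u \<tau> z)"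

lemma winf_le: "\<tau> \<in> strip (1/8) j \<Longrightarrow> dist y z < scale j / 8 \<Longrightarrow> winf r \<beta> u j y \<le> wavg r \<beta> u \<tau> z"
  unfolding winf_def by (rule INF_lower2[of "(\<tau>, z)"]) auto

lemma le_mult_INF_ennreal:
  assumes "0 < c" "\<And>i. i \<in> I \<Longrightarrow> a \<le> ennreal c * f i"
  shows "a \<le> ennreal c * (INF i\<in>I. f i)"
proof -
  have c: "ennreal (1 / c) * ennreal c = 1" "ennreal c * ennreal (1 / c) = 1"
    using assms(1) by (simp_all flip: ennreal_mult)
  have "ennreal (1 / c) * a \<le> f i" if "i \<in> I" for i
    using mult_left_mono[OF assms(2)[OF that], of "ennreal (1 / c)"]
    by (simp add: mult.assoc[symmetric] c)
  then have "ennreal c * (ennreal (1 / c) * a) \<le> ennreal c * (INF i\<in>I. f i)"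
    by (intro mult_left_mono INF_greatest) auto
  then show ?thesis by (simp add: mult.assoc[symmetric] c)
qed

text \<open>The volume of a box is a multiple of t^(d+1), so doubling the scale costs 2^(d+1) before
  the power 1/r is taken.\<close>

lemma wconst_compare:
  assumes "0 < \<tau>" "0 < t" "\<tau> \<le> 2 * t"
  shows "wconst d r t \<le> ennreal (2 powr (real (d + 1) / enn2real r)) * wconst d r \<tau>"
proof -
  let ?w = "\<lambda>t. t / 2 * (unit_ball_vol (real d) * t ^ d)"
  let ?b = "1 / enn2real r"
  have w: "?w t = unit_ball_vol (real d) / 2 * t ^ (d + 1)" for t by simp
  have pos: "0 < ?w \<tau>" "0 < ?w t" using assms by (auto intro!: mult_pos_pos)
  have "?w \<tau> \<le> ?w (2 * t)"
    unfolding w using assms by (intro mult_left_mono power_mono) auto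
  also have "\<dots> = 2 ^ (d + 1) * ?w t" by (simp add: power_mult_distrib)
  finally have "?w \<tau> / 2 ^ (d + 1) \<le> ?w t" by (simp add: field_simps)
  then have "?w t powr - ?b \<le> (?w \<tau> / 2 ^ (d + 1)) powr - ?b"
    using pos by (intro powr_mono2') (auto intro!: divide_pos_pos)
  also have "\<dots> = 2 powr (real (d + 1) / enn2real r) * ?w \<tau> powr - ?b"
  proof -
    have "(?w \<tau> / 2 ^ (d + 1)) powr - ?b = (2 ^ (d + 1)) powr ?b * ?w \<tau> powr - ?b"
      using pos by (subst powr_divide) (auto simp: powr_minus_divide)
    moreover have "(2 ^ (d + 1)) powr ?b = (2::real) powr (real (d + 1) / enn2real r)"
      by (subst powr_realpow[symmetric]) (simp_all only: powr_powr zero_less_numeral times_divide_eq_right mult_1_right)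
    ultimately show ?thesis by simp
  qed
  finally show ?thesis unfolding wconst_def
    by (simp flip: ennreal_mult)
qed

lemma wavg_piece:
  fixes u :: "real \<times> 'a::euclidean_space \<Rightarrow> ennreal"
  assumes "0 < r" and [measurable]: "u \<in> borel_measurable borel" "P \<in> sets borel"
    and "P \<subseteq> wbox \<tau> z" "0 < \<tau>" "0 < t" "\<tau> \<le> 2 * t"
  shows "wconst DIM('a) r t * Lnorm lborel r (\<lambda>w. indicator P w * (ennreal (fst w powr - \<beta>) * u w))
    \<le> ennreal (2 powr (real (DIM('a) + 1) / enn2real r)) * wavg r \<beta> u \<tau> z"
proof -
  have "Lnorm lborel r (\<lambda>w. indicator P w * (ennreal (fst w powr - \<beta>) * u w))
     \<le> Lnorm lborel r (\<lambda>w. indicator (wbox \<tau> z) w * (ennreal (fst w powr - \<beta>) * u w))"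
    using assms(1,4) by (intro Lnorm_mono) (auto simp: indicator_def)
  from mult_mono[OF wconst_compare[OF assms(5-7), of "DIM('a)" r] this] show ?thesis
    by (simp add: wavg_def mult.assoc)
qed

text \<open>Within a box the height is comparable to the scale, so one exponent can be exchanged for
  another at the price of a power of the scale. This lets unweighted averages serve \<beta>0,
  \<beta>1 and \<beta> alike.\<close>

lemma powr_compare:
  fixes s T :: real
  assumes "0 < T" "T / 4 \<le> s" "s \<le> T"
  shows "s powr - \<beta> \<le> 4 powr \<bar>\<beta>' - \<beta>\<bar> * T powr (\<beta>' - \<beta>) * s powr - \<beta>'"
proof -
  have s: "0 < s" using assms by linarith
  define \<gamma> where "\<gamma> = \<beta>' - \<beta>"
  have "(s / T) powr \<gamma> \<le> 4 powr \<bar>\<gamma>\<bar>"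
  proof (cases "0 \<le> \<gamma>")
    case True
    have "(s / T) powr \<gamma> \<le> 1 powr \<gamma>" using True assms s by (intro powr_mono2) auto
    also have "\<dots> \<le> 4 powr \<bar>\<gamma>\<bar>" by (simp add: ge_one_powr_ge_zero)
    finally show ?thesis .
  next
    case False
    have "(s / T) powr \<gamma> \<le> (1 / 4) powr \<gamma>" using False assms s by (intro powr_mono2') (auto simp: field_simps)
    also have "\<dots> = 4 powr \<bar>\<gamma>\<bar>" using False by (simp add: powr_divide powr_minus_divide[symmetric])
    finally show ?thesis .
  qed
  then have "s powr \<gamma> \<le> 4 powr \<bar>\<gamma>\<bar> * T powr \<gamma>"
    using assms s by (simp add: powr_divide field_simps)
  then have "s powr \<gamma> * s powr - \<beta>' \<le> 4 powr \<bar>\<gamma>\<bar> * T powr \<gamma> * s powr - \<beta>'"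
    by (rule mult_right_mono) simp
  then show ?thesis by (simp add: \<gamma>_def flip: powr_add)
qed

definition neighbour_const :: "nat \<Rightarrow> nat \<Rightarrow> ennreal \<Rightarrow> real \<Rightarrow> real \<Rightarrow> ennreal" where
  "neighbour_const d N r \<beta> \<beta>' = ennreal (4 powr \<bar>\<beta>' - \<beta>\<bar>) * (Lconst r ^ N * (Lconst r * ennreal (2 powr (real (d + 1) / enn2real r))))"

lemma neighbour_const_finite: "neighbour_const d N r \<beta> \<beta>' < top"
  using Lconst_bounds(2)[of r] unfolding neighbour_const_def
  by (auto simp: ennreal_mult_less_top power_less_top_ennreal)

text \<open>The box is cut horizontally in two and laterally by the scaled net. Every upper piece
  lies in each box competing in the infimum for the strip k + 1, every lower piece in each box
  competing for k - 1.\<close>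

lemma wavg_le_winf:
  fixes u :: "real \<times> 'a::euclidean_space \<Rightarrow> ennreal"
  assumes r: "0 < r" and u [measurable]: "u \<in> borel_measurable borel" and t: "t \<in> strip (1/8) k"
  shows "wavg r \<beta> u t x \<le> neighbour_const DIM('a) (card (cover_net :: 'a set)) r \<beta> \<beta>' *
      (ennreal (scale k powr (\<beta>' - \<beta>)) *
      (\<Sum>e\<in>cover_net. winf r \<beta>' u (k + 1) (x + scale k *\<^sub>R e) + winf r \<beta>' u (k - 1) (x + scale k *\<^sub>R e)))"
proof -
  define B where "B = (\<lambda>e. ball (x + scale k *\<^sub>R e) (scale k / 4))"
  \<comment> \<open>A height \<tau> in strip k + 1 satisfies \<open>scale k < \<tau>\<close> and
    \<open>\<tau> / 2 \<le> scale (k - 2)\<close>, so its box contains the heights of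
    \<open>P\<close>. In strip k - 1 it satisfies \<open>scale (k - 2) < \<tau>\<close> and
    \<open>\<tau> / 2 \<le> scale (k - 1) / 2\<close>, which fits \<open>Q\<close>.\<close>
  define P where "P = (\<lambda>e. {scale (k - 2)<..scale k} \<times> B e)"
  define Q where "Q = (\<lambda>e. {scale (k - 1) / 2<..scale (k - 2)} \<times> B e)"
  have [measurable]: "P e \<in> sets borel" "Q e \<in> sets borel" for e
    unfolding P_def Q_def B_def by (auto simp flip: borel_prod)
  define g where "g = (\<lambda>w. ennreal (fst w powr - \<beta>') * u w)"
  have [measurable]: "g \<in> borel_measurable borel" unfolding g_def by measurable
  define c where "c = ennreal (4 powr \<bar>\<beta>' - \<beta>\<bar> * scale k powr (\<beta>' - \<beta>))"
  have t': "scale (k - 1) < t" "t \<le> scale k" "0 < t" using t strip_pos[OF t] by (auto simp: strip_scale)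
  have s1: "scale k \<le> 2 * scale (k - 1)" using scale_double[of "k - 1"] scale_le_iff(1)[of k "k + 2"]
    by (smt (verit) scale_le_iff(1))
  have "scale (k + 1) \<le> 2 * scale (k - 2)"
    using scale_double[of "k - 2"] by (simp add: add.commute[of k 1])
  moreover have "scale (k - 2) \<le> scale k" "scale (k - 2) \<le> scale (k - 1)"
    by simp_all
  ultimately have s2: "scale (k + 1) \<le> 2 * scale (k - 2)" "scale (k + 1) \<le> 2 * scale k"
    "scale (k + 1) \<le> 2 * scale (k - 1)"
    by linarith+
  \<comment> \<open>The distances add up to less than 1/4 + 1/8 = 3/8 of
    \<open>scale (k + 1)\<close>, hence to less than 3/4 of \<open>scale (k - 2)\<close>. This is
    the reason for the radii 1/4 in the net and 1/8 in \<open>winf\<close>.\<close>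
  have ball: "dist z y < \<tau>" if "y \<in> B e" "dist (x + scale k *\<^sub>R e) z < scale j / 8" "j \<le> k + 1" "scale (k - 2) < \<tau>" for y z e \<tau> j
  proof -
    have "dist z y \<le> dist (x + scale k *\<^sub>R e) z + dist (x + scale k *\<^sub>R e) y"
      by (metis dist_commute dist_triangle)
    moreover have "scale j \<le> scale (k + 1)" using that(3) by simp
    moreover have "scale k \<le> scale (k + 1)" by simp
    moreover have "dist (x + scale k *\<^sub>R e) y < scale k / 4" using that(1) by (simp add: B_def)
    ultimately show ?thesis using that(2,4) s2(1) scale_pos[of "k - 2"] by linarith
  qed
  have P: "P e \<subseteq> wbox \<tau> z" if "\<tau> \<in> strip (1/8) (k + 1)" "dist (x + scale k *\<^sub>R e) z < scale (k + 1) / 8" for e \<tau> z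
  proof
    fix w assume w: "w \<in> P e"
    have \<tau>: "scale k < \<tau>" "\<tau> \<le> scale (k + 1)" using that(1) by (auto simp: strip_scale)
    have "scale (k - 2) < \<tau>" using \<tau>(1) by (rule order.strict_trans[rotated]) simp
    then have "dist z (snd w) < \<tau>" using w ball[OF _ that(2)] by (auto simp: P_def)
    then show "w \<in> wbox \<tau> z" using w \<tau> s2 by (auto simp: P_def mem_wbox)
  qed
  have Q: "Q e \<subseteq> wbox \<tau> z" if "\<tau> \<in> strip (1/8) (k - 1)" "dist (x + scale k *\<^sub>R e) z < scale (k - 1) / 8" for e \<tau> z
  proof
    fix w assume w: "w \<in> Q e"
    have \<tau>: "scale (k - 2) < \<tau>" "\<tau> \<le> scale (k - 1)" using that(1) by (auto simp: strip_scale)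
    then have "dist z (snd w) < \<tau>" using w ball[OF _ that(2)] by (auto simp: Q_def)
    then show "w \<in> wbox \<tau> z" using w \<tau> by (auto simp: Q_def mem_wbox)
  qed
  let ?W = "wconst DIM('a) r t" and ?D = "ennreal (2 powr (real (DIM('a) + 1) / enn2real r))"
  have WP: "?W * Lnorm lborel r (\<lambda>w. indicator (P e) w * g w) \<le> ?D * winf r \<beta>' u (k + 1) (x + scale k *\<^sub>R e)" for e
    unfolding winf_def
  proof (rule le_mult_INF_ennreal)
    fix i assume i: "i \<in> strip (1/8) (k + 1) \<times> ball (x + scale k *\<^sub>R e) (scale (k + 1) / 8)"
    obtain \<tau> z where [simp]: "i = (\<tau>, z)" by (cases i)
    have \<tau>: "\<tau> \<in> strip (1/8) (k + 1)" using i by simp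
    have "?W * Lnorm lborel r (\<lambda>w. indicator (P e) w * g w) \<le> ?D * wavg r \<beta>' u \<tau> z"
      unfolding g_def using r t' s2 i strip_scale[of \<tau> "k + 1"] strip_pos[OF \<tau>]
      by (intro wavg_piece P \<tau>) (auto intro: less_imp_le)
    then show "?W * Lnorm lborel r (\<lambda>w. indicator (P e) w * g w) \<le> ?D * (case i of (\<tau>, z) \<Rightarrow> wavg r \<beta>' u \<tau> z)"
      by simp
  qed simp
  have WQ: "?W * Lnorm lborel r (\<lambda>w. indicator (Q e) w * g w) \<le> ?D * winf r \<beta>' u (k - 1) (x + scale k *\<^sub>R e)" for e
    unfolding winf_def
  proof (rule le_mult_INF_ennreal)
    fix i assume i: "i \<in> strip (1/8) (k - 1) \<times> ball (x + scale k *\<^sub>R e) (scale (k - 1) / 8)"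
    obtain \<tau> z where [simp]: "i = (\<tau>, z)" by (cases i)
    have \<tau>: "\<tau> \<in> strip (1/8) (k - 1)" using i by simp
    have "?W * Lnorm lborel r (\<lambda>w. indicator (Q e) w * g w) \<le> ?D * wavg r \<beta>' u \<tau> z"
      unfolding g_def using r t' s2 i strip_scale[of \<tau> "k - 1"] strip_pos[OF \<tau>]
      by (intro wavg_piece Q \<tau>) (auto intro: less_imp_le)
    then show "?W * Lnorm lborel r (\<lambda>w. indicator (Q e) w * g w) \<le> ?D * (case i of (\<tau>, z) \<Rightarrow> wavg r \<beta>' u \<tau> z)"
      by simp
  qed simp
  have pt: "indicator (wbox t x) w * (ennreal (fst w powr - \<beta>) * u w)
     \<le> c * (\<Sum>e\<in>cover_net. indicator (P e) w * g w + indicator (Q e) w * g w)" for w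
  proof (cases "w \<in> wbox t x")
    case True
    then have w: "t / 2 < fst w" "fst w \<le> t" "dist x (snd w) < scale k"
      using t' by (auto simp: mem_wbox)
    obtain e where e: "e \<in> cover_net" "dist (x + scale k *\<^sub>R e) (snd w) < scale k / 4"
      using cover_net_scaled[OF scale_pos w(3)] .
    have "w \<in> P e \<or> w \<in> Q e" using w e(2) t' by (cases w) (auto simp: P_def Q_def B_def)
    then have "g w \<le> indicator (P e) w * g w + indicator (Q e) w * g w"
      by (auto simp: indicator_def)
    also have "\<dots> \<le> (\<Sum>e\<in>cover_net. indicator (P e) w * g w + indicator (Q e) w * g w)"
      using e(1) cover_net(1) by (intro member_le_sum) auto
    finally have "c * g w \<le> c * (\<Sum>e\<in>cover_net. indicator (P e) w * g w + indicator (Q e) w * g w)"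
      by (rule mult_left_mono) simp
    moreover have "ennreal (fst w powr - \<beta>) * u w \<le> c * g w"
    proof -
      have "fst w powr - \<beta> \<le> 4 powr \<bar>\<beta>' - \<beta>\<bar> * scale k powr (\<beta>' - \<beta>) * fst w powr - \<beta>'"
        using w t' s1 by (intro powr_compare) auto
      then have "ennreal (fst w powr - \<beta>) \<le> c * ennreal (fst w powr - \<beta>')"
        unfolding c_def by (subst ennreal_mult[symmetric]) (auto intro: ennreal_leI)
      from mult_right_mono[OF this, of "u w"] show ?thesis by (simp add: g_def mult.assoc)
    qed
    ultimately show ?thesis using True by simp
  qed simp
  let ?L = "Lnorm lborel r" and ?N = "Lconst r ^ card (cover_net :: 'a set)"
  have "?L (\<lambda>w. indicator (wbox t x) w * (ennreal (fst w powr - \<beta>) * u w))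
     \<le> ?L (\<lambda>w. c * (\<Sum>e\<in>cover_net. indicator (P e) w * g w + indicator (Q e) w * g w))"
    using r pt by (intro Lnorm_mono) auto
  also have "\<dots> \<le> c * ?L (\<lambda>w. \<Sum>e\<in>cover_net. indicator (P e) w * g w + indicator (Q e) w * g w)"
    using r by (intro Lnorm_cmult_le) auto
  also have "\<dots> \<le> c * (?N * (\<Sum>e\<in>cover_net. ?L (\<lambda>w. indicator (P e) w * g w + indicator (Q e) w * g w)))"
    using r cover_net(1) by (intro mult_left_mono Lnorm_sum_le) auto
  also have "\<dots> \<le> c * (?N * (\<Sum>e\<in>cover_net. Lconst r * (?L (\<lambda>w. indicator (P e) w * g w) + ?L (\<lambda>w. indicator (Q e) w * g w))))"
    using r by (intro mult_left_mono sum_mono Lnorm_add_le) auto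
  finally have "wavg r \<beta> u t x \<le> ?W * \<dots>"
    unfolding wavg_def by (rule mult_left_mono) simp
  also have "\<dots> = c * (?N * (Lconst r * (\<Sum>e\<in>cover_net. ?W * ?L (\<lambda>w. indicator (P e) w * g w) + ?W * ?L (\<lambda>w. indicator (Q e) w * g w))))"
    by (simp add: sum_distrib_left algebra_simps)
  also have "\<dots> \<le> c * (?N * (Lconst r * (\<Sum>e\<in>cover_net. ?D * winf r \<beta>' u (k + 1) (x + scale k *\<^sub>R e) + ?D * winf r \<beta>' u (k - 1) (x + scale k *\<^sub>R e))))"
    using WP WQ by (intro mult_left_mono sum_mono add_mono) auto
  also have "\<dots> = c * (?N * (Lconst r * ?D)) * (\<Sum>e\<in>cover_net. winf r \<beta>' u (k + 1) (x + scale k *\<^sub>R e) + winf r \<beta>' u (k - 1) (x + scale k *\<^sub>R e))"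
    by (simp add: sum_distrib_left algebra_simps)
  finally show ?thesis
    unfolding neighbour_const_def c_def by (simp add: ennreal_mult mult_ac)
qed

text \<open>Subtracting \<open>g\<close> reduces the claim to the defining property of the infimum;
  this needs \<open>g\<close> finite, while an infinite \<open>g\<close> makes the claim
  trivial.\<close>

lemma le_INF_add_ennreal:
  fixes b g :: ennreal
  assumes "\<And>i. i \<in> I \<Longrightarrow> b \<le> f i + g"
  shows "b \<le> (INF i\<in>I. f i) + g"
proof (cases "g = top")
  case False
  have "b - g \<le> (INF i\<in>I. f i)"
    using assms False by (intro INF_greatest) (simp add: ennreal_minus_le_iff add.commute)
  then show ?thesis using False by (simp add: ennreal_minus_le_iff add.commute)
qed simp

lemma le_INF_add_INF_ennreal:
  fixes b :: ennreal
  assumes "\<And>i j. i \<in> I \<Longrightarrow> j \<in> J \<Longrightarrow> b \<le> f i + g j"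
  shows "b \<le> (INF i\<in>I. f i) + (INF j\<in>J. g j)"
proof -
  have "b \<le> (INF i\<in>I. f i) + g j" if "j \<in> J" for j
    using assms that by (intro le_INF_add_ennreal) auto
  then show ?thesis
    using le_INF_add_ennreal[of J b g] by (simp add: add.commute)
qed

definition weight :: "real \<Rightarrow> int \<Rightarrow> ennreal" where
  "weight \<beta> k = ennreal (scale k powr - \<beta>)"

lemma weight_exp: "weight \<beta> k = ennreal (exp (- \<beta> / 8 * of_int k))"
  by (simp add: weight_def scale_def powr_def)

lemma weight_finite [simp]: "weight \<beta> k < top" "weight \<beta> k \<noteq> top" "weight \<beta> k \<noteq> 0" "0 < weight \<beta> k"
  by (simp_all add: weight_exp)

lemma weight_cancel: "weight \<beta> k * weight (- \<beta>) k = 1" "weight \<beta> k * (weight (- \<beta>) k * y) = y"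
    "weight (- \<beta>) k * (weight \<beta> k * y) = y"
  by (simp_all add: weight_exp mult_exp_exp flip: ennreal_mult mult.assoc)

lemma weight_neighbour:
  assumes "\<bar>j - k\<bar> \<le> 1"
  shows "weight \<beta> k \<le> ennreal (exp \<bar>\<beta>\<bar>) * weight \<beta> j"
proof -
  have "\<beta> / 8 * (of_int j - of_int k) \<le> \<bar>\<beta>\<bar>"
  proof -
    have "\<beta> / 8 * (of_int j - of_int k) \<le> \<bar>\<beta> / 8\<bar> * \<bar>of_int j - of_int k\<bar>"
      by (metis abs_ge_self abs_mult)
    also have "\<dots> \<le> \<bar>\<beta> / 8\<bar> * 1"
      using assms by (intro mult_left_mono) linarith+
    finally show ?thesis by simp
  qed
  then have "- \<beta> / 8 * of_int k \<le> \<bar>\<beta>\<bar> + - \<beta> / 8 * of_int j"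
    by (simp add: algebra_simps)
  then have "exp (- \<beta> / 8 * of_int k) \<le> exp \<bar>\<beta>\<bar> * exp (- \<beta> / 8 * of_int j)"
    by (simp only: exp_le_cancel_iff flip: exp_add)
  then show ?thesis
    by (simp add: weight_exp flip: ennreal_mult)
qed

lemma decay_neighbour:
  assumes "\<bar>j - k\<bar> \<le> 1" "0 \<le> \<epsilon>"
  shows "decay \<epsilon> (j - n) \<le> ennreal (exp \<epsilon>) * decay \<epsilon> (k - n)"
proof -
  have "\<bar>of_int (k - n)\<bar> \<le> 1 + \<bar>of_int (j - n) :: real\<bar>" using assms by linarith
  from mult_left_mono[OF this assms(2)]
  have "- \<epsilon> * \<bar>of_int (j - n)\<bar> \<le> \<epsilon> + - \<epsilon> * \<bar>of_int (k - n)\<bar>"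
    by (simp add: algebra_simps)
  then have "exp (- \<epsilon> * \<bar>of_int (j - n)\<bar>) \<le> exp \<epsilon> * exp (- \<epsilon> * \<bar>of_int (k - n)\<bar>)"
    by (simp only: exp_le_cancel_iff flip: exp_add)
  then show ?thesis
    by (simp add: decay_def flip: ennreal_mult)
qed

subsection \<open>Norms in terms of discrete Whitney averages\<close>

text \<open>The average is taken with exponent 0 and the power of the scale is kept apart in
  \<open>weight\<close>, so that one sequence describes \<open>f\<close> simultaneously in both tent
  spaces and in the Z-space.\<close>

definition wnorm :: "ennreal \<Rightarrow> ennreal \<Rightarrow> (real \<times> 'a::euclidean_space \<Rightarrow> ennreal) \<Rightarrow> int \<Rightarrow> ennreal" where
  "wnorm p r u k = Lnorm lborel p (wavg r 0 u (scale k))"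

lemma modulus_rep_borel: "modulus_rep f u \<Longrightarrow> u \<in> borel_measurable borel"
  by (simp add: modulus_rep_def)

lemma Lnorm_dtt_wavg_measurable:
  "u \<in> borel_measurable borel \<Longrightarrow> (\<lambda>x. Lnorm dtt q (\<lambda>t. wavg r \<beta> u t x)) \<in> borel_measurable borel"
  using Lnorm_dtt_measurable_param[OF wavg_measurable] .

lemma Lnorm_wavg_measurable:
  fixes u :: "real \<times> 'a::euclidean_space \<Rightarrow> ennreal"
  assumes "u \<in> borel_measurable borel"
  shows "(\<lambda>t. Lnorm lborel p (wavg r \<beta> u t)) \<in> borel_measurable borel"
proof -
  have "(\<lambda>(t, x). wavg r \<beta> u t x) \<in> borel_measurable (borel \<Otimes>\<^sub>M borel)"
    using measurable_pair_swap[OF wavg_measurable[OF assms]] by (simp add: case_prod_unfold)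
  also have "borel_measurable (borel \<Otimes>\<^sub>M borel) = borel_measurable ((borel :: real measure) \<Otimes>\<^sub>M (lborel :: 'a measure))"
    by (intro measurable_cong_sets sets_pair_measure_cong) auto
  finally show ?thesis
    by (intro Lnorm_measurable_param sigma_finite_lborel)
qed

lemma Lnorm_lebesgue: "0 < p \<Longrightarrow> g \<in> borel_measurable borel \<Longrightarrow> Lnorm lebesgue p g = Lnorm lborel p g"
  by (simp add: Lnorm_completion)

lemma whitney_eq_wavg_fun:
  "0 < r \<Longrightarrow> 0 < t \<Longrightarrow> modulus_rep f u \<Longrightarrow> whitney r \<beta> f t = wavg r \<beta> u t"
  by (intro ext whitney_eq_wavg)

lemma Z_norm_wavg:
  assumes "0 < p" "0 < r" "modulus_rep f u"
  shows "Z_norm p q r \<beta> f = Lnorm dtt q (\<lambda>t. Lnorm lborel p (wavg r \<beta> u t))"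
  unfolding Z_norm_def using assms
  by (intro Lnorm_cong) (simp add: whitney_eq_wavg_fun Lnorm_lebesgue wavg_measurable_x[OF modulus_rep_borel])

lemma tent_norm_wavg:
  fixes f :: "real \<times> 'a::euclidean_space \<Rightarrow> complex"
  assumes "0 < p" "0 < r" "modulus_rep f u"
  shows "tent_norm p q r \<beta> f =
     (if p < \<infinity> then Lnorm lborel p (\<lambda>x. Lnorm dtt q (\<lambda>t. wavg r \<beta> u t x))
      else if q < \<infinity> then
        (SUP \<tau>\<in>{0<..}. SUP y.
           epow (\<integral>\<^sup>+ t\<in>{0<..<\<tau>}. mean lebesgue (ball y \<tau>)
                  (\<lambda>x. epow (wavg r \<beta> u t x) (enn2real q)) \<partial>dtt)
             (1 / enn2real q))
      else (SUP t\<in>{0<..}. SUP x. wavg r \<beta> u t x))"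
proof -
  have 1: "(\<lambda>x. Lnorm dtt q (\<lambda>t. whitney r \<beta> f t x)) = (\<lambda>x. Lnorm dtt q (\<lambda>t. wavg r \<beta> u t x))"
    using assms by (intro ext Lnorm_cong) (simp add: whitney_eq_wavg_fun)
  have 2: "(\<integral>\<^sup>+ t\<in>{0<..<\<tau>}. mean lebesgue (ball y \<tau>) (\<lambda>x. epow (whitney r \<beta> f t x) (enn2real q)) \<partial>dtt)
    = (\<integral>\<^sup>+ t\<in>{0<..<\<tau>}. mean lebesgue (ball y \<tau>) (\<lambda>x. epow (wavg r \<beta> u t x) (enn2real q)) \<partial>dtt)" for \<tau> and y :: 'a
    using assms by (intro nn_integral_cong) (simp add: whitney_eq_wavg_fun)
  have 3: "(SUP t\<in>{0<..}. SUP x. whitney r \<beta> f t x) = (SUP t\<in>{0<..}. SUP x. wavg r \<beta> u t x)"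
    using assms by (intro SUP_cong) (simp_all add: whitney_eq_wavg_fun)
  show ?thesis
    unfolding tent_norm_def 1 2 3
    using assms by (simp add: Lnorm_lebesgue Lnorm_dtt_wavg_measurable[OF modulus_rep_borel])
qed

lemma Lnorm_net_sum_le:
  fixes g h :: "'a::euclidean_space \<Rightarrow> ennreal"
  assumes "0 < p" and [measurable]: "g \<in> borel_measurable borel" "h \<in> borel_measurable borel"
  shows "Lnorm lborel p (\<lambda>x. \<Sum>e\<in>cover_net. g (x + c *\<^sub>R e) + h (x + c *\<^sub>R e))
    \<le> Lconst p ^ card (cover_net :: 'a set) * (of_nat (card (cover_net :: 'a set)) * Lconst p) * (Lnorm lborel p g + Lnorm lborel p h)"
proof -
  let ?L = "Lnorm lborel p"
  have "?L (\<lambda>x. \<Sum>e\<in>cover_net. g (x + c *\<^sub>R e) + h (x + c *\<^sub>R e))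
    \<le> Lconst p ^ card (cover_net :: 'a set) * (\<Sum>e\<in>cover_net. ?L (\<lambda>x. g (x + c *\<^sub>R e) + h (x + c *\<^sub>R e)))"
    using assms(1) cover_net(1) by (intro Lnorm_sum_le) auto
  also have "\<dots> \<le> Lconst p ^ card (cover_net :: 'a set) * (\<Sum>e\<in>(cover_net :: 'a set). Lconst p * (?L g + ?L h))"
  proof (intro mult_left_mono sum_mono)
    fix e :: 'a
    have "?L (\<lambda>x. g (x + c *\<^sub>R e) + h (x + c *\<^sub>R e))
        \<le> Lconst p * (?L (\<lambda>x. g (x + c *\<^sub>R e)) + ?L (\<lambda>x. h (x + c *\<^sub>R e)))"
      using assms(1) by (intro Lnorm_add_le) auto
    then show "?L (\<lambda>x. g (x + c *\<^sub>R e) + h (x + c *\<^sub>R e)) \<le> Lconst p * (?L g + ?L h)"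
      using assms by (simp add: Lnorm_translate)
  qed simp
  finally show ?thesis by (simp add: mult_ac)
qed

lemma net_const_finite: "Lconst p ^ n * (of_nat n * Lconst p) < top"
  using Lconst_bounds(2)[of p] of_nat_less_top[of n]
  by (auto simp: ennreal_mult_less_top power_less_top_ennreal)

lemma winf_le_scale: "winf r \<beta> u j y \<le> wavg r \<beta> u (scale j) y"
  by (rule winf_le[OF scale_in_strip]) simp

lemma winf_le_any: "\<tau> \<in> strip (1/8) j \<Longrightarrow> winf r \<beta> u j y \<le> wavg r \<beta> u \<tau> y"
  by (rule winf_le) simp_all

text \<open>\<open>wavg_le_winf\<close> with target exponent 0; the infimum is then evaluated at its
  centre and at the top of its strip.\<close>

lemma wavg_le_scale:
  fixes u :: "real \<times> 'a::euclidean_space \<Rightarrow> ennreal"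
  assumes "0 < r" "u \<in> borel_measurable borel" "t \<in> strip (1/8) k"
  shows "wavg r \<beta> u t x \<le> neighbour_const DIM('a) (card (cover_net :: 'a set)) r \<beta> 0 * (weight \<beta> k *
      (\<Sum>e\<in>cover_net. wavg r 0 u (scale (k + 1)) (x + scale k *\<^sub>R e) + wavg r 0 u (scale (k - 1)) (x + scale k *\<^sub>R e)))"
  unfolding weight_def
  by (rule order_trans[OF wavg_le_winf[OF assms, of \<beta> x 0]])
     (auto intro!: mult_left_mono sum_mono add_mono winf_le_scale)

text \<open>\<open>wavg_le_winf\<close> with source exponent 0; the power of \<open>scale k\<close>
  it produces is the inverse of the weight on the left.\<close>

lemma scale_le_wavg:
  fixes u :: "real \<times> 'a::euclidean_space \<Rightarrow> ennreal"
  assumes "0 < r" "u \<in> borel_measurable borel"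
  shows "weight \<beta> k * wavg r 0 u (scale k) x \<le> neighbour_const DIM('a) (card (cover_net :: 'a set)) r 0 \<beta> *
      (\<Sum>e\<in>cover_net. winf r \<beta> u (k + 1) (x + scale k *\<^sub>R e) + winf r \<beta> u (k - 1) (x + scale k *\<^sub>R e))"
proof -
  let ?K = "neighbour_const DIM('a) (card (cover_net :: 'a set)) r 0 \<beta>"
  let ?S = "\<Sum>e\<in>cover_net. winf r \<beta> u (k + 1) (x + scale k *\<^sub>R e) + winf r \<beta> u (k - 1) (x + scale k *\<^sub>R e)"
  have "wavg r 0 u (scale k) x \<le> ?K * (weight (- \<beta>) k * ?S)"
    using wavg_le_winf[OF assms scale_in_strip, of 0 k x \<beta>] by (simp add: weight_def)
  then have "weight \<beta> k * wavg r 0 u (scale k) x \<le> weight \<beta> k * (?K * (weight (- \<beta>) k * ?S))"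
    by (rule mult_left_mono) simp
  also have "\<dots> = ?K * (weight \<beta> k * (weight (- \<beta>) k * ?S))"
    by (rule mult.left_commute)
  finally show ?thesis by (simp only: weight_cancel)
qed

text \<open>The second bound, for individual heights, serves the Z-norm. The first concerns the
  majorant, which is the same for all heights of a strip; the tent norm needs it because there the
  L^p norm is taken after the summation over scales.\<close>

lemma Lnorm_wavg_le:
  fixes p r :: ennreal
  assumes p: "0 < p" and r: "0 < r"
  shows "\<exists>C<top. \<forall>(u :: real \<times> 'a::euclidean_space \<Rightarrow> ennreal) k. \<forall>t\<in>strip (1/8) k. u \<in> borel_measurable borel \<longrightarrow>
     Lnorm lborel p (\<lambda>x. weight \<beta> k * (\<Sum>e\<in>cover_net. wavg r 0 u (scale (k + 1)) (x + scale k *\<^sub>R e)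
        + wavg r 0 u (scale (k - 1)) (x + scale k *\<^sub>R e)))
       \<le> C * (weight \<beta> (k + 1) * wnorm p r u (k + 1) + weight \<beta> (k - 1) * wnorm p r u (k - 1))
   \<and> Lnorm lborel p (wavg r \<beta> u t)
       \<le> C * (weight \<beta> (k + 1) * wnorm p r u (k + 1) + weight \<beta> (k - 1) * wnorm p r u (k - 1))"
proof -
  let ?N = "card (cover_net :: 'a set)"
  define M where "M = Lconst p ^ ?N * (of_nat ?N * Lconst p) * ennreal (exp \<bar>\<beta>\<bar>)"
  define K where "K = neighbour_const DIM('a) ?N r \<beta> 0"
  have fin: "M < top" "K < top"
    using net_const_finite neighbour_const_finite by (simp_all add: M_def K_def ennreal_mult_less_top)
  show ?thesis
  proof (intro exI[of _ "M + K * M"] conjI allI impI ballI)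
    fix u :: "real \<times> 'a \<Rightarrow> ennreal" and k t assume t: "t \<in> strip (1/8) k" and u [measurable]: "u \<in> borel_measurable borel"
    let ?D = "\<lambda>j. wavg r 0 u (scale j)"
    let ?b = "\<lambda>j. weight \<beta> j * wnorm p r u j"
    let ?H = "\<lambda>x. \<Sum>e\<in>cover_net. ?D (k + 1) (x + scale k *\<^sub>R e) + ?D (k - 1) (x + scale k *\<^sub>R e)"
    note [measurable] = wavg_measurable_x[OF u]
    have "Lnorm lborel p (\<lambda>x. weight \<beta> k * ?H x) \<le> weight \<beta> k * Lnorm lborel p ?H"
      using p by (intro Lnorm_cmult_le) auto
    also have "\<dots> \<le> weight \<beta> k * (Lconst p ^ ?N * (of_nat ?N * Lconst p) * (wnorm p r u (k + 1) + wnorm p r u (k - 1)))"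
      unfolding wnorm_def using p by (intro mult_left_mono Lnorm_net_sum_le) auto
    also have "\<dots> = Lconst p ^ ?N * (of_nat ?N * Lconst p) * (weight \<beta> k * wnorm p r u (k + 1) + weight \<beta> k * wnorm p r u (k - 1))"
      by (simp add: algebra_simps)
    also have "\<dots> \<le> Lconst p ^ ?N * (of_nat ?N * Lconst p) *
        (ennreal (exp \<bar>\<beta>\<bar>) * weight \<beta> (k + 1) * wnorm p r u (k + 1) + ennreal (exp \<bar>\<beta>\<bar>) * weight \<beta> (k - 1) * wnorm p r u (k - 1))"
      by (intro mult_left_mono add_mono mult_right_mono weight_neighbour) auto
    also have "\<dots> = M * (?b (k + 1) + ?b (k - 1))"
      by (simp add: M_def algebra_simps)
    finally have 1: "Lnorm lborel p (\<lambda>x. weight \<beta> k * ?H x) \<le> M * (?b (k + 1) + ?b (k - 1))" .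
    then show "Lnorm lborel p (\<lambda>x. weight \<beta> k * ?H x) \<le> (M + K * M) * (?b (k + 1) + ?b (k - 1))"
      by (rule order_trans) (simp add: mult_right_mono)
    have "Lnorm lborel p (wavg r \<beta> u t) \<le> Lnorm lborel p (\<lambda>x. K * (weight \<beta> k * ?H x))"
      unfolding K_def using p by (intro Lnorm_mono wavg_le_scale[OF r u t]) auto
    also have "\<dots> \<le> K * Lnorm lborel p (\<lambda>x. weight \<beta> k * ?H x)"
      using p by (intro Lnorm_cmult_le) auto
    also have "\<dots> \<le> K * (M * (?b (k + 1) + ?b (k - 1)))"
      by (intro mult_left_mono 1) auto
    also have "\<dots> \<le> (M + K * M) * (?b (k + 1) + ?b (k - 1))"
      by (simp add: mult.assoc[symmetric] mult_right_mono)
    finally show "Lnorm lborel p (wavg r \<beta> u t) \<le> (M + K * M) * (?b (k + 1) + ?b (k - 1))" .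
  qed (use fin in \<open>simp add: ennreal_mult_less_top\<close>)
qed

section \<open>The Z-norm as a weighted sequence quasi-norm\<close>

lemma bij_shift_int: "bij (\<lambda>k::int. k + j)"
  by (rule bij_betw_byWitness[where f'="\<lambda>k. k - j"]) auto

lemma Lnorm_neighbour_le:
  assumes "0 < q"
  shows "Lnorm (count_space UNIV) q (\<lambda>k::int. C * (b (k + 1) + b (k - 1)))
    \<le> C * (Lconst q * (2 * Lnorm (count_space UNIV) q b))"
proof -
  let ?L = "Lnorm (count_space UNIV) q"
  have "?L (\<lambda>k::int. C * (b (k + 1) + b (k - 1))) \<le> C * ?L (\<lambda>k. b (k + 1) + b (k - 1))"
    by (rule Lnorm_cmult_le[OF assms]) simp
  also have "?L (\<lambda>k. b (k + 1) + b (k - 1)) \<le> Lconst q * (?L (\<lambda>k. b (k + 1)) + ?L (\<lambda>k. b (k - 1)))"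
    by (rule Lnorm_add_le[OF assms]) simp_all
  also have "?L (\<lambda>k. b (k + 1)) = ?L b"
    by (rule Lnorm_count_space_bij[OF bij_shift_int])
  also have "?L (\<lambda>k. b (k - 1)) = ?L b"
    using Lnorm_count_space_bij[OF bij_shift_int[of "- 1"], of q b] by simp
  finally show ?thesis by (simp add: mult_2 mult_left_mono)
qed

lemma Z_norm_le_discrete:
  assumes p: "0 < p" and q: "0 < q" and r: "0 < r"
  shows "\<exists>C<top. \<forall>(f :: real \<times> 'a::euclidean_space \<Rightarrow> complex) u. modulus_rep f u \<longrightarrow>
    Z_norm p q r \<beta> f \<le> C * Lnorm (count_space UNIV) q (\<lambda>k. weight \<beta> k * wnorm p r u k)"
proof -
  obtain C where C: "C < top" and *: "\<And>(u :: real \<times> 'a \<Rightarrow> ennreal) k t. t \<in> strip (1/8) k \<Longrightarrow> u \<in> borel_measurable borel \<Longrightarrow>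
      Lnorm lborel p (wavg r \<beta> u t)
       \<le> C * (weight \<beta> (k + 1) * wnorm p r u (k + 1) + weight \<beta> (k - 1) * wnorm p r u (k - 1))"
    using Lnorm_wavg_le[OF p r, of \<beta>] by blast
  let ?h = "ennreal (\<bar>1/8\<bar> powr (1 / enn2real q))"
  show ?thesis
  proof (intro exI[of _ "?h * (C * (Lconst q * 2))"] conjI allI impI)
    show "?h * (C * (Lconst q * 2)) < top"
      using C Lconst_bounds(2) by (simp add: ennreal_mult_less_top)
    fix f :: "real \<times> 'a \<Rightarrow> complex" and u assume rep: "modulus_rep f u"
    note u = modulus_rep_borel[OF rep]
    let ?b = "\<lambda>k. weight \<beta> k * wnorm p r u k"
    have "Z_norm p q r \<beta> f \<le> ?h * Lnorm (count_space UNIV) q (\<lambda>k. C * (?b (k + 1) + ?b (k - 1)))"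
      unfolding Z_norm_wavg[OF p r rep] using *[OF _ u] q u
      by (intro strip_upper measurable_dtt Lnorm_wavg_measurable) auto
    also have "\<dots> \<le> ?h * (C * (Lconst q * (2 * Lnorm (count_space UNIV) q ?b)))"
      using q by (intro mult_left_mono Lnorm_neighbour_le) auto
    finally show "Z_norm p q r \<beta> f \<le> ?h * (C * (Lconst q * 2)) * Lnorm (count_space UNIV) q ?b"
      by (simp add: mult.assoc)
  qed
qed

lemma discrete_le_Z_norm:
  assumes p: "0 < p" and q: "0 < q" and r: "0 < r"
  shows "\<exists>C<top. \<forall>(f :: real \<times> 'a::euclidean_space \<Rightarrow> complex) u. modulus_rep f u \<longrightarrow>
    Lnorm (count_space UNIV) q (\<lambda>k. weight \<beta> k * wnorm p r u k) \<le> C * Z_norm p q r \<beta> f"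
proof -
  let ?N = "card (cover_net :: 'a set)"
  let ?K = "neighbour_const DIM('a) ?N r 0 \<beta>" and ?M = "Lconst p ^ ?N * (of_nat ?N * Lconst p)"
  let ?h = "\<bar>1/8\<bar> powr (1 / enn2real q)"
  have "ennreal (1 / ?h) * ennreal ?h = 1" by (simp flip: ennreal_mult)
  then have h: "ennreal (1 / ?h) * (ennreal ?h * y) = y" for y
    by (metis mult.assoc mult_1)
  \<comment> \<open>Adding 1 keeps \<open>C\<close> away from 0, since only a positive finite factor
    is moved past an infimum below.\<close>
  define C where "C = (?K + 1) * (?M + 1)"
  have fin: "?K + 1 < top" "?M + 1 < top"
    using net_const_finite[of p ?N] neighbour_const_finite by auto
  have C: "C < top" "C \<noteq> 0"
    using fin by (simp_all add: C_def ennreal_mult_less_top)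
  have C3: "?K * ?M \<le> C"
    unfolding C_def by (intro mult_mono) auto
  show ?thesis
  proof (intro exI[of _ "C * (Lconst q * 2) * ennreal (1 / ?h)"] conjI allI impI)
    show "C * (Lconst q * 2) * ennreal (1 / ?h) < top"
      using C Lconst_bounds(2) by (simp add: ennreal_mult_less_top)
    fix f :: "real \<times> 'a \<Rightarrow> complex" and u assume rep: "modulus_rep f u"
    note u [measurable] = modulus_rep_borel[OF rep]
    note [measurable] = wavg_measurable_x[OF u]
    define A where "A = (\<lambda>t. Lnorm lborel p (wavg r \<beta> u t))"
    \<comment> \<open>The infimum is taken after the L^p norm. For fixed heights the averages are
      Borel in \<open>x\<close>, so translation invariance applies; the uncountable infimum
      \<open>winf\<close> is bounded by them first.\<close>
    define c where "c = (\<lambda>j. INF \<tau>\<in>strip (1/8) j. A \<tau>)"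
    have b: "weight \<beta> k * wnorm p r u k \<le> C * (c (k + 1) + c (k - 1))" for k
    proof -
      have "weight \<beta> k * wnorm p r u k \<le> C * A \<tau> + C * A \<tau>'"
        if \<tau>: "\<tau> \<in> strip (1/8) (k + 1)" "\<tau>' \<in> strip (1/8) (k - 1)" for \<tau> \<tau>'
      proof -
        have "weight \<beta> k * wnorm p r u k = Lnorm lborel p (\<lambda>x. weight \<beta> k * wavg r 0 u (scale k) x)"
          unfolding wnorm_def using p by (intro Lnorm_cmult[symmetric]) auto
        also have "\<dots> \<le> Lnorm lborel p (\<lambda>x. ?K * (\<Sum>e\<in>cover_net. wavg r \<beta> u \<tau> (x + scale k *\<^sub>R e) + wavg r \<beta> u \<tau>' (x + scale k *\<^sub>R e)))"
          using p by (intro Lnorm_mono order_trans[OF scale_le_wavg[OF r u]] mult_left_mono sum_mono add_mono winf_le_any \<tau>) auto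
        also have "\<dots> \<le> ?K * Lnorm lborel p (\<lambda>x. \<Sum>e\<in>cover_net. wavg r \<beta> u \<tau> (x + scale k *\<^sub>R e) + wavg r \<beta> u \<tau>' (x + scale k *\<^sub>R e))"
          using p by (intro Lnorm_cmult_le) auto
        also have "\<dots> \<le> ?K * (?M * (A \<tau> + A \<tau>'))"
          unfolding A_def using p by (intro mult_left_mono Lnorm_net_sum_le) auto
        also have "\<dots> \<le> C * (A \<tau> + A \<tau>')"
          using mult_right_mono[OF C3, of "A \<tau> + A \<tau>'"] by (simp only: mult.assoc zero_le simp_thms)
        finally show ?thesis by (simp add: distrib_left)
      qed
      then have "weight \<beta> k * wnorm p r u k \<le> (INF \<tau>\<in>strip (1/8) (k + 1). C * A \<tau>) + (INF \<tau>\<in>strip (1/8) (k - 1). C * A \<tau>)"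
        by (rule le_INF_add_INF_ennreal)
      moreover have "(INF \<tau>\<in>strip (1/8) j. C * A \<tau>) \<le> C * c j" for j
      proof -
        obtain C' where C': "C = ennreal C'" "0 < C'"
          using C(1,2) by (cases C) (auto simp: less_le)
        show ?thesis unfolding c_def C'(1)
          by (rule le_mult_INF_ennreal[OF C'(2)]) (rule INF_lower)
      qed
      ultimately show ?thesis
        unfolding distrib_left by (meson add_mono order_trans)
    qed
    have "Lnorm (count_space UNIV) q (\<lambda>k. weight \<beta> k * wnorm p r u k) \<le> Lnorm (count_space UNIV) q (\<lambda>k. C * (c (k + 1) + c (k - 1)))"
      using q b by (intro Lnorm_mono) auto
    also have "\<dots> \<le> C * (Lconst q * (2 * Lnorm (count_space UNIV) q c))"
      by (rule Lnorm_neighbour_le[OF q])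
    also have "\<dots> = C * (Lconst q * (2 * (ennreal (1 / ?h) * (ennreal ?h * Lnorm (count_space UNIV) q c))))"
      by (simp only: h)
    also have "\<dots> \<le> C * (Lconst q * (2 * (ennreal (1 / ?h) * Z_norm p q r \<beta> f)))"
      unfolding Z_norm_wavg[OF p r rep] A_def[symmetric]
      using q by (intro mult_left_mono strip_lower) (auto simp: c_def A_def intro: INF_lower)
    finally show "Lnorm (count_space UNIV) q (\<lambda>k. weight \<beta> k * wnorm p r u k) \<le> C * (Lconst q * 2) * ennreal (1 / ?h) * Z_norm p q r \<beta> f"
      by (simp only: mult.assoc)
  qed
qed

section \<open>The tent norm dominates each discrete average\<close>

lemma emeasure_ball_nonzero: "0 < \<tau> \<Longrightarrow> emeasure lborel (ball (y::'a::euclidean_space) \<tau>) \<noteq> 0"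
  by (simp add: emeasure_ball less_imp_neq[OF unit_ball_vol_pos, symmetric])

text \<open>The infimum is a constant minorant on a strip of measure 1/8, that is, a single term of
  an l^q quasi-norm.\<close>

lemma winf_le_Lnorm_dtt:
  assumes "0 < q"
  shows "winf r \<beta> u j y \<le> ennreal (1 / \<bar>1/8\<bar> powr (1 / enn2real q)) * Lnorm dtt q (\<lambda>t. wavg r \<beta> u t y)"
proof -
  let ?h = "\<bar>1/8\<bar> powr (1 / enn2real q)"
  have h: "ennreal (1 / ?h) * ennreal ?h = 1" by (simp flip: ennreal_mult)
  have "ennreal ?h * winf r \<beta> u j y \<le> ennreal ?h * Lnorm (count_space UNIV) q (\<lambda>j. winf r \<beta> u j y)"
    using Lnorm_count_space_ge[OF assms, of "\<lambda>j. winf r \<beta> u j y"] by (intro mult_left_mono) auto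
  also have "\<dots> \<le> Lnorm dtt q (\<lambda>t. wavg r \<beta> u t y)"
    by (intro strip_lower assms winf_le_any) auto
  finally have "ennreal (1 / ?h) * (ennreal ?h * winf r \<beta> u j y) \<le> ennreal (1 / ?h) * Lnorm dtt q (\<lambda>t. wavg r \<beta> u t y)"
    by (rule mult_left_mono) simp
  then show ?thesis by (simp only: mult.assoc[symmetric] h mult_1)
qed

lemma winf_le_tent_finite:
  fixes u :: "real \<times> 'a::euclidean_space \<Rightarrow> ennreal"
  assumes q: "0 < q" "q \<noteq> top"
  shows "winf r \<beta> u j y \<le> ennreal ((8 * 16 ^ DIM('a)) powr (1 / enn2real q)) *
      (SUP \<tau>\<in>{0<..}. SUP y.
           epow (\<integral>\<^sup>+ t\<in>{0<..<\<tau>}. mean lebesgue (ball y \<tau>)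
                  (\<lambda>x. epow (wavg r \<beta> u t x) (enn2real q)) \<partial>dtt)
             (1 / enn2real q))" (is "_ \<le> _ * ?T")
proof -
  define a where "a = enn2real q"
  have a: "0 < a" using enn2real_pos q by (simp add: a_def)
  define w where "w = epow (winf r \<beta> u j y) a"
  \<comment> \<open>The factor 2 places the strip, which contains \<open>scale j\<close> itself,
    inside the open interval \<open>{0<..<\<tau>}\<close>.\<close>
  define \<tau> where "\<tau> = 2 * scale j"
  \<comment> \<open>The volume ratio of the balls of radii \<open>scale j / 8\<close> and
    \<open>2 * scale j\<close>. Together with the measure 1/8 of the strip it yields the constant of
    the statement.\<close>
  define c :: real where "c = 1 / 16 ^ DIM('a)"
  have \<tau>: "0 < \<tau>" by (simp add: \<tau>_def)
  let ?V = "unit_ball_vol DIM('a)"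
  have m: "ennreal c * w \<le> mean lebesgue (ball y \<tau>) (\<lambda>x. epow (wavg r \<beta> u t x) a)" if t: "t \<in> strip (1/8) j" for t
  proof -
    have "w * emeasure lebesgue (ball y (scale j / 8)) = (\<integral>\<^sup>+x. w * indicator (ball y (scale j / 8)) x \<partial>lebesgue)"
      by (simp add: nn_integral_cmult_indicator)
    also have "\<dots> \<le> (\<integral>\<^sup>+x. epow (wavg r \<beta> u t x) a * indicator (ball y \<tau>) x \<partial>lebesgue)"
    proof (intro nn_integral_mono)
      fix x
      show "w * indicator (ball y (scale j / 8)) x \<le> epow (wavg r \<beta> u t x) a * indicator (ball y \<tau>) x"
      proof (cases "x \<in> ball y (scale j / 8)")
        case True
        then have "dist y x < scale j / 8" by simp
        then have "x \<in> ball y \<tau>"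
          using scale_pos[of j] unfolding \<tau>_def mem_ball by linarith
        moreover have "w \<le> epow (wavg r \<beta> u t x) a"
          unfolding w_def using a True t by (intro epow_mono winf_le) auto
        ultimately show ?thesis using True by simp
      qed simp
    qed
    finally have "w * emeasure lebesgue (ball y (scale j / 8)) / emeasure lebesgue (ball y \<tau>)
        \<le> mean lebesgue (ball y \<tau>) (\<lambda>x. epow (wavg r \<beta> u t x) a)"
      unfolding mean_def by (rule divide_right_mono_ennreal)
    moreover have "emeasure lebesgue (ball y (scale j / 8)) = ennreal c * emeasure lebesgue (ball y \<tau>)"
    proof -
      have "scale j / 8 = \<tau> / 16" by (simp add: \<tau>_def)
      then have "?V * (scale j / 8) ^ DIM('a) = c * (?V * \<tau> ^ DIM('a))"
        by (simp only: c_def power_divide) simp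
      then show ?thesis using \<tau>
        by (simp add: emeasure_ball c_def less_imp_le flip: ennreal_mult)
    qed
    moreover have "emeasure lebesgue (ball y \<tau>) \<noteq> 0" "emeasure lebesgue (ball y \<tau>) \<noteq> top"
      using \<tau> emeasure_ball_nonzero[OF \<tau>, of y] by (simp_all, simp add: emeasure_ball)
    ultimately show ?thesis
      by (simp add: mult.assoc[symmetric] mult.commute[of w] ennreal_mult_divide_eq)
  qed
  have "ennreal (c * (1/8)) * w = (\<integral>\<^sup>+t. ennreal c * w * indicator (strip (1/8) j) t \<partial>dtt)"
  proof -
    have "(\<integral>\<^sup>+t. ennreal c * w * indicator (strip (1/8) j) t \<partial>dtt) = ennreal c * w * ennreal \<bar>1/8\<bar>"
      by (subst nn_integral_cmult_indicator) (simp_all add: emeasure_dtt_strip)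
    also have "\<dots> = (ennreal c * ennreal (1/8)) * w"
      by (simp only: mult_ac abs_of_nonneg zero_le_divide_1_iff zero_le_numeral)
    also have "ennreal c * ennreal (1/8) = ennreal (c * (1/8))"
      by (rule ennreal_mult''[symmetric]) simp
    finally show ?thesis by (rule sym)
  qed
  also have "\<dots> \<le> (\<integral>\<^sup>+ t\<in>{0<..<\<tau>}. mean lebesgue (ball y \<tau>) (\<lambda>x. epow (wavg r \<beta> u t x) a) \<partial>dtt)"
  proof (intro nn_integral_mono)
    fix t
    show "ennreal c * w * indicator (strip (1/8) j) t
        \<le> mean lebesgue (ball y \<tau>) (\<lambda>x. epow (wavg r \<beta> u t x) a) * indicator {0<..<\<tau>} t"
    proof (cases "t \<in> strip (1/8) j")
      case True
      then have "t \<in> {0<..<\<tau>}" using strip_pos[OF True] scale_pos[of j] by (simp add: \<tau>_def strip_scale)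
      then show ?thesis using True m by simp
    qed simp
  qed
  finally have "epow (ennreal (c * (1/8)) * w) (1 / a)
      \<le> epow (\<integral>\<^sup>+ t\<in>{0<..<\<tau>}. mean lebesgue (ball y \<tau>) (\<lambda>x. epow (wavg r \<beta> u t x) a) \<partial>dtt) (1 / a)"
    using a by (intro epow_mono) auto
  also have "\<dots> \<le> ?T"
    unfolding a_def using \<tau> by (intro SUP_upper2[of \<tau>] SUP_upper2[of y]) auto
  also have "epow (ennreal (c * (1/8)) * w) (1 / a) = ennreal ((c * (1/8)) powr (1 / a)) * winf r \<beta> u j y"
    using a by (simp add: epow_mult w_def epow_ennreal c_def)
  finally have "ennreal ((8 * 16 ^ DIM('a)) powr (1 / a)) * (ennreal ((c * (1/8)) powr (1 / a)) * winf r \<beta> u j y)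
      \<le> ennreal ((8 * 16 ^ DIM('a)) powr (1 / a)) * ?T"
    by (rule mult_left_mono) simp
  moreover have "(8 * 16 ^ DIM('a)) powr (1 / a) * (c * (1/8)) powr (1 / a) = 1"
    by (subst powr_mult[symmetric]) (simp_all add: c_def)
  then have "ennreal ((8 * 16 ^ DIM('a)) powr (1 / a)) * ennreal ((c * (1/8)) powr (1 / a)) = 1"
    by (simp flip: ennreal_mult)
  ultimately show ?thesis
    by (simp only: mult.assoc[symmetric] mult_1 a_def)
qed

lemma winf_le_tent_infinity:
  fixes r :: ennreal
  assumes q: "0 < q" and r: "0 < r"
  shows "\<exists>C<top. \<forall>(f :: real \<times> 'a::euclidean_space \<Rightarrow> complex) u j y. modulus_rep f u \<longrightarrow>
     winf r \<beta> u j y \<le> C * tent_norm \<infinity> q r \<beta> f"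
proof (cases "q = top")
  case True
  have "winf r \<beta> u j y \<le> 1 * tent_norm \<infinity> q r \<beta> f" if "modulus_rep f u"
    for f :: "real \<times> 'a \<Rightarrow> complex" and u j y
  proof -
    have "winf r \<beta> u j y \<le> wavg r \<beta> u (scale j) y"
      by (rule winf_le_scale)
    also have "\<dots> \<le> (SUP x. wavg r \<beta> u (scale j) x)"
      by (rule SUP_upper) simp
    also have "\<dots> \<le> (SUP t\<in>{0<..}. SUP x. wavg r \<beta> u t x)"
      by (rule SUP_upper[where f="\<lambda>t. SUP x. wavg r \<beta> u t x"]) simp
    finally show ?thesis
      using tent_norm_wavg[OF _ r that, of \<infinity> q \<beta>] True by simp
  qed
  then show ?thesis by (intro exI[of _ 1]) auto
next
  case False
  then have "q < \<infinity>" by (simp add: less_top)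
  have "winf r \<beta> u j y \<le> ennreal ((8 * 16 ^ DIM('a)) powr (1 / enn2real q)) * tent_norm \<infinity> q r \<beta> f"
    if "modulus_rep f u" for f :: "real \<times> 'a \<Rightarrow> complex" and u j y
    using winf_le_tent_finite[OF q False, of r \<beta> u j y] tent_norm_wavg[OF _ r that, of \<infinity> q \<beta>] \<open>q < \<infinity>\<close>
    by simp
  then show ?thesis by (intro exI[of _ "ennreal ((8 * 16 ^ DIM('a)) powr (1 / enn2real q))"]) auto
qed

text \<open>For p = \<infinity> the tent norm bounds every \<open>winf\<close> pointwise. For finite
  p each \<open>winf\<close> is below the inner norm in t at the same point, and the finitely many
  translates of that function have equal L^p norms.\<close>

lemma discrete_le_tent_norm:
  assumes p: "0 < p" and q: "0 < q" and r: "0 < r"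
  shows "\<exists>C<top. \<forall>(f :: real \<times> 'a::euclidean_space \<Rightarrow> complex) u k. modulus_rep f u \<longrightarrow>
     weight \<beta> k * wnorm p r u k \<le> C * tent_norm p q r \<beta> f"
proof -
  let ?N = "card (cover_net :: 'a set)"
  let ?K = "neighbour_const DIM('a) ?N r 0 \<beta>" and ?M = "Lconst p ^ ?N * (of_nat ?N * Lconst p)"
  show ?thesis
  proof (cases "p = top")
    case True
    obtain C where C: "C < top" and *: "\<And>(f :: real \<times> 'a \<Rightarrow> complex) u j y. modulus_rep f u \<Longrightarrow>
        winf r \<beta> u j y \<le> C * tent_norm \<infinity> q r \<beta> f"
      using winf_le_tent_infinity[OF q r, of \<beta>] by blast
    show ?thesis
    proof (intro exI[of _ "?K * (of_nat ?N * (2 * C))"] conjI allI impI)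
      show "?K * (of_nat ?N * (2 * C)) < top"
        using C neighbour_const_finite of_nat_less_top by (simp add: ennreal_mult_less_top)
      fix f :: "real \<times> 'a \<Rightarrow> complex" and u k assume rep: "modulus_rep f u"
      note u = modulus_rep_borel[OF rep]
      note [measurable] = wavg_measurable_x[OF u]
      let ?T = "tent_norm p q r \<beta> f"
      have pt: "weight \<beta> k * wavg r 0 u (scale k) x \<le> ?K * (of_nat ?N * (2 * C)) * ?T" for x
      proof -
        have "weight \<beta> k * wavg r 0 u (scale k) x \<le> ?K * (\<Sum>e\<in>(cover_net :: 'a set). C * ?T + C * ?T)"
          using *[OF rep] True
          by (intro order_trans[OF scale_le_wavg[OF r u]] mult_left_mono sum_mono add_mono) auto
        then show ?thesis by (simp add: mult_2 algebra_simps)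
      qed
      have "weight \<beta> k * wnorm p r u k = Lnorm lborel p (\<lambda>x. weight \<beta> k * wavg r 0 u (scale k) x)"
        unfolding wnorm_def using p by (intro Lnorm_cmult[symmetric]) auto
      also have "\<dots> \<le> ?K * (of_nat ?N * (2 * C)) * ?T"
        unfolding True Lnorm_top using pt unfolding True by (intro esssup_I) auto
      finally show "weight \<beta> k * wnorm p r u k \<le> ?K * (of_nat ?N * (2 * C)) * ?T" .
    qed
  next
    case False
    let ?c = "ennreal (1 / \<bar>1/8\<bar> powr (1 / enn2real q))"
    show ?thesis
    proof (intro exI[of _ "?K * (?M * (2 * ?c))"] conjI allI impI)
      show "?K * (?M * (2 * ?c)) < top"
        using net_const_finite[of p ?N] neighbour_const_finite by (simp add: ennreal_mult_less_top)
      fix f :: "real \<times> 'a \<Rightarrow> complex" and u k assume rep: "modulus_rep f u"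
      note u = modulus_rep_borel[OF rep]
      define S where "S = (\<lambda>x. Lnorm dtt q (\<lambda>t. wavg r \<beta> u t x))"
      have [measurable]: "S \<in> borel_measurable borel"
        unfolding S_def by (rule Lnorm_dtt_wavg_measurable[OF u])
      note [measurable] = wavg_measurable_x[OF u]
      have T: "tent_norm p q r \<beta> f = Lnorm lborel p S"
        using tent_norm_wavg[OF p r rep, of q \<beta>] False by (simp add: S_def less_top)
      have "weight \<beta> k * wnorm p r u k = Lnorm lborel p (\<lambda>x. weight \<beta> k * wavg r 0 u (scale k) x)"
        unfolding wnorm_def using p by (intro Lnorm_cmult[symmetric]) auto
      also have "\<dots> \<le> Lnorm lborel p (\<lambda>x. ?K * (\<Sum>e\<in>cover_net. ?c * S (x + scale k *\<^sub>R e) + ?c * S (x + scale k *\<^sub>R e)))"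
        unfolding S_def using p
        by (intro Lnorm_mono order_trans[OF scale_le_wavg[OF r u]] mult_left_mono sum_mono add_mono winf_le_Lnorm_dtt q) auto
      also have "\<dots> \<le> ?K * Lnorm lborel p (\<lambda>x. \<Sum>e\<in>cover_net. ?c * S (x + scale k *\<^sub>R e) + ?c * S (x + scale k *\<^sub>R e))"
        using p by (intro Lnorm_cmult_le) auto
      also have "\<dots> \<le> ?K * (?M * (Lnorm lborel p (\<lambda>x. ?c * S x) + Lnorm lborel p (\<lambda>x. ?c * S x)))"
        using p Lnorm_net_sum_le[of p "\<lambda>x. ?c * S x" "\<lambda>x. ?c * S x" "scale k"] by (intro mult_left_mono) auto
      also have "\<dots> \<le> ?K * (?M * (?c * Lnorm lborel p S + ?c * Lnorm lborel p S))"
        using p by (intro mult_left_mono add_mono Lnorm_cmult_le) auto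
      also have "\<dots> = ?K * (?M * (2 * ?c)) * tent_norm p q r \<beta> f"
        by (simp only: T mult_2 distrib_left distrib_right mult.assoc)
      finally show "weight \<beta> k * wnorm p r u k \<le> ?K * (?M * (2 * ?c)) * tent_norm p q r \<beta> f" .
    qed
  qed
qed

section \<open>Exponential decay of the discrete averages bounds the tent norm\<close>

lemma winf_le_esssup:
  fixes u :: "real \<times> 'a::euclidean_space \<Rightarrow> ennreal"
  shows "winf r \<beta> u j y \<le> esssup lborel (wavg r \<beta> u (scale j))"
proof (rule ccontr)
  assume *: "\<not> winf r \<beta> u j y \<le> esssup lborel (wavg r \<beta> u (scale j))"
  \<comment> \<open>Every centre in the ball competes in the infimum, so exceeding the essential
    supremum would make the whole ball null.\<close>
  have "AE z in lborel. z \<notin> ball y (scale j / 8)"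
    using esssup_AE[of "wavg r \<beta> u (scale j)" lborel]
  proof eventually_elim
    case (elim z)
    then show ?case using * winf_le[OF scale_in_strip, of y z j r \<beta> u] by (auto dest: order_trans)
  qed
  then have "emeasure lborel (ball y (scale j / 8)) = 0"
    by (subst (asm) AE_iff_measurable[of "ball y (scale j / 8)"]) auto
  then show False using emeasure_ball_nonzero[of "scale j / 8" y] by simp
qed

text \<open>The bound holds at every point, not only almost everywhere: the tent norm with p = q =
  \<infinity> is a true supremum, whereas \<open>wnorm\<close> is an essential one.\<close>

lemma wavg_le_wnorm_infinity:
  assumes r: "0 < r"
  shows "\<exists>C<top. \<forall>(u :: real \<times> 'a::euclidean_space \<Rightarrow> ennreal) k x. \<forall>t\<in>strip (1/8) k. u \<in> borel_measurable borel \<longrightarrow>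
     wavg r \<beta> u t x \<le> C * (weight \<beta> (k + 1) * wnorm \<infinity> r u (k + 1) + weight \<beta> (k - 1) * wnorm \<infinity> r u (k - 1))"
proof -
  let ?N = "card (cover_net :: 'a set)"
  let ?K = "neighbour_const DIM('a) ?N r \<beta> 0" and ?E = "ennreal (exp \<bar>\<beta>\<bar>)"
  show ?thesis
  proof (intro exI[of _ "?K * (of_nat ?N * ?E)"] conjI allI impI ballI)
    show "?K * (of_nat ?N * ?E) < top"
      using neighbour_const_finite of_nat_less_top by (simp add: ennreal_mult_less_top)
    fix u :: "real \<times> 'a \<Rightarrow> ennreal" and k x t assume t: "t \<in> strip (1/8) k" and u: "u \<in> borel_measurable borel"
    let ?a = "wnorm \<infinity> r u"
    have "wavg r \<beta> u t x \<le> ?K * (weight \<beta> k * (\<Sum>e\<in>(cover_net :: 'a set). ?a (k + 1) + ?a (k - 1)))"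
    proof -
      have a: "?a j = esssup lborel (wavg r 0 u (scale j))" for j
        by (simp add: wnorm_def Lnorm_top)
      have "wavg r \<beta> u t x \<le> ?K * (weight \<beta> k * (\<Sum>e\<in>cover_net. winf r 0 u (k + 1) (x + scale k *\<^sub>R e) + winf r 0 u (k - 1) (x + scale k *\<^sub>R e)))"
        using wavg_le_winf[OF r u t, of \<beta> x 0] by (simp add: weight_def)
      also have "\<dots> \<le> ?K * (weight \<beta> k * (\<Sum>e\<in>(cover_net :: 'a set). ?a (k + 1) + ?a (k - 1)))"
        unfolding a by (intro mult_left_mono sum_mono add_mono winf_le_esssup) auto
      finally show ?thesis .
    qed
    also have "\<dots> = ?K * (of_nat ?N * (weight \<beta> k * ?a (k + 1) + weight \<beta> k * ?a (k - 1)))"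
      by (simp add: algebra_simps)
    also have "\<dots> \<le> ?K * (of_nat ?N * (?E * weight \<beta> (k + 1) * ?a (k + 1) + ?E * weight \<beta> (k - 1) * ?a (k - 1)))"
      by (intro mult_left_mono add_mono mult_right_mono weight_neighbour) auto
    also have "\<dots> = ?K * (of_nat ?N * ?E) * (weight \<beta> (k + 1) * ?a (k + 1) + weight \<beta> (k - 1) * ?a (k - 1))"
      by (simp add: algebra_simps)
    finally show "wavg r \<beta> u t x \<le> ?K * (of_nat ?N * ?E) * (weight \<beta> (k + 1) * ?a (k + 1) + weight \<beta> (k - 1) * ?a (k - 1))" .
  qed
qed

lemma decay_neighbours:
  assumes "\<And>k. b k \<le> A * decay \<epsilon> (k - n)" "0 \<le> \<epsilon>"
  shows "b (k + 1) + b (k - 1) \<le> ennreal (2 * exp \<epsilon>) * (A * decay \<epsilon> (k - n))"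
proof -
  have "b j \<le> ennreal (exp \<epsilon>) * (A * decay \<epsilon> (k - n))" if "\<bar>j - k\<bar> \<le> 1" for j
  proof -
    have "b j \<le> A * (ennreal (exp \<epsilon>) * decay \<epsilon> (k - n))"
      by (rule order_trans[OF assms(1)]) (intro mult_left_mono decay_neighbour that assms(2); simp)
    then show ?thesis by (simp only: mult.left_commute)
  qed
  from add_mono[OF this this, of "k + 1" "k - 1"] show ?thesis
    by (simp add: ennreal_mult mult.assoc flip: mult_2)
qed

lemma mean_le:
  assumes "\<And>x. g x \<le> K" "0 < \<tau>"
  shows "mean lebesgue (ball (y::'a::euclidean_space) \<tau>) g \<le> K"
proof -
  have "(\<integral>\<^sup>+x\<in>ball y \<tau>. g x \<partial>lebesgue) \<le> (\<integral>\<^sup>+x. K * indicator (ball y \<tau>) x \<partial>lebesgue)"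
    using assms(1) by (intro nn_integral_mono mult_right_mono) auto
  also have "\<dots> = K * emeasure lebesgue (ball y \<tau>)"
    by (simp add: nn_integral_cmult_indicator)
  finally have "mean lebesgue (ball y \<tau>) g \<le> K * emeasure lebesgue (ball y \<tau>) / emeasure lebesgue (ball y \<tau>)"
    unfolding mean_def by (rule divide_right_mono_ennreal)
  also have "\<dots> = K"
    using assms(2) emeasure_ball_nonzero[of \<tau> y]
    by (intro ennreal_mult_divide_eq) (simp_all, simp add: emeasure_ball)
  finally show ?thesis .
qed

lemma tent_norm_infinity_decay:
  assumes q: "0 < q" and r: "0 < r" and \<epsilon>: "0 < \<epsilon>"
  shows "\<exists>C<top. \<forall>(f :: real \<times> 'a::euclidean_space \<Rightarrow> complex) u A n. modulus_rep f u \<longrightarrow>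
     (\<forall>k. weight \<beta> k * wnorm \<infinity> r u k \<le> A * decay \<epsilon> (k - n)) \<longrightarrow> tent_norm \<infinity> q r \<beta> f \<le> C * A"
proof -
  obtain C where C: "C < top" and *: "\<And>(u :: real \<times> 'a \<Rightarrow> ennreal) k t x. t \<in> strip (1/8) k \<Longrightarrow> u \<in> borel_measurable borel \<Longrightarrow>
      wavg r \<beta> u t x \<le> C * (weight \<beta> (k + 1) * wnorm \<infinity> r u (k + 1) + weight \<beta> (k - 1) * wnorm \<infinity> r u (k - 1))"
    using wavg_le_wnorm_infinity[OF r, of \<beta>] by blast
  define C1 where "C1 = C * ennreal (2 * exp \<epsilon>)"
  have C1: "C1 < top" using C by (simp add: C1_def ennreal_mult_less_top)
  have w: "wavg r \<beta> u t x \<le> C1 * A * decay \<epsilon> (k - n)"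
    if "modulus_rep f u" and b: "\<And>k. weight \<beta> k * wnorm \<infinity> r u k \<le> A * decay \<epsilon> (k - n)" and t: "t \<in> strip (1/8) k"
    for f :: "real \<times> 'a \<Rightarrow> complex" and u A n t k x
  proof -
    have "wavg r \<beta> u t x \<le> C * (ennreal (2 * exp \<epsilon>) * (A * decay \<epsilon> (k - n)))"
      using decay_neighbours[of "\<lambda>k. weight \<beta> k * wnorm \<infinity> r u k", OF b] \<epsilon>
      by (intro order_trans[OF *[OF t modulus_rep_borel[OF that(1)]]] mult_left_mono) auto
    then show ?thesis by (simp only: C1_def mult.assoc)
  qed
  show ?thesis
  proof (cases "q = top")
    case True
    show ?thesis
    proof (intro exI[of _ C1] conjI allI impI C1)
      fix f :: "real \<times> 'a \<Rightarrow> complex" and u A n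
      assume rep: "modulus_rep f u" and b: "\<forall>k. weight \<beta> k * wnorm \<infinity> r u k \<le> A * decay \<epsilon> (k - n)"
      have "wavg r \<beta> u t x \<le> C1 * A" if "0 < t" for t x
      proof -
        have "wavg r \<beta> u t x \<le> C1 * A * decay \<epsilon> (\<lceil>ln t / (1/8)\<rceil> - n)"
          using b by (intro w[OF rep _ strip_ceiling[OF that]]) auto
        also have "\<dots> \<le> C1 * A * 1"
          using \<epsilon> by (intro mult_left_mono) (auto simp: decay_def)
        finally show ?thesis by simp
      qed
      then show "tent_norm \<infinity> q r \<beta> f \<le> C1 * A"
        using tent_norm_wavg[OF _ r rep, of \<infinity> q \<beta>] True by (auto intro!: SUP_least)
    qed
  next
    case False
    define a where "a = enn2real q"
    have a: "0 < a" using enn2real_pos q False by (simp add: a_def)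
    let ?h = "ennreal (\<bar>1/8\<bar> powr (1 / enn2real q))"
    show ?thesis
    proof (intro exI[of _ "?h * (decay_const q \<epsilon> * C1)"] conjI allI impI)
      show "?h * (decay_const q \<epsilon> * C1) < top"
        using C1 decay_const_finite[OF q \<epsilon>] by (simp add: ennreal_mult_less_top)
      fix f :: "real \<times> 'a \<Rightarrow> complex" and u A n
      assume rep: "modulus_rep f u" and b: "\<forall>k. weight \<beta> k * wnorm \<infinity> r u k \<le> A * decay \<epsilon> (k - n)"
      have "epow (\<integral>\<^sup>+ t\<in>{0<..<\<tau>}. mean lebesgue (ball y \<tau>) (\<lambda>x. epow (wavg r \<beta> u t x) a) \<partial>dtt) (1 / a)
          \<le> ?h * (decay_const q \<epsilon> * C1) * A" if \<tau>: "0 < \<tau>" for \<tau> and y :: 'a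
      proof -
        \<comment> \<open>Extending the integral beyond the cutoff at \<tau> turns it into an
          L^q(dt/t) quasi-norm of \<open>F\<close>. The pointwise bound passes to the mean over any
          ball, so the estimate is uniform in \<tau> and \<open>y\<close>.\<close>
        define F where "F = (\<lambda>t. epow (mean lebesgue (ball y \<tau>) (\<lambda>x. epow (wavg r \<beta> u t x) a)) (1 / a))"
        have "epow (\<integral>\<^sup>+ t\<in>{0<..<\<tau>}. mean lebesgue (ball y \<tau>) (\<lambda>x. epow (wavg r \<beta> u t x) a) \<partial>dtt) (1 / a)
           \<le> epow (\<integral>\<^sup>+ t. epow (F t) a \<partial>dtt) (1 / a)"
          using a by (intro epow_mono nn_integral_mono) (auto simp: F_def indicator_def)
        also have "\<dots> = Lnorm dtt q F"
          by (simp add: Lnorm_finite[OF False] a_def)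
        also have "\<dots> \<le> ?h * Lnorm (count_space UNIV) q (\<lambda>k. C1 * A * decay \<epsilon> (k - n))"
        proof (rule strip_upper[OF q])
          fix k t assume t: "t \<in> strip (1/8) k"
          have "mean lebesgue (ball y \<tau>) (\<lambda>x. epow (wavg r \<beta> u t x) a) \<le> epow (C1 * A * decay \<epsilon> (k - n)) a"
            using a b \<tau> by (intro mean_le epow_mono w[OF rep _ t]) auto
          then have "F t \<le> epow (epow (C1 * A * decay \<epsilon> (k - n)) a) (1 / a)"
            unfolding F_def using a by (intro epow_mono) auto
          then show "F t \<le> C1 * A * decay \<epsilon> (k - n)" using a by simp
        qed (use False in auto)
        also have "\<dots> \<le> ?h * (decay_const q \<epsilon> * (C1 * A))"
          using \<epsilon> by (intro mult_left_mono Lnorm_decay_le[OF q]) auto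
        finally show ?thesis by (simp only: mult.assoc)
      qed
      then show "tent_norm \<infinity> q r \<beta> f \<le> ?h * (decay_const q \<epsilon> * C1) * A"
        using tent_norm_wavg[OF _ r rep, of \<infinity> q \<beta>] False by (auto intro!: SUP_least simp: a_def less_top)
    qed
  qed
qed

lemma tent_norm_finite_decay:
  assumes p: "0 < p" "p \<noteq> top" and q: "0 < q" and r: "0 < r" and \<epsilon>: "0 < \<epsilon>"
  shows "\<exists>C<top. \<forall>(f :: real \<times> 'a::euclidean_space \<Rightarrow> complex) u A n. modulus_rep f u \<longrightarrow>
     (\<forall>k. weight \<beta> k * wnorm p r u k \<le> A * decay \<epsilon> (k - n)) \<longrightarrow> tent_norm p q r \<beta> f \<le> C * A"
proof -
  obtain C where C: "C < top" and *: "\<And>(u :: real \<times> 'a \<Rightarrow> ennreal) k. u \<in> borel_measurable borel \<Longrightarrow>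
     Lnorm lborel p (\<lambda>x. weight \<beta> k * (\<Sum>e\<in>cover_net. wavg r 0 u (scale (k + 1)) (x + scale k *\<^sub>R e)
        + wavg r 0 u (scale (k - 1)) (x + scale k *\<^sub>R e)))
       \<le> C * (weight \<beta> (k + 1) * wnorm p r u (k + 1) + weight \<beta> (k - 1) * wnorm p r u (k - 1))"
    using Lnorm_wavg_le[OF p(1) r, of \<beta>] scale_in_strip by blast
  let ?K = "neighbour_const DIM('a) (card (cover_net :: 'a set)) r \<beta> 0"
  let ?h = "ennreal (\<bar>1/8\<bar> powr (1 / enn2real q))"
  define C1 where "C1 = C * ennreal (2 * exp \<epsilon>)"
  define C2 where "C2 = ?h * (decay_const q (\<epsilon>/2) * ?K)"
  have C1: "C1 < top" using C by (simp add: C1_def ennreal_mult_less_top)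
  have C2: "C2 < top" using decay_const_finite[OF q, of "\<epsilon>/2"] \<epsilon> neighbour_const_finite
    by (simp add: C2_def ennreal_mult_less_top)
  show ?thesis
  proof (intro exI[of _ "C2 * (decay_const p (\<epsilon>/2) * C1)"] conjI allI impI)
    show "C2 * (decay_const p (\<epsilon>/2) * C1) < top"
      using C1 C2 decay_const_finite[OF p(1), of "\<epsilon>/2"] \<epsilon> by (simp add: ennreal_mult_less_top)
    fix f :: "real \<times> 'a \<Rightarrow> complex" and u A n
    assume rep: "modulus_rep f u" and b: "\<forall>k. weight \<beta> k * wnorm p r u k \<le> A * decay \<epsilon> (k - n)"
    note u = modulus_rep_borel[OF rep]
    note [measurable] = wavg_measurable_x[OF u]
    define H where "H = (\<lambda>k x. weight \<beta> k * (\<Sum>e\<in>cover_net. wavg r 0 u (scale (k + 1)) (x + scale k *\<^sub>R e)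
        + wavg r 0 u (scale (k - 1)) (x + scale k *\<^sub>R e)))"
    have H [measurable]: "H k \<in> borel_measurable borel" for k unfolding H_def by measurable
    \<comment> \<open>The decay rate is halved: one half pays for the inner l^q sum over scales at
      fixed \<open>x\<close>, the other for the supremum over \<open>k\<close> under the L^p
      norm.\<close>
    define G where "G = (\<lambda>k x. decay (-(\<epsilon>/2)) (k - n) * H k x)"
    have G [measurable]: "G k \<in> borel_measurable borel" for k unfolding G_def by measurable
    define S where "S = (\<lambda>x. Lnorm dtt q (\<lambda>t. wavg r \<beta> u t x))"
    have [measurable]: "S \<in> borel_measurable borel"
      unfolding S_def by (rule Lnorm_dtt_wavg_measurable[OF u])
    have "Lnorm lborel p (H k) \<le> C1 * A * decay \<epsilon> (k - n)" for k
    proof -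
      have "Lnorm lborel p (H k) \<le> C * (ennreal (2 * exp \<epsilon>) * (A * decay \<epsilon> (k - n)))"
        unfolding H_def using decay_neighbours[of "\<lambda>k. weight \<beta> k * wnorm p r u k", of A \<epsilon> n] b \<epsilon>
        by (intro order_trans[OF *[OF u]] mult_left_mono) auto
      then show ?thesis by (simp only: C1_def mult.assoc)
    qed
    then have LG: "Lnorm lborel p (G k) \<le> C1 * A * decay (\<epsilon>/2) (k - n)" for k
    proof -
      have "Lnorm lborel p (G k) \<le> decay (-(\<epsilon>/2)) (k - n) * Lnorm lborel p (H k)"
        unfolding G_def using p by (intro Lnorm_cmult_le) auto
      also have "\<dots> \<le> decay (-(\<epsilon>/2)) (k - n) * (C1 * A * decay \<epsilon> (k - n))"
        by (intro mult_left_mono \<open>\<And>k. Lnorm lborel p (H k) \<le> C1 * A * decay \<epsilon> (k - n)\<close>) auto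
      also have "\<dots> = C1 * A * (decay (-(\<epsilon>/2)) (k - n) * decay \<epsilon> (k - n))"
        by (rule mult.left_commute)
      finally show ?thesis by (simp add: decay_add)
    qed
    have S: "S x \<le> C2 * (SUP k. G k x)" for x
    proof -
      have "S x \<le> ?h * Lnorm (count_space UNIV) q (\<lambda>k. ?K * H k x)"
        unfolding S_def H_def
      proof (rule strip_upper[OF q])
        show "(\<lambda>t. wavg r \<beta> u t x) \<in> borel_measurable dtt"
          using measurable_Pair2[OF wavg_measurable[OF u], of x] by (simp add: measurable_dtt)
      qed (use wavg_le_scale[OF r u] in auto)
      also have "\<dots> \<le> ?h * (decay_const q (\<epsilon>/2) * (?K * (SUP k. G k x)))"
      proof (intro mult_left_mono Lnorm_decay_le[OF q])
        fix k
        have "H k x = decay (\<epsilon>/2) (k - n) * G k x"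
          by (simp add: G_def mult.assoc[symmetric] decay_add)
        also have "\<dots> \<le> decay (\<epsilon>/2) (k - n) * (SUP k. G k x)"
          by (intro mult_left_mono SUP_upper) auto
        finally have "?K * H k x \<le> ?K * (decay (\<epsilon>/2) (k - n) * (SUP k. G k x))"
          by (rule mult_left_mono) simp
        then show "?K * H k x \<le> ?K * (SUP k. G k x) * decay (\<epsilon>/2) (k - n)"
          by (simp only: mult_ac)
      qed (use \<epsilon> in auto)
      finally show ?thesis by (simp only: C2_def mult.assoc)
    qed
    have "tent_norm p q r \<beta> f = Lnorm lborel p S"
      using tent_norm_wavg[OF p(1) r rep, of q \<beta>] p(2) by (simp add: S_def less_top)
    also have "\<dots> \<le> Lnorm lborel p (\<lambda>x. C2 * (SUP k. G k x))"
      using p S by (intro Lnorm_mono) auto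
    also have "\<dots> \<le> C2 * Lnorm lborel p (\<lambda>x. SUP k. G k x)"
      using p by (intro Lnorm_cmult_le) auto
    also have "\<dots> \<le> C2 * (decay_const p (\<epsilon>/2) * (C1 * A))"
      using p \<epsilon> LG by (intro mult_left_mono Lnorm_SUP_decay_le) auto
    finally show "tent_norm p q r \<beta> f \<le> C2 * (decay_const p (\<epsilon>/2) * C1) * A"
      by (simp only: mult.assoc)
  qed
qed

lemma tent_norm_decay:
  assumes "0 < p" "0 < q" "0 < r" "0 < \<epsilon>"
  shows "\<exists>C<top. \<forall>(f :: real \<times> 'a::euclidean_space \<Rightarrow> complex) u A n. modulus_rep f u \<longrightarrow>
     (\<forall>k. weight \<beta> k * wnorm p r u k \<le> A * decay \<epsilon> (k - n)) \<longrightarrow> tent_norm p q r \<beta> f \<le> C * A"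
  using tent_norm_infinity_decay[OF assms(2-4), of \<beta>] tent_norm_finite_decay[OF assms(1) _ assms(2-4), of \<beta>]
  by (cases "p = top") auto

subsection \<open>The K-functional\<close>

text \<open>Every decomposition competes at both parameters, and the factor \<open>l\<close>, being
  at least 1, covers both terms of the sum.\<close>

lemma K_functional_le:
  assumes "0 \<le> t" "1 \<le> l" "s \<le> l * t"
  shows "K_functional M s f X0 X1 \<le> ennreal l * K_functional M t f X0 X1"
  unfolding K_functional_def[of M t]
proof (rule le_mult_INF_ennreal)
  fix w assume w: "w \<in> decomps M X0 X1 f"
  obtain f0 f1 where [simp]: "w = (f0, f1)" by (cases w)
  have "K_functional M s f X0 X1 \<le> qnorm X0 f0 + ennreal s * qnorm X1 f1"
    unfolding K_functional_def using w by (intro INF_lower2[of w]) auto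
  also have "\<dots> \<le> ennreal l * qnorm X0 f0 + ennreal (l * t) * qnorm X1 f1"
  proof (intro add_mono mult_right_mono ennreal_leI assms(3))
    show "qnorm X0 f0 \<le> ennreal l * qnorm X0 f0"
      using mult_right_mono[of 1 "ennreal l" "qnorm X0 f0"] assms(2) by simp
  qed simp
  also have "\<dots> = ennreal l * (qnorm X0 f0 + ennreal t * qnorm X1 f1)"
    using assms by (simp add: ennreal_mult distrib_left mult.assoc)
  finally show "K_functional M s f X0 X1
      \<le> ennreal l * (case w of (f0, f1) \<Rightarrow> qnorm X0 f0 + ennreal t * qnorm X1 f1)"
    by simp
qed (use assms in simp)

definition K_weighted where
  "K_weighted M X0 X1 \<theta> f t = ennreal (t powr - \<theta>) * K_functional M t f X0 X1"

text \<open>One factor \<open>exp c\<close> comes from the K-functional and one from the power,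
  whose exponent has modulus below 1.\<close>

lemma K_weighted_compare:
  assumes "0 < \<theta>" "\<theta> < 1" "0 < s" "0 < t" "\<bar>ln s - ln t\<bar> \<le> c"
  shows "K_weighted M X0 X1 \<theta> f s \<le> ennreal (exp (2 * c)) * K_weighted M X0 X1 \<theta> f t"
proof -
  have c: "0 \<le> c" using assms(5) by linarith
  have "s = exp (ln s)" using assms(3) by simp
  also have "\<dots> \<le> exp (c + ln t)" using assms(5) by (subst exp_le_cancel_iff) linarith
  also have "\<dots> = exp c * t" using assms(4) by (simp add: exp_add)
  finally have K: "K_functional M s f X0 X1 \<le> ennreal (exp c) * K_functional M t f X0 X1"
    using c assms(4) by (intro K_functional_le) auto
  have "- \<theta> * (ln s - ln t) \<le> \<bar>\<theta>\<bar> * \<bar>ln s - ln t\<bar>"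
    by (metis abs_ge_self abs_minus_cancel abs_mult)
  also have "\<dots> \<le> 1 * c" using assms by (intro mult_mono) auto
  finally have "- \<theta> * ln s \<le> c + - \<theta> * ln t" by (simp add: algebra_simps)
  then have "exp (- \<theta> * ln s) \<le> exp c * exp (- \<theta> * ln t)"
    by (simp only: exp_le_cancel_iff flip: exp_add)
  then have "s powr - \<theta> \<le> exp c * t powr - \<theta>"
    using assms by (simp add: powr_def)
  then have "ennreal (s powr - \<theta>) \<le> ennreal (exp c) * ennreal (t powr - \<theta>)"
    by (simp flip: ennreal_mult)
  from mult_mono[OF this K] have
    "K_weighted M X0 X1 \<theta> f s \<le> (ennreal (exp c) * ennreal (t powr - \<theta>)) * (ennreal (exp c) * K_functional M t f X0 X1)"
    by (simp add: K_weighted_def)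
  also have "\<dots> = (ennreal (exp c) * ennreal (exp c)) * K_weighted M X0 X1 \<theta> f t"
    by (simp only: K_weighted_def mult_ac)
  also have "ennreal (exp c) * ennreal (exp c) = ennreal (exp (2 * c))"
    by (simp flip: ennreal_mult exp_add)
  finally show ?thesis .
qed

lemma strip_ln_compare:
  assumes "h \<noteq> 0" "t \<in> strip h k"
  shows "\<bar>ln t - h * of_int k\<bar> \<le> \<bar>h\<bar>"
proof -
  have "\<bar>ln t / h - of_int k\<bar> \<le> 1" using assms(2) by (auto simp: strip_iff)
  then have "\<bar>h\<bar> * \<bar>ln t / h - of_int k\<bar> \<le> \<bar>h\<bar> * 1" by (rule mult_left_mono) simp
  then show ?thesis using assms(1) by (simp add: abs_mult[symmetric] right_diff_distrib)
qed

section \<open>Discretization of the interpolation norm\<close>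

lemma interp_norm_finite_eq:
  assumes "q \<noteq> top"
  shows "interp_norm M X0 X1 \<theta> q f = Lnorm dtt q (K_weighted M X0 X1 \<theta> f)"
  using assms
  by (simp add: interp_norm_def Lnorm_finite K_weighted_def[abs_def] epow_mult epow_ennreal powr_powr)

lemma interp_norm_top_eq:
  "interp_norm M X0 X1 \<theta> top f = (SUP t\<in>{0<..}. K_weighted M X0 X1 \<theta> f t)"
  by (simp add: interp_norm_def K_weighted_def)

text \<open>On a strip the weighted K-functional varies by at most the factor
  \<open>exp (2 * \<bar>h\<bar>)\<close>, so it lies between multiples of a step function. Its
  measurability in t is avoided: finite q involves lower integrals, and q = \<infinity> a true
  supremum.\<close>

lemma interp_norm_discrete:
  assumes \<theta>: "0 < \<theta>" "\<theta> < 1" and h: "h \<noteq> 0" and q: "0 < q"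
  shows "\<exists>C<top. \<forall>f :: 'c \<Rightarrow> 'b::plus. interp_norm M X0 X1 \<theta> q f
      \<le> C * Lnorm (count_space UNIV) q (\<lambda>n. K_weighted M X0 X1 \<theta> f (exp (h * of_int n)))
    \<and> Lnorm (count_space UNIV) q (\<lambda>n. K_weighted M X0 X1 \<theta> f (exp (h * of_int n)))
      \<le> C * interp_norm M X0 X1 \<theta> q f"
proof -
  let ?w = "\<bar>h\<bar> powr (1 / enn2real q)"
  let ?L = "exp (2 * \<bar>h\<bar>)"
  let ?C = "ennreal ((?w + 1 / ?w + 1) * ?L)"
  have w: "0 < ?w" using h by simp
  have L: "1 \<le> ?L" by simp
  have C: "ennreal (?w * ?L) \<le> ?C" "ennreal (1 / ?w * ?L) \<le> ?C" "1 \<le> ?C" "ennreal ?L \<le> ?C"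
  proof -
    show "ennreal (?w * ?L) \<le> ?C" "ennreal (1 / ?w * ?L) \<le> ?C" "ennreal ?L \<le> ?C"
      using w by (auto intro!: ennreal_leI simp: distrib_right)
    then show "1 \<le> ?C" using L by (metis ennreal_1 ennreal_leI order_trans)
  qed
  show ?thesis
  proof (intro exI[of _ ?C] conjI allI)
    fix f :: "'c \<Rightarrow> 'b"
    let ?F = "K_weighted M X0 X1 \<theta> f"
    let ?E = "\<lambda>n. ?F (exp (h * of_int n))"
    let ?cs = "Lnorm (count_space (UNIV::int set)) q"
    have up: "?F t \<le> ennreal ?L * ?E k" if "t \<in> strip h k" for t k
      using strip_ln_compare[OF h that] strip_pos[OF that] \<theta> by (intro K_weighted_compare) auto
    have low: "?E k \<le> ennreal ?L * ?F t" if "t \<in> strip h k" for t k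
      using strip_ln_compare[OF h that] strip_pos[OF that] \<theta> by (intro K_weighted_compare) (auto simp: abs_minus_commute)
    show "interp_norm M X0 X1 \<theta> q f \<le> ?C * ?cs ?E"
    proof (cases "q = top")
      case True
      have "?F t \<le> ennreal ?L * (SUP k. ?E k)" if "0 < t" for t
        by (rule order_trans[OF up[OF strip_ceiling[OF that]]]) (intro mult_left_mono SUP_upper; simp)
      then have "interp_norm M X0 X1 \<theta> q f \<le> ennreal ?L * ?cs ?E"
        by (auto simp: True interp_norm_top_eq Lnorm_count_space_top intro!: SUP_least)
      also have "\<dots> \<le> ?C * ?cs ?E" by (intro mult_right_mono C) simp
      finally show ?thesis .
    next
      case False
      have "interp_norm M X0 X1 \<theta> q f \<le> ennreal ?w * ?cs (\<lambda>k. ennreal ?L * ?E k)"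
        unfolding interp_norm_finite_eq[OF False] using False up by (intro strip_upper q h) auto
      also have "\<dots> \<le> ennreal ?w * (ennreal ?L * ?cs ?E)"
        using q by (intro mult_left_mono Lnorm_cmult_le) auto
      also have "\<dots> = ennreal (?w * ?L) * ?cs ?E"
        using w by (simp add: ennreal_mult mult.assoc)
      also have "\<dots> \<le> ?C * ?cs ?E" by (intro mult_right_mono C) simp
      finally show ?thesis .
    qed
    show "?cs ?E \<le> ?C * interp_norm M X0 X1 \<theta> q f"
    proof (cases "q = top")
      case True
      have "?cs ?E \<le> 1 * interp_norm M X0 X1 \<theta> q f"
        by (auto simp: True interp_norm_top_eq Lnorm_count_space_top intro!: SUP_least SUP_upper)
      also have "\<dots> \<le> ?C * interp_norm M X0 X1 \<theta> q f" by (intro mult_right_mono C) simp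
      finally show ?thesis .
    next
      case False
      have inv: "ennreal ?L * (ennreal (1 / ?L) * y) = y" "ennreal (1 / ?L) * (ennreal ?L * y) = y" for y
        by (simp_all add: mult.assoc[symmetric] ennreal_mult[symmetric] exp_minus inverse_eq_divide)
      have winv: "ennreal (1 / ?w) * (ennreal ?w * y) = y" for y
        using w by (simp add: mult.assoc[symmetric] ennreal_mult[symmetric])
      have "ennreal (1 / ?L) * ?E k \<le> ?F t" if "t \<in> strip h k" for t k
        using mult_left_mono[OF low[OF that], of "ennreal (1 / ?L)"] by (simp only: inv zero_le simp_thms)
      then have *: "ennreal ?w * ?cs (\<lambda>k. ennreal (1 / ?L) * ?E k) \<le> interp_norm M X0 X1 \<theta> q f"
        unfolding interp_norm_finite_eq[OF False] by (intro strip_lower q h) auto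
      have "?cs ?E = ?cs (\<lambda>k. ennreal ?L * (ennreal (1 / ?L) * ?E k))"
        by (simp only: inv)
      also have "\<dots> \<le> ennreal ?L * ?cs (\<lambda>k. ennreal (1 / ?L) * ?E k)"
        using q by (intro Lnorm_cmult_le) auto
      also have "\<dots> = ennreal ?L * (ennreal (1 / ?w) * (ennreal ?w * ?cs (\<lambda>k. ennreal (1 / ?L) * ?E k)))"
        by (simp only: winv)
      also have "\<dots> \<le> ennreal ?L * (ennreal (1 / ?w) * interp_norm M X0 X1 \<theta> q f)"
        by (intro mult_left_mono *) auto
      also have "\<dots> = (ennreal (1 / ?w) * ennreal ?L) * interp_norm M X0 X1 \<theta> q f"
        by (simp only: mult_ac)
      also have "ennreal (1 / ?w) * ennreal ?L = ennreal (1 / ?w * ?L)"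
        using w by (intro ennreal_mult[symmetric]) auto
      also have "\<dots> * interp_norm M X0 X1 \<theta> q f \<le> ?C * interp_norm M X0 X1 \<theta> q f"
        by (intro mult_right_mono C) simp
      finally show ?thesis .
    qed
  qed simp
qed

subsection \<open>Discrete Whitney averages and the K-functional\<close>

lemma AE_half_space:
  assumes "AE z in lebesgue_on half_space. P z"
  shows "AE z in lborel. 0 < fst (z :: real \<times> 'a::euclidean_space) \<longrightarrow> P z"
proof -
  have "AE z in lebesgue. z \<in> half_space \<longrightarrow> P z"
    using assms by (subst (asm) AE_restrict_space_iff) auto
  then show ?thesis by (simp add: AE_completion_iff half_space_eq)
qed

lemma wnorm_add_le:
  fixes f f0 f1 :: "real \<times> 'a::euclidean_space \<Rightarrow> complex"
  assumes p: "0 < p" and r: "0 < r" and rep: "modulus_rep f u" "modulus_rep f0 u0" "modulus_rep f1 u1"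
    and sum: "AE z in lebesgue_on half_space. f z = f0 z + f1 z"
  shows "wnorm p r u k \<le> Lconst r * Lconst p * (wnorm p r u0 k + wnorm p r u1 k)"
proof -
  note u [measurable] = rep[THEN modulus_rep_borel]
  note [measurable] = u[THEN wavg_measurable_x]
  have AEu: "AE z in lborel. 0 < fst z \<longrightarrow> u z = ennreal (norm (f z))"
    "AE z in lborel. 0 < fst z \<longrightarrow> u0 z = ennreal (norm (f0 z))"
    "AE z in lborel. 0 < fst z \<longrightarrow> u1 z = ennreal (norm (f1 z))"
    using rep by (simp_all add: modulus_rep_def)
  have "AE z in lborel. 0 < fst z \<longrightarrow> u z \<le> u0 z + u1 z"
    using AEu AE_half_space[OF sum]
    by eventually_elim (auto simp: norm_triangle_ineq simp flip: ennreal_plus)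
  then have *: "AE z in lborel. z \<in> wbox (scale k) x \<longrightarrow> u z \<le> u0 z + u1 z" for x
  proof eventually_elim
    case (elim z)
    then show ?case using scale_pos[of k] by (auto simp: mem_wbox simp del: scale_pos)
  qed
  let ?D = "\<lambda>u. wavg r 0 u (scale k)"
  have "?D u x \<le> Lconst r * (?D u0 x + ?D u1 x)" for x
    using r * by (intro order_trans[OF wavg_mono_AE wavg_add_le]) auto
  then have "wnorm p r u k \<le> Lnorm lborel p (\<lambda>x. Lconst r * (?D u0 x + ?D u1 x))"
    unfolding wnorm_def using p by (intro Lnorm_mono) auto
  also have "\<dots> \<le> Lconst r * Lnorm lborel p (\<lambda>x. ?D u0 x + ?D u1 x)"
    using p by (intro Lnorm_cmult_le) auto
  also have "\<dots> \<le> Lconst r * (Lconst p * (wnorm p r u0 k + wnorm p r u1 k))"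
    unfolding wnorm_def using p by (intro mult_left_mono Lnorm_add_le) auto
  finally show ?thesis by (simp only: mult.assoc)
qed

lemma weight_add: "weight a k * weight b k = weight (a + b) k"
  by (simp add: weight_exp mult_exp_exp algebra_simps add_divide_distrib diff_divide_distrib flip: ennreal_mult)

lemma ennreal_finite_posE:
  assumes "C < (top::ennreal)"
  obtains c where "0 < c" "C \<le> ennreal c"
proof
  show "0 < enn2real C + 1" by (simp add: add_nonneg_pos)
  show "C \<le> ennreal (enn2real C + 1)" using assms by (cases C) (auto intro: ennreal_leI)
qed

text \<open>At the parameter t = T_k^(\<beta>1-\<beta>0), with T_k = \<open>scale k\<close>, the
  factors t^(-\<theta>) and t^(1-\<theta>) turn the weights for \<beta>0 and \<beta>1 into the one
  for \<beta>. Each decomposition then bounds the average of \<open>f\<close> through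
  \<open>wnorm_add_le\<close>.\<close>

lemma discrete_le_K_functional:
  assumes p: "0 < p" and q0: "0 < q0" and q1: "0 < q1" and r: "0 < r"
    and \<beta>: "\<beta> = (1 - \<theta>) * \<beta>0 + \<theta> * \<beta>1"
  shows "\<exists>C<top. \<forall>(f :: real \<times> 'a::euclidean_space \<Rightarrow> complex) u k. modulus_rep f u \<longrightarrow>
    weight \<beta> k * wnorm p r u k \<le> C * K_weighted (lebesgue_on half_space)
       (tent_space p q0 r \<beta>0) (tent_space p q1 r \<beta>1) \<theta> f (exp ((\<beta>1 - \<beta>0) / 8 * of_int k))"
proof -
  obtain C0 where C0: "C0 < top" and *: "\<And>(f :: real \<times> 'a \<Rightarrow> complex) u k. modulus_rep f u \<Longrightarrow>
     weight \<beta>0 k * wnorm p r u k \<le> C0 * tent_norm p q0 r \<beta>0 f"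
    using discrete_le_tent_norm[OF p q0 r, of \<beta>0] by blast
  obtain C1 where C1: "C1 < top" and **: "\<And>(f :: real \<times> 'a \<Rightarrow> complex) u k. modulus_rep f u \<Longrightarrow>
     weight \<beta>1 k * wnorm p r u k \<le> C1 * tent_norm p q1 r \<beta>1 f"
    using discrete_le_tent_norm[OF p q1 r, of \<beta>1] by blast
  define D where "D = C0 + C1"
  have "Lconst r * Lconst p * D < top"
    using C0 C1 Lconst_bounds(2) by (simp add: D_def ennreal_mult_less_top)
  then obtain c where c: "0 < c" "Lconst r * Lconst p * D \<le> ennreal c"
    by (rule ennreal_finite_posE)
  define \<Gamma> where "\<Gamma> = \<beta>1 - \<beta>0"
  let ?M = "lebesgue_on half_space :: (real \<times> 'a) measure"
  let ?X0 = "tent_space p q0 r \<beta>0" and ?X1 = "tent_space p q1 r \<beta>1"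
  have \<beta>': "\<theta> * \<Gamma> + \<beta>0 = \<beta>" "\<theta> * \<Gamma> - \<Gamma> + \<beta>1 = \<beta>" unfolding \<beta> \<Gamma>_def by (simp_all add: algebra_simps)
  show ?thesis
  proof (intro exI[of _ "ennreal c"] conjI allI impI)
    fix f :: "real \<times> 'a \<Rightarrow> complex" and u k assume rep: "modulus_rep f u"
    let ?t = "exp (\<Gamma> / 8 * of_int k)"
    have t: "ennreal (?t powr - \<theta>) = weight (\<theta> * \<Gamma>) k"
      by (simp add: weight_exp powr_def algebra_simps)
    have t1: "ennreal ?t = weight (- \<Gamma>) k"
      by (simp add: weight_exp algebra_simps)
    have "weight \<beta> k * wnorm p r u k \<le> ennreal (c * (?t powr - \<theta>)) * K_functional ?M ?t f ?X0 ?X1"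
      unfolding K_functional_def
    proof (rule le_mult_INF_ennreal)
      fix w assume w: "w \<in> decomps ?M ?X0 ?X1 f"
      obtain f0 f1 where [simp]: "w = (f0, f1)" by (cases w)
      have mem: "f0 \<in> borel_measurable ?M" "f1 \<in> borel_measurable ?M" and sum: "AE z in ?M. f z = f0 z + f1 z"
        using w by (auto simp: decomps_def tent_space_def)
      obtain u0 u1 where rep01: "modulus_rep f0 u0" "modulus_rep f1 u1"
        using modulus_rep_exists mem by metis
      let ?n0 = "tent_norm p q0 r \<beta>0 f0" and ?n1 = "tent_norm p q1 r \<beta>1 f1"
      have w0: "weight \<beta> k * wnorm p r u0 k \<le> weight (\<theta> * \<Gamma>) k * (C0 * ?n0)"
        using mult_left_mono[OF *[OF rep01(1)], of "weight (\<theta> * \<Gamma>) k" k]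
        by (simp add: weight_add \<beta>'(1) mult.assoc[symmetric])
      have w1: "weight \<beta> k * wnorm p r u1 k \<le> weight (\<theta> * \<Gamma>) k * (weight (- \<Gamma>) k * (C1 * ?n1))"
        using mult_left_mono[OF **[OF rep01(2)], of "weight (\<theta> * \<Gamma> - \<Gamma>) k" k]
        by (simp add: weight_add \<beta>'(2) mult.assoc[symmetric])
      have "weight \<beta> k * wnorm p r u k \<le> weight \<beta> k * (Lconst r * Lconst p * (wnorm p r u0 k + wnorm p r u1 k))"
        by (intro mult_left_mono wnorm_add_le[OF p r rep rep01 sum]) simp
      also have "\<dots> = Lconst r * Lconst p * (weight \<beta> k * wnorm p r u0 k + weight \<beta> k * wnorm p r u1 k)"
        by (simp only: distrib_left mult_ac)
      also have "\<dots> \<le> Lconst r * Lconst p * (weight (\<theta> * \<Gamma>) k * (C0 * ?n0) + weight (\<theta> * \<Gamma>) k * (weight (- \<Gamma>) k * (C1 * ?n1)))"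
        by (intro mult_left_mono add_mono w0 w1) simp
      also have "\<dots> \<le> Lconst r * Lconst p * (weight (\<theta> * \<Gamma>) k * (D * ?n0) + weight (\<theta> * \<Gamma>) k * (weight (- \<Gamma>) k * (D * ?n1)))"
        by (intro mult_left_mono add_mono mult_right_mono) (auto simp: D_def)
      also have "\<dots> = (Lconst r * Lconst p * D) * (weight (\<theta> * \<Gamma>) k * (?n0 + weight (- \<Gamma>) k * ?n1))"
        by (simp only: distrib_left mult_ac)
      also have "\<dots> \<le> ennreal c * (weight (\<theta> * \<Gamma>) k * (?n0 + weight (- \<Gamma>) k * ?n1))"
        by (intro mult_right_mono c) simp
      also have "\<dots> = ennreal (c * (?t powr - \<theta>)) * (?n0 + ennreal ?t * ?n1)"
        using c(1) by (simp only: t[symmetric] t1 ennreal_mult less_imp_le powr_ge_zero mult.assoc)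
      finally show "weight \<beta> k * wnorm p r u k \<le> ennreal (c * (?t powr - \<theta>)) *
          (case w of (f0, f1) \<Rightarrow> qnorm ?X0 f0 + ennreal ?t * qnorm ?X1 f1)"
        by (simp add: tent_space_def)
    qed (use c in simp)
    then show "weight \<beta> k * wnorm p r u k \<le> ennreal c * K_weighted ?M ?X0 ?X1 \<theta> f (exp ((\<beta>1 - \<beta>0) / 8 * of_int k))"
      using c(1) by (simp add: K_weighted_def ennreal_mult mult.assoc \<Gamma>_def)
  qed simp
qed

text \<open>The splitting \<open>f = f 1\<^bsub>s \<le> T\<^esub> + f 1\<^bsub>s > T\<^esub>\<close> with \<open>T\<close> = \<^term>\<open>scale n\<close>.\<close>

definition truncate :: "bool \<Rightarrow> int \<Rightarrow> (real \<times> 'a \<Rightarrow> 'b::zero) \<Rightarrow> real \<times> 'a \<Rightarrow> 'b" where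
  "truncate low n f z = (if fst z \<le> scale n \<longleftrightarrow> low then f z else 0)"

lemma modulus_rep_truncate:
  fixes f :: "real \<times> 'a::euclidean_space \<Rightarrow> complex"
  assumes "modulus_rep f u"
  shows "modulus_rep (truncate low n f) (truncate low n u)"
proof -
  have f: "f \<in> borel_measurable (lebesgue_on half_space)" and u [measurable]: "u \<in> borel_measurable borel"
    and AE: "AE z in lborel. 0 < fst z \<longrightarrow> u z = ennreal (norm (f z))"
    using assms by (auto simp: modulus_rep_def)
  have [measurable]: "(fst :: real \<times> 'a \<Rightarrow> real) \<in> borel_measurable borel"
    by (intro borel_measurable_continuous_onI continuous_intros)
  have "(fst :: real \<times> 'a \<Rightarrow> real) \<in> borel_measurable (lebesgue_on half_space)"
    by (intro measurable_restrict_space1 measurable_completion) simp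
  with f have "truncate low n f \<in> borel_measurable (lebesgue_on half_space)"
    unfolding truncate_def by measurable
  moreover have "truncate low n u \<in> borel_measurable borel"
    unfolding truncate_def by measurable
  moreover have "AE z in lborel. 0 < fst z \<longrightarrow> truncate low n u z = ennreal (norm (truncate low n f z))"
    using AE by eventually_elim (auto simp: truncate_def)
  ultimately show ?thesis by (simp add: modulus_rep_def)
qed

lemma wnorm_truncate_le:
  assumes "0 < p" "0 < r" "modulus_rep f u"
  shows "wnorm p r (truncate low n u) k \<le> wnorm p r u k"
proof -
  have b: "truncate low n u \<in> borel_measurable borel" "u \<in> borel_measurable borel"
    using modulus_rep_truncate[OF assms(3)] assms(3) by (auto simp: modulus_rep_def)
  show ?thesis unfolding wnorm_def
    using assms(1,2) b by (intro Lnorm_mono wavg_mono_AE) (auto simp: wavg_measurable_x truncate_def)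
qed

text \<open>A box at scale k lies strictly above half its scale and not above the scale itself. The
  high part therefore vanishes for all \<open>k \<le> n\<close>, whereas the low part does so once
  \<open>scale k\<close> has doubled, which eight steps guarantee.\<close>

lemma wnorm_truncate_eq_0:
  assumes "0 < p" "0 < r" "modulus_rep f u" and k: "if low then n + 8 \<le> k else k \<le> n"
  shows "wnorm p r (truncate low n u) k = 0"
proof -
  have b: "truncate low n u \<in> borel_measurable borel"
    using modulus_rep_truncate[OF assms(3)] by (auto simp: modulus_rep_def)
  have "truncate low n u z = 0" if z: "z \<in> wbox (scale k) x" for z x
  proof (cases low)
    case True
    have "2 \<le> exp (1::real)" using exp_ge_add_one_self[of 1] by simp
    then have "2 * scale n \<le> scale (n + 8)" by (simp add: scale_add) (simp add: scale_def)
    also have "\<dots> \<le> scale k" using k True by simp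
    finally show ?thesis using z True by (auto simp: mem_wbox truncate_def)
  next
    case False
    then have "scale k \<le> scale n" using k by simp
    then have "fst z \<le> scale n" using z unfolding mem_wbox by linarith
    then show ?thesis using False by (simp add: truncate_def)
  qed
  then have "wavg r 0 (truncate low n u) (scale k) x = 0" for x
    using assms(2) b by (intro wavg_eq_0) auto
  then have "wavg r 0 (truncate low n u) (scale k) = (\<lambda>x. 0)" by (rule ext)
  then show ?thesis by (simp only: wnorm_def Lnorm_zero[OF assms(1)])
qed

text \<open>With m = k - n, the truncation leaves only indices where \<eta>m is negative, up to
  eight steps. This overlap costs 2|\<eta>|, since m + |m| is at most 16; elsewhere |\<eta>||m|/8
  pays for two copies of \<delta>|m|, whence
  \<open>16 * \<delta> \<le> \<bar>\<eta>\<bar>\<close>.\<close>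

lemma truncation_exponent:
  fixes \<eta> \<delta> :: real and m :: int
  assumes "0 \<le> \<delta>" "16 * \<delta> \<le> \<bar>\<eta>\<bar>" "if 0 < \<eta> then m \<le> 8 else 0 \<le> m"
  shows "\<eta> / 8 * of_int m + \<delta> * \<bar>of_int m\<bar> \<le> 2 * \<bar>\<eta>\<bar> - \<delta> * \<bar>of_int m\<bar>"
proof -
  have "\<eta> * of_int m \<le> 16 * \<bar>\<eta>\<bar> - \<bar>\<eta>\<bar> * \<bar>of_int m\<bar>"
  proof (cases "0 < \<eta>")
    case True
    then have "of_int m + \<bar>of_int m\<bar> \<le> (16::real)" using assms(3) by simp
    from mult_left_mono[OF this, of \<eta>] show ?thesis using True by (simp add: algebra_simps)
  next
    case False
    then show ?thesis using assms(3) by simp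
  qed
  moreover have "16 * (\<delta> * \<bar>of_int m\<bar>) \<le> \<bar>\<eta>\<bar> * \<bar>of_int m\<bar>"
    using mult_right_mono[OF assms(2), of "\<bar>of_int m\<bar>"] by simp
  ultimately show ?thesis by linarith
qed

text \<open>The hypothesis allows the sequence to grow like e^(\<delta>|k-n|). Changing the weight
  from \<gamma> + \<eta> to \<gamma> brings in a factor e^(\<eta>k/8), small on the side kept by the
  truncation; it beats the growth and leaves decay at the same rate.\<close>

lemma truncated_weight_decay:
  fixes f :: "real \<times> 'a::euclidean_space \<Rightarrow> complex"
  assumes p: "0 < p" and r: "0 < r" and rep: "modulus_rep f u"
    and \<delta>: "0 \<le> \<delta>" "16 * \<delta> \<le> \<bar>\<eta>\<bar>" and B: "\<And>k. decay \<delta> (k - n) * (weight (\<gamma> + \<eta>) k * wnorm p r u k) \<le> B"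
  shows "weight \<gamma> k * wnorm p r (truncate (0 < \<eta>) n u) k
    \<le> ennreal (exp (2 * \<bar>\<eta>\<bar>)) * weight (- \<eta>) n * B * decay \<delta> (k - n)"
proof (cases "if 0 < \<eta> then n + 8 \<le> k else k \<le> n")
  case True
  then show ?thesis using wnorm_truncate_eq_0[OF p r rep, of "0 < \<eta>" n k] by simp
next
  case False
  let ?m = "k - n"
  let ?b = "weight (\<gamma> + \<eta>) k * wnorm p r u k"
  have "weight (- \<eta>) k * decay (- \<delta>) ?m \<le> ennreal (exp (2 * \<bar>\<eta>\<bar>)) * weight (- \<eta>) n * decay \<delta> ?m"
  proof -
    have "\<eta> / 8 * of_int ?m + \<delta> * \<bar>of_int ?m\<bar> \<le> 2 * \<bar>\<eta>\<bar> - \<delta> * \<bar>of_int ?m\<bar>"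
      using False by (intro truncation_exponent \<delta>) (auto split: if_splits)
    then have "\<eta> / 8 * of_int k + \<delta> * \<bar>of_int ?m\<bar> \<le> 2 * \<bar>\<eta>\<bar> + \<eta> / 8 * of_int n + - \<delta> * \<bar>of_int ?m\<bar>"
      by (simp add: algebra_simps diff_divide_distrib)
    then have "exp (\<eta> / 8 * of_int k) * exp (\<delta> * \<bar>of_int ?m\<bar>) \<le> exp (2 * \<bar>\<eta>\<bar>) * exp (\<eta> / 8 * of_int n) * exp (- \<delta> * \<bar>of_int ?m\<bar>)"
      by (simp only: exp_le_cancel_iff flip: exp_add)
    then show ?thesis by (simp add: weight_exp decay_def flip: ennreal_mult)
  qed
  note * = this
  have "weight \<gamma> k * wnorm p r (truncate (0 < \<eta>) n u) k \<le> weight \<gamma> k * wnorm p r u k"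
    by (intro mult_left_mono wnorm_truncate_le[OF p r rep]) simp
  also have "\<dots> = weight (- \<eta>) k * ?b"
    by (simp add: mult.assoc[symmetric] weight_add)
  also have "?b = decay (- \<delta>) ?m * (decay \<delta> ?m * ?b)"
    by (simp add: mult.assoc[symmetric] decay_add)
  also have "weight (- \<eta>) k * \<dots> = (weight (- \<eta>) k * decay (- \<delta>) ?m) * (decay \<delta> ?m * ?b)"
    by (simp only: mult.assoc)
  also have "\<dots> \<le> (ennreal (exp (2 * \<bar>\<eta>\<bar>)) * weight (- \<eta>) n * decay \<delta> ?m) * B"
    by (intro mult_mono * B) simp_all
  finally show ?thesis by (simp only: mult_ac)
qed

lemma K_functional_le_discrete:
  assumes p: "0 < p" and q0: "0 < q0" and q1: "0 < q1" and r: "0 < r"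
    and \<theta>: "0 < \<theta>" "\<theta> < 1" and ne: "\<beta>0 \<noteq> \<beta>1" and \<beta>: "\<beta> = (1 - \<theta>) * \<beta>0 + \<theta> * \<beta>1"
  shows "\<exists>C<top. \<exists>\<delta>>0. \<forall>(f :: real \<times> 'a::euclidean_space \<Rightarrow> complex) u n. modulus_rep f u \<longrightarrow>
    (SUP k. decay \<delta> (k - n) * (weight \<beta> k * wnorm p r u k)) < top \<longrightarrow>
    decomps (lebesgue_on half_space) (tent_space p q0 r \<beta>0) (tent_space p q1 r \<beta>1) f \<noteq> {} \<and>
    K_weighted (lebesgue_on half_space)
       (tent_space p q0 r \<beta>0) (tent_space p q1 r \<beta>1) \<theta> f (exp ((\<beta>1 - \<beta>0) / 8 * of_int n))
     \<le> C * (SUP k. decay \<delta> (k - n) * (weight \<beta> k * wnorm p r u k))"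
proof -
  define \<Gamma> where "\<Gamma> = \<beta>1 - \<beta>0"
  \<comment> \<open>The differences \<beta> - \<beta>0 and \<beta> - \<beta>1. They have opposite
    signs, and the part below the cut goes to the space whose difference is positive.\<close>
  define \<eta>0 \<eta>1 where "\<eta>0 = \<theta> * \<Gamma>" and "\<eta>1 = - ((1 - \<theta>) * \<Gamma>)"
  define \<delta> where "\<delta> = min \<bar>\<eta>0\<bar> \<bar>\<eta>1\<bar> / 16"
  have \<Gamma>: "\<Gamma> \<noteq> 0" using ne by (simp add: \<Gamma>_def)
  have \<delta>: "0 < \<delta>" "0 \<le> \<delta>" "16 * \<delta> \<le> \<bar>\<eta>0\<bar>" "16 * \<delta> \<le> \<bar>\<eta>1\<bar>"
    using \<Gamma> \<theta> by (auto simp: \<delta>_def \<eta>0_def \<eta>1_def)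
  have \<beta>': "\<beta> = \<beta>0 + \<eta>0" "\<beta> = \<beta>1 + \<eta>1" unfolding \<beta> \<eta>0_def \<eta>1_def \<Gamma>_def by (simp_all add: algebra_simps)
  \<comment> \<open>This makes the two truncations complementary, so that they add up to
    \<open>f\<close> for either ordering of \<beta>0 and \<beta>1.\<close>
  have sgn: "(0 < \<eta>1) = (\<not> 0 < \<eta>0)"
    using \<theta> \<Gamma> by (auto simp: \<eta>0_def \<eta>1_def zero_less_mult_iff mult_less_0_iff not_less)
  obtain C0 where C0: "C0 < top" and *: "\<And>(f :: real \<times> 'a \<Rightarrow> complex) u A n. modulus_rep f u \<Longrightarrow>
     (\<forall>k. weight \<beta>0 k * wnorm p r u k \<le> A * decay \<delta> (k - n)) \<Longrightarrow> tent_norm p q0 r \<beta>0 f \<le> C0 * A"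
    using tent_norm_decay[OF p q0 r \<delta>(1), of \<beta>0] by metis
  obtain C1 where C1: "C1 < top" and **: "\<And>(f :: real \<times> 'a \<Rightarrow> complex) u A n. modulus_rep f u \<Longrightarrow>
     (\<forall>k. weight \<beta>1 k * wnorm p r u k \<le> A * decay \<delta> (k - n)) \<Longrightarrow> tent_norm p q1 r \<beta>1 f \<le> C1 * A"
    using tent_norm_decay[OF p q1 r \<delta>(1), of \<beta>1] by metis
  let ?M = "lebesgue_on half_space :: (real \<times> 'a) measure"
  let ?X0 = "tent_space p q0 r \<beta>0" and ?X1 = "tent_space p q1 r \<beta>1"
  define C where "C = C0 * ennreal (exp (2 * \<bar>\<eta>0\<bar>)) + C1 * ennreal (exp (2 * \<bar>\<eta>1\<bar>))"
  have C: "C < top" using C0 C1 by (simp add: C_def ennreal_mult_less_top)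
  have main: "decomps ?M ?X0 ?X1 f \<noteq> {} \<and> K_weighted ?M ?X0 ?X1 \<theta> f (exp (\<Gamma> / 8 * of_int n)) \<le> C * B"
    if rep: "modulus_rep f u" and B: "B < top" "\<And>k. decay \<delta> (k - n) * (weight \<beta> k * wnorm p r u k) \<le> B"
    for f :: "real \<times> 'a \<Rightarrow> complex" and u n B
  proof -
    define f0 f1 where "f0 = truncate (0 < \<eta>0) n f" and "f1 = truncate (0 < \<eta>1) n f"
    let ?u0 = "truncate (0 < \<eta>0) n u" and ?u1 = "truncate (0 < \<eta>1) n u"
    have rep0: "modulus_rep f0 ?u0" and rep1: "modulus_rep f1 ?u1"
      unfolding f0_def f1_def by (intro modulus_rep_truncate rep)+
    have n0: "tent_norm p q0 r \<beta>0 f0 \<le> C0 * (ennreal (exp (2 * \<bar>\<eta>0\<bar>)) * weight (- \<eta>0) n * B)"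
      using B(2) by (intro *[OF rep0, of _ n] allI truncated_weight_decay[OF p r rep] \<delta>) (simp add: \<beta>'(1))
    have n1: "tent_norm p q1 r \<beta>1 f1 \<le> C1 * (ennreal (exp (2 * \<bar>\<eta>1\<bar>)) * weight (- \<eta>1) n * B)"
      using B(2) by (intro **[OF rep1, of _ n] allI truncated_weight_decay[OF p r rep] \<delta>) (simp add: \<beta>'(2))
    \<comment> \<open>Finiteness of \<open>B\<close> is what makes the two parts admissible.\<close>
    have "f0 \<in> elems ?X0" "f1 \<in> elems ?X1"
      using rep0 rep1 n0 n1 C0 C1 B(1)
      by (auto simp: tent_space_def modulus_rep_def ennreal_mult_less_top elim!: order.strict_trans1)
    moreover have "f z = f0 z + f1 z" for z
      using sgn by (auto simp: f0_def f1_def truncate_def)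
    ultimately have dec: "(f0, f1) \<in> decomps ?M ?X0 ?X1 f"
      by (simp add: decomps_def)
    let ?t = "exp (\<Gamma> / 8 * of_int n)"
    have t: "ennreal (?t powr - \<theta>) = weight \<eta>0 n" "ennreal ?t = weight (- \<Gamma>) n"
      by (simp_all add: weight_exp powr_def \<eta>0_def algebra_simps)
    \<comment> \<open>The powers of \<open>scale n\<close> from the sampling point and from the two
      truncation estimates cancel, so the resulting constant is free of n.\<close>
    have e1: "weight \<eta>0 n * (weight (- \<Gamma>) n * weight (- \<eta>1) n) = 1" "weight \<eta>0 n * weight (- \<eta>0) n = 1"
      by (simp_all add: weight_add) (simp_all add: weight_exp \<eta>0_def \<eta>1_def algebra_simps)
    have "K_weighted ?M ?X0 ?X1 \<theta> f ?t \<le> weight \<eta>0 n * (tent_norm p q0 r \<beta>0 f0 + weight (- \<Gamma>) n * tent_norm p q1 r \<beta>1 f1)"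
      unfolding K_weighted_def K_functional_def t
      using dec by (intro mult_left_mono INF_lower2[of "(f0, f1)"]) (auto simp: tent_space_def)
    also have "\<dots> \<le> weight \<eta>0 n * (C0 * (ennreal (exp (2 * \<bar>\<eta>0\<bar>)) * weight (- \<eta>0) n * B)
        + weight (- \<Gamma>) n * (C1 * (ennreal (exp (2 * \<bar>\<eta>1\<bar>)) * weight (- \<eta>1) n * B)))"
      by (intro mult_left_mono add_mono n0 n1) auto
    also have "\<dots> = (weight \<eta>0 n * weight (- \<eta>0) n) * (C0 * ennreal (exp (2 * \<bar>\<eta>0\<bar>)) * B)
        + (weight \<eta>0 n * (weight (- \<Gamma>) n * weight (- \<eta>1) n)) * (C1 * ennreal (exp (2 * \<bar>\<eta>1\<bar>)) * B)"
      by (simp only: distrib_left mult_ac)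
    also have "\<dots> = C * B"
      by (simp only: e1 C_def mult_1 distrib_right)
    finally show ?thesis using dec by auto
  qed
  show ?thesis
    using \<delta>(1) C main unfolding \<Gamma>_def
    by (intro exI[of _ C] exI[of _ \<delta>] conjI[OF C] conjI[OF \<delta>(1)] allI impI main[unfolded \<Gamma>_def])
       (auto intro: SUP_upper)
qed

text \<open>A finite Z-norm supplies the finite suprema that put the truncated parts into the tent
  spaces. Besides the norm estimate this yields a decomposition, which is membership in the sum
  space.\<close>

lemma interp_norm_equivalent:
  assumes p: "0 < p" and q: "0 < q" and q0: "0 < q0" and q1: "0 < q1" and r: "0 < r"
    and \<theta>: "0 < \<theta>" "\<theta> < 1" and ne: "\<beta>0 \<noteq> \<beta>1" and \<beta>: "\<beta> = (1 - \<theta>) * \<beta>0 + \<theta> * \<beta>1"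
  shows "\<exists>C<top. \<forall>f :: real \<times> 'a::euclidean_space \<Rightarrow> complex. f \<in> borel_measurable (lebesgue_on half_space) \<longrightarrow>
    Z_norm p q r \<beta> f \<le> C * interp_norm (lebesgue_on half_space) (tent_space p q0 r \<beta>0) (tent_space p q1 r \<beta>1) \<theta> q f \<and>
    (Z_norm p q r \<beta> f < top \<longrightarrow>
      interp_norm (lebesgue_on half_space) (tent_space p q0 r \<beta>0) (tent_space p q1 r \<beta>1) \<theta> q f \<le> C * Z_norm p q r \<beta> f \<and>
      decomps (lebesgue_on half_space) (tent_space p q0 r \<beta>0) (tent_space p q1 r \<beta>1) f \<noteq> {})"
proof -
  let ?M = "lebesgue_on half_space :: (real \<times> 'a) measure"
  let ?X0 = "tent_space p q0 r \<beta>0" and ?X1 = "tent_space p q1 r \<beta>1"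
  let ?cs = "Lnorm (count_space (UNIV :: int set)) q"
  define h where "h = (\<beta>1 - \<beta>0) / 8"
  have h: "h \<noteq> 0" using ne by (simp add: h_def)
  let ?N = "interp_norm ?M ?X0 ?X1 \<theta> q"
  let ?E = "\<lambda>f n. K_weighted ?M ?X0 ?X1 \<theta> f (exp (h * of_int n))"
  let ?b = "\<lambda>u k. weight \<beta> k * wnorm p r u k"
  obtain C1 where C1: "C1 < top" "\<And>f. ?N f \<le> C1 * ?cs (?E f)" "\<And>f. ?cs (?E f) \<le> C1 * ?N f"
    using interp_norm_discrete[OF \<theta> h q, of ?M ?X0 ?X1] by blast
  obtain C2 where C2: "C2 < top" "\<And>(f :: real \<times> 'a \<Rightarrow> complex) u k. modulus_rep f u \<Longrightarrow> ?b u k \<le> C2 * ?E f k"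
    using discrete_le_K_functional[OF p q0 q1 r \<beta>] unfolding h_def by blast
  obtain C3 \<delta> where C3: "C3 < top" "0 < \<delta>" "\<And>(f :: real \<times> 'a \<Rightarrow> complex) u n. modulus_rep f u \<Longrightarrow>
      (SUP k. decay \<delta> (k - n) * ?b u k) < top \<Longrightarrow>
      decomps ?M ?X0 ?X1 f \<noteq> {} \<and> ?E f n \<le> C3 * (SUP k. decay \<delta> (k - n) * ?b u k)"
    using K_functional_le_discrete[OF p q0 q1 r \<theta> ne \<beta>] unfolding h_def by blast
  obtain C4 where C4: "C4 < top" "\<And>(f :: real \<times> 'a \<Rightarrow> complex) u. modulus_rep f u \<Longrightarrow> Z_norm p q r \<beta> f \<le> C4 * ?cs (?b u)"
    using Z_norm_le_discrete[OF p q r, of \<beta>] by blast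
  obtain C5 where C5: "C5 < top" "\<And>(f :: real \<times> 'a \<Rightarrow> complex) u. modulus_rep f u \<Longrightarrow> ?cs (?b u) \<le> C5 * Z_norm p q r \<beta> f"
    using discrete_le_Z_norm[OF p q r, of \<beta>] by blast
  let ?A = "C4 * (C2 * C1)" and ?B = "C1 * (C3 * (decay_const q \<delta> * C5))"
  have dc: "decay_const q \<delta> < top" by (rule decay_const_finite[OF q C3(2)])
  show ?thesis
  proof (intro exI[of _ "?A + ?B"] conjI allI impI)
    show "?A + ?B < top"
      using C1(1) C2(1) C3(1) C4(1) C5(1) dc by (simp add: ennreal_mult_less_top)
    fix f :: "real \<times> 'a \<Rightarrow> complex" assume "f \<in> borel_measurable ?M"
    then obtain u where rep: "modulus_rep f u" by (rule modulus_rep_exists)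
    have "Z_norm p q r \<beta> f \<le> C4 * ?cs (?b u)" by (rule C4(2)[OF rep])
    also have "\<dots> \<le> C4 * ?cs (\<lambda>k. C2 * ?E f k)"
      using q C2(2)[OF rep] by (intro mult_left_mono Lnorm_mono) auto
    also have "\<dots> \<le> C4 * (C2 * ?cs (?E f))"
      using q by (intro mult_left_mono Lnorm_cmult_le) auto
    also have "\<dots> \<le> C4 * (C2 * (C1 * ?N f))"
      by (intro mult_left_mono C1(3)) auto
    also have "\<dots> \<le> (?A + ?B) * ?N f"
      by (simp add: distrib_right mult.assoc)
    finally show "Z_norm p q r \<beta> f \<le> (?A + ?B) * ?N f" .
    assume Z: "Z_norm p q r \<beta> f < top"
    define S where "S = (\<lambda>n. SUP k. decay \<delta> (k - n) * ?b u k)"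
    have S: "?cs S \<le> decay_const q \<delta> * (C5 * Z_norm p q r \<beta> f)"
      unfolding S_def using C3(2)
      by (intro order_trans[OF Lnorm_SUP_conv_le[OF q]] mult_left_mono C5(2)[OF rep]) auto
    also have "\<dots> < top" using dc C5(1) Z by (simp add: ennreal_mult_less_top)
    \<comment> \<open>An l^q quasi-norm dominates each of its entries, so the splitting is available
      at every height.\<close>
    finally have fin: "S n < top" for n
      using Lnorm_count_space_ge[OF q, of S n] by (rule order.strict_trans1[rotated])
    then show "decomps ?M ?X0 ?X1 f \<noteq> {}" using C3(3)[OF rep] unfolding S_def by blast
    have "?N f \<le> C1 * ?cs (?E f)" by (rule C1(2))
    also have "\<dots> \<le> C1 * ?cs (\<lambda>n. C3 * S n)"
      using q C3(3)[OF rep] fin unfolding S_def by (intro mult_left_mono Lnorm_mono) auto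
    also have "\<dots> \<le> C1 * (C3 * ?cs S)"
      using q by (intro mult_left_mono Lnorm_cmult_le) auto
    also have "\<dots> \<le> C1 * (C3 * (decay_const q \<delta> * (C5 * Z_norm p q r \<beta> f)))"
      by (intro mult_left_mono S) auto
    also have "\<dots> \<le> (?A + ?B) * Z_norm p q r \<beta> f"
      by (simp add: distrib_right mult.assoc)
    finally show "?N f \<le> (?A + ?B) * Z_norm p q r \<beta> f" .
  qed
qed

theorem proposition3p31:
  fixes p q q0 q1 r :: ennreal and \<beta>0 \<beta>1 \<beta> \<theta> :: real
  assumes "0 < p" and "0 < q" and "0 < q0" and "0 < q1" and "0 < r"
    and "\<beta>0 \<noteq> \<beta>1" and "\<theta> \<in> {0<..<1}"
    and "\<beta> = (1 - \<theta>) * \<beta>0 + \<theta> * \<beta>1"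
  shows "qn_equal
    (real_interp (lebesgue_on half_space)
       (tent_space p q0 r \<beta>0) (tent_space p q1 r \<beta>1) \<theta> q)
    (Z_space p q r \<beta> :: (real \<times> 'a::euclidean_space \<Rightarrow> complex) qnspace)"
proof -
  let ?M = "lebesgue_on half_space :: (real \<times> 'a) measure"
  let ?X0 = "tent_space p q0 r \<beta>0" and ?X1 = "tent_space p q1 r \<beta>1"
  let ?N = "interp_norm ?M ?X0 ?X1 \<theta> q" and ?Z = "Z_norm p q r \<beta>"
  obtain C where C: "C < top" and *: "\<And>f :: real \<times> 'a \<Rightarrow> complex. f \<in> borel_measurable ?M \<Longrightarrow>
    ?Z f \<le> C * ?N f \<and> (?Z f < top \<longrightarrow> ?N f \<le> C * ?Z f \<and> decomps ?M ?X0 ?X1 f \<noteq> {})"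
    using interp_norm_equivalent[OF assms(1-5) _ _ assms(6,8)] assms(7) by auto
  obtain c where c: "0 < c" "C \<le> ennreal c" using ennreal_finite_posE[OF C] .
  have elems: "elems (real_interp ?M ?X0 ?X1 \<theta> q) = elems (Z_space p q r \<beta>)"
  proof (intro set_eqI iffI)
    fix f assume "f \<in> elems (real_interp ?M ?X0 ?X1 \<theta> q)"
    then have f: "f \<in> borel_measurable ?M" "?N f < top"
      by (auto simp: real_interp_def sum_elems_def)
    have "?Z f \<le> C * ?N f" using *[OF f(1)] by simp
    also have "\<dots> < top" using C f(2) by (simp add: ennreal_mult_less_top)
    finally show "f \<in> elems (Z_space p q r \<beta>)" using f by (simp add: Z_space_def)
  next
    fix f :: "real \<times> 'a \<Rightarrow> complex" assume "f \<in> elems (Z_space p q r \<beta>)"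
    then have f: "f \<in> borel_measurable ?M" "?Z f < top"
      by (auto simp: Z_space_def)
    have "?N f \<le> C * ?Z f" using *[OF f(1)] f(2) by simp
    also have "\<dots> < top" using C f(2) by (simp add: ennreal_mult_less_top)
    finally show "f \<in> elems (real_interp ?M ?X0 ?X1 \<theta> q)"
      using f *[OF f(1)] by (simp add: real_interp_def sum_elems_def)
  qed
  have "ennreal (1 / c) * ?N f \<le> ?Z f \<and> ?Z f \<le> ennreal c * ?N f"
    if "f \<in> elems (real_interp ?M ?X0 ?X1 \<theta> q)" for f
  proof
    have f: "f \<in> borel_measurable ?M" "?Z f < top"
      using that unfolding elems by (auto simp: Z_space_def)
    have "?N f \<le> ennreal c * ?Z f"
      using *[OF f(1)] f(2) mult_right_mono[OF c(2), of "?Z f"] by (auto intro: order_trans)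
    then have "ennreal (1 / c) * ?N f \<le> ennreal (1 / c) * (ennreal c * ?Z f)"
      by (rule mult_left_mono) simp
    also have "\<dots> = ?Z f"
      using c(1) by (simp add: mult.assoc[symmetric] ennreal_mult[symmetric])
    finally show "ennreal (1 / c) * ?N f \<le> ?Z f" .
    show "?Z f \<le> ennreal c * ?N f"
      using *[OF f(1)] mult_right_mono[OF c(2), of "?N f"] by (auto intro: order_trans)
  qed
  then show ?thesis
    unfolding qn_equal_def using elems c(1)
    by (intro conjI exI[of _ "1 / c"] exI[of _ c]) (auto simp: real_interp_def Z_space_def)
qed

end
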